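(* Let $R\subset\mathbb R^N$ be a root system with multiplicity function $k\ge0$, and let $(X_t^{\lambda,Dunkl})_{t\ge0}$ be a Dunkl process on $\mathbb R^N$ of type $R$ with multiplicity $k$, drift $\lambda\in\mathbb R^N$ and start in $0\in\mathbb R^N$, defined on some probability space $(\Omega,\mathcal A,P)$. Then for each $T>0$, $(X_t^{\lambda,Dunkl})_{t\in[0,T]}$ is a Dunkl process without drift (of type $R$ with multiplicity $k$) with start in $0\in\mathbb R^N$ with respect to the probability measure $$\frac{e^{\|\lambda\|^2T/2}}{E_k(X_T^{\lambda,Dunkl},\lambda)}\cdot P$$ on $(\Omega,\mathcal A)$.
   Context: $\mathbb R^N$ carries the usual scalar product $\langle\cdot,\cdot\rangle$ (extended bilinearly to $\mathbb C^N$) and norm $\|\cdot\|$. A root system $R\subset\mathbb R^N\setminus\{0\}$ is a finite set with $\sigma_\alpha(R)=R$ for all $\alpha\in R$, where $\sigma_\alpha$ is the orthogonal reflection in the hyperplane $\alpha^\perp$; $W$ is the finite group generated by the $\sigma_\alpha$; $R_+\subset R$ is a fixed positive subsystem; $k:R\to[0,\infty)$ is a $W$-invariant multiplicity function; $\gamma=\sum_{\alpha\in R_+}k(\alpha)$. Dunkl operators: $T_\xi(k)f(x)=\partial_\xi f(x)+\sum_{\alpha\in R_+}k(\alpha)\langle\alpha,\xi\rangle\frac{f(x)-f(\sigma_\alpha x)}{\langle\alpha,x\rangle}$. For $w\in\mathbb C^N$ the Dunkl kernel $E_k(\cdot,w)$ is the unique holomorphic $f$ on $\mathbb C^N$ with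 $T_\xi(k)f=\langle\xi,w\rangle f$ for all $\xi\in\mathbb C^N$ and $f(0)=1$. Let $w_k(x)=\prod_{\alpha\in R_+}|\langle\alpha,x\rangle|^{2k(\alpha)}$ and $c_k>0$ with $c_k\int_{\mathbb R^N}e^{-\|y\|^2/2}w_k(y)\,dy=1$. A Dunkl process with drift $\lambda\in\mathbb R^N$ is a time-homogeneous Feller process on $\mathbb R^N$ with RCLL paths and transition kernels $$K_t^{\lambda,k,Dunkl}(x,A)=\frac{c_k\,e^{-\|\lambda\|^2t/2}}{t^{\gamma+N/2}}\int_Ae^{-(\|x\|^2+\|y\|^2)/(2t)}\,\frac{E_k(\frac x{\sqrt t},\frac y{\sqrt t})E_k(y,\lambda)}{E_k(x,\lambda)}\,w_k(y)\,dy\quad(t>0).$$ A Dunkl process without drift is the case $\lambda=0$ (where $E_k(\cdot,0)=1$). *)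

theory Defs
  imports "HOL-Probability.Probability"
begin

section \<open>Root systems and multiplicity functions\<close>

definition reflection :: "real^'n \<Rightarrow> real^'n \<Rightarrow> real^'n" where
  "reflection \<alpha> x = x - (2 * (\<alpha> \<bullet> x) / (\<alpha> \<bullet> \<alpha>)) *\<^sub>R \<alpha>"

definition root_system :: "(real^'n) set \<Rightarrow> bool" where
  "root_system R \<longleftrightarrow> finite R \<and> 0 \<notin> R \<and> (\<forall>\<alpha>\<in>R. reflection \<alpha> ` R = R)"

text \<open>The reflections are involutions, so closing under composition already gives the generated
  group.\<close>

inductive_set reflection_group :: "(real^'n) set \<Rightarrow> (real^'n \<Rightarrow> real^'n) set"
  for R :: "(real^'n) set" where
  id: "id \<in> reflection_group R"
| refl: "\<alpha> \<in> R \<Longrightarrow> w \<in> reflection_group R \<Longrightarrow> reflection \<alpha> \<circ> w \<in> reflection_group R"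

definition positive_subsystem :: "(real^'n) set \<Rightarrow> (real^'n) set \<Rightarrow> bool" where
  "positive_subsystem R Rp \<longleftrightarrow>
     (\<exists>\<beta>. (\<forall>\<alpha>\<in>R. \<alpha> \<bullet> \<beta> \<noteq> 0) \<and> Rp = {\<alpha>\<in>R. \<alpha> \<bullet> \<beta> > 0})"

definition multiplicity_function :: "(real^'n) set \<Rightarrow> (real^'n \<Rightarrow> real) \<Rightarrow> bool" where
  "multiplicity_function R k \<longleftrightarrow>
     (\<forall>\<alpha>\<in>R. k \<alpha> \<ge> 0) \<and> (\<forall>w\<in>reflection_group R. \<forall>\<alpha>\<in>R. k (w \<alpha>) = k \<alpha>)"


section \<open>Dunkl operators and the Dunkl kernel\<close>

definition cvec :: "real^'n \<Rightarrow> complex^'n" where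
  "cvec x = (\<chi> i. complex_of_real (x $ i))"

text \<open>The scalar product, extended bilinearly (not sesquilinearly) to complex vectors.\<close>

definition cbil :: "complex^'n \<Rightarrow> complex^'n \<Rightarrow> complex" where
  "cbil z w = (\<Sum>i\<in>UNIV. z $ i * w $ i)"

definition creflection :: "real^'n \<Rightarrow> complex^'n \<Rightarrow> complex^'n" where
  "creflection \<alpha> z = z - (2 * cbil (cvec \<alpha>) z / complex_of_real (\<alpha> \<bullet> \<alpha>)) *s cvec \<alpha>"

text \<open>Holomorphic in several variables: everywhere totally differentiable with a complex linear
  derivative.\<close>

definition holomorphic_Cn :: "(complex^'n \<Rightarrow> complex) \<Rightarrow> bool" where
  "holomorphic_Cn f \<longleftrightarrow>
     (\<forall>z. \<exists>D. (f has_derivative D) (at z) \<and> (\<forall>c v. D (c *s v) = c * D v))"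

text \<open>The quotient \<open>(f(z) - f(\<sigma>\<^sub>\<alpha> z)) / \<langle>\<alpha>, z\<rangle>\<close>. For holomorphic \<open>f\<close> the singularity on the
  hyperplane \<open>\<langle>\<alpha>, z\<rangle> = 0\<close> is removable, and the value there is the continuous extension.\<close>

definition dunkl_quotient :: "real^'n \<Rightarrow> (complex^'n \<Rightarrow> complex) \<Rightarrow> complex^'n \<Rightarrow> complex" where
  "dunkl_quotient \<alpha> f z =
     (if cbil (cvec \<alpha>) z = 0
      then 2 / complex_of_real (\<alpha> \<bullet> \<alpha>) * frechet_derivative f (at z) (cvec \<alpha>)
      else (f z - f (creflection \<alpha> z)) / cbil (cvec \<alpha>) z)"

definition dunkl_operator ::
  "(real^'n) set \<Rightarrow> (real^'n \<Rightarrow> real) \<Rightarrow> complex^'n \<Rightarrow> (complex^'n \<Rightarrow> complex) \<Rightarrow> complex^'n \<Rightarrow> complex"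
  where
  "dunkl_operator Rp k \<xi> f z =
     frechet_derivative f (at z) \<xi>
     + (\<Sum>\<alpha>\<in>Rp. complex_of_real (k \<alpha>) * cbil (cvec \<alpha>) \<xi> * dunkl_quotient \<alpha> f z)"

definition dunkl_kernel ::
  "(real^'n) set \<Rightarrow> (real^'n \<Rightarrow> real) \<Rightarrow> complex^'n \<Rightarrow> complex^'n \<Rightarrow> complex" where
  "dunkl_kernel Rp k z w =
     (THE f. holomorphic_Cn f \<and>
             (\<forall>\<xi> u. dunkl_operator Rp k \<xi> f u = cbil \<xi> w * f u) \<and>
             f 0 = 1) z"

text \<open>On real arguments the Dunkl kernel takes values in \<open>(0, \<infinity>)\<close>; \<open>Re\<close> only
  changes the type.\<close>

definition real_dunkl_kernel ::
  "(real^'n) set \<Rightarrow> (real^'n \<Rightarrow> real) \<Rightarrow> real^'n \<Rightarrow> real^'n \<Rightarrow> real" where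
  "real_dunkl_kernel Rp k x y = Re (dunkl_kernel Rp k (cvec x) (cvec y))"


section \<open>Transition kernels\<close>

text \<open>The case distinction is needed because \<open>0 powr 0 = 0\<close>.\<close>

definition dunkl_weight :: "(real^'n) set \<Rightarrow> (real^'n \<Rightarrow> real) \<Rightarrow> real^'n \<Rightarrow> real" where
  "dunkl_weight Rp k x =
     (\<Prod>\<alpha>\<in>Rp. if k \<alpha> = 0 then 1 else \<bar>\<alpha> \<bullet> x\<bar> powr (2 * k \<alpha>))"

definition dunkl_const :: "(real^'n) set \<Rightarrow> (real^'n \<Rightarrow> real) \<Rightarrow> real" where
  "dunkl_const Rp k = 1 / (LINT y|lborel. exp (- (norm y)\<^sup>2 / 2) * dunkl_weight Rp k y)"

text \<open>Only used for \<open>t > 0\<close>.\<close>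

definition dunkl_transition ::
  "(real^'n) set \<Rightarrow> (real^'n \<Rightarrow> real) \<Rightarrow> real^'n \<Rightarrow> real \<Rightarrow> real^'n \<Rightarrow> (real^'n) measure" where
  "dunkl_transition Rp k lam t x =
     density lborel (\<lambda>y. ennreal (
       dunkl_const Rp k * exp (- (norm lam)\<^sup>2 * t / 2)
         / t powr ((\<Sum>\<alpha>\<in>Rp. k \<alpha>) + real CARD('n) / 2)
       * exp (- ((norm x)\<^sup>2 + (norm y)\<^sup>2) / (2 * t))
       * (real_dunkl_kernel Rp k (x /\<^sub>R sqrt t) (y /\<^sub>R sqrt t) * real_dunkl_kernel Rp k y lam
          / real_dunkl_kernel Rp k x lam)
       * dunkl_weight Rp k y))"


section \<open>Feller processes\<close>

definition vanishing_continuous :: "(real^'n \<Rightarrow> real) set" where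
  "vanishing_continuous = {f. continuous_on UNIV f \<and> (f \<longlongrightarrow> 0) at_infinity}"

text \<open>Markov kernels \<open>K t\<close>, \<open>t > 0\<close> (with the identity understood at time \<open>0\<close>), which form a
  semigroup that preserves \<open>C\<^sub>0\<close> and is strongly continuous on it.\<close>

definition feller_semigroup :: "(real \<Rightarrow> real^'n \<Rightarrow> (real^'n) measure) \<Rightarrow> bool" where
  "feller_semigroup K \<longleftrightarrow>
     (\<forall>t>0. K t \<in> borel \<rightarrow>\<^sub>M prob_algebra borel) \<and>
     (\<forall>s>0. \<forall>t>0. \<forall>x. K (s + t) x = K s x \<bind> K t) \<and>
     (\<forall>t>0. \<forall>f\<in>vanishing_continuous. (\<lambda>x. LINT y|K t x. f y) \<in> vanishing_continuous) \<and>
     (\<forall>f\<in>vanishing_continuous. uniform_limit UNIV (\<lambda>t x. LINT y|K t x. f y) f (at_right 0))"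

text \<open>\<open>rcll_on I p\<close>: right-continuous with left limits, for paths with time set \<open>I\<close>
  (an interval).\<close>

definition rcll_on :: "real set \<Rightarrow> (real \<Rightarrow> 'b::topological_space) \<Rightarrow> bool" where
  "rcll_on I p \<longleftrightarrow>
     (\<forall>t\<in>I. continuous (at t within I \<inter> {t..}) p \<and>
            (\<exists>l. (p \<longlongrightarrow> l) (at t within I \<inter> {..<t})))"

definition natural_filtration ::
  "'a measure \<Rightarrow> real set \<Rightarrow> (real \<Rightarrow> 'a \<Rightarrow> 'b::topological_space) \<Rightarrow> real \<Rightarrow> 'a measure" where
  "natural_filtration M I X s =
     sigma (space M) {X u -` B \<inter> space M | u B. u \<in> I \<and> u \<le> s \<and> B \<in> sets borel}"

text \<open>A time-homogeneous Feller process with time set \<open>I\<close>, transition kernels \<open>K\<close>, RCLL paths and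
  start in \<open>x0\<close>; the Markov property refers to the natural filtration.\<close>

definition feller_process ::
  "'a measure \<Rightarrow> real set \<Rightarrow> (real \<Rightarrow> real^'n \<Rightarrow> (real^'n) measure) \<Rightarrow> real^'n
     \<Rightarrow> (real \<Rightarrow> 'a \<Rightarrow> real^'n) \<Rightarrow> bool" where
  "feller_process M I K x0 X \<longleftrightarrow>
     prob_space M \<and>
     feller_semigroup K \<and>
     (\<forall>t\<in>I. X t \<in> borel_measurable M) \<and>
     (\<forall>\<omega>\<in>space M. rcll_on I (\<lambda>t. X t \<omega>)) \<and>
     (AE \<omega> in M. X 0 \<omega> = x0) \<and>
     (\<forall>s\<in>I. \<forall>t\<in>I. s < t \<longrightarrow> (\<forall>A\<in>sets borel.
        AE \<omega> in M. real_cond_exp M (natural_filtration M I X s)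
                      (indicator (X t -` A \<inter> space M)) \<omega>
                    = measure (K (t - s) (X s \<omega>)) A))"

definition dunkl_process ::
  "'a measure \<Rightarrow> real set \<Rightarrow> (real^'n) set \<Rightarrow> (real^'n \<Rightarrow> real) \<Rightarrow> real^'n \<Rightarrow> real^'n
     \<Rightarrow> (real \<Rightarrow> 'a \<Rightarrow> real^'n) \<Rightarrow> bool" where
  "dunkl_process M I Rp k lam x0 X \<longleftrightarrow> feller_process M I (dunkl_transition Rp k lam) x0 X"

end

theory Submission
  imports Defs
begin

text \<open>
  Let \<open>E x = E\<^sub>k(x, \<lambda>)\<close>. The kernels with drift are the \<open>h\<close>-transforms of the driftless ones by
  the space-time function \<open>exp (- \<parallel>\<lambda>\<parallel>\<^sup>2 t / 2) E x\<close>, so that \<open>\<rho>\<^sub>t = exp (\<parallel>\<lambda>\<parallel>\<^sup>2 t / 2) / E (X\<^sub>t)\<close> is a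
  martingale with \<open>\<rho>\<^sub>0 = 1\<close>, and weighting by \<open>\<rho>\<^sub>T\<close> undoes the transform in the Markov property.

  For this the Dunkl kernel has to exist and to be positive. Existence: the homogeneous parts solve
  \<open>(n + \<gamma>) E\<^sub>n - \<Sum> k(\<alpha>) E\<^sub>n \<circ> \<sigma>\<^sub>\<alpha> = \<langle>\<cdot>, w\<rangle> E\<^sub>n\<^sub>-\<^sub>1\<close>, which is inverted by a nonnegative Neumann series on the
  reflection group. Applying \<open>T\<^sub>\<xi>\<close> to this equation, the defect \<open>T\<^sub>\<xi> E\<^sub>n - \<langle>\<xi>, w\<rangle> E\<^sub>n\<^sub>-\<^sub>1\<close> satisfies a
  maximum principle along \<open>W\<close>-orbits and vanishes. On rays, the values on an orbit solve a linear
  system with dissipative, cooperative reflection part; this gives uniqueness, and the bounds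
  \<open>exp (- \<parallel>x\<parallel> \<parallel>y\<parallel>) \<le> E\<^sub>k(x, y) \<le> exp (\<parallel>x\<parallel> \<parallel>y\<parallel>)\<close>.

  The Chapman-Kolmogorov equation and strong continuity of the driftless kernels are inherited from
  the kernels with drift. That the driftless kernels have total mass one follows from
  Chapman-Kolmogorov and Brownian scaling, without computing the Macdonald-type integral.
\<close>

section \<open>Complexified reflections and difference quotients\<close>

text \<open>The recursion for \<open>E\<^sub>n\<close> is the eigenvalue equation in the single
  direction \<xi> = z: there the factor <\<alpha>, z> cancels the denominators, and Euler's formula
  for homogeneous functions turns the derivative into the factor n. This one direction already
  determines the series, so the equations in all other directions remain to be proved; that is the
  purpose of the defect argument. The conclusion contains the full Feller property of the driftless
  kernels, while the hypotheses give it for the one drift \<open>lam\<close> only. Nonnegative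
  integrals can be transferred in both directions without integrability concerns, but two properties
  do not transfer. Total mass one is an integral identity that Chapman-Kolmogorov alone does not
  imply. Strong continuity is uniform in x, and the transfer factor \<open>E x lam\<close> is in
  general unbounded, so the transfer works on balls only and Gaussian tails must cover the rest.
  Even convergence of the Gaussian integral behind \<open>ck\<close> is extracted from the
  hypotheses: a divergent integral would have the default value 0, and the kernels with drift would
  be zero measures.\<close>

lemma cbil_commute: "cbil z w = cbil w z"
  by (simp add: cbil_def mult.commute)

lemma cbil_add_left: "cbil (z + z') w = cbil z w + cbil z' w"
  by (simp add: cbil_def algebra_simps sum.distrib)

lemma cbil_diff_left: "cbil (z - z') w = cbil z w - cbil z' w"
  by (simp add: cbil_def algebra_simps sum_subtractf)

lemma cbil_smult_left: "cbil (c *s z) w = c * cbil z w"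
  by (simp add: cbil_def algebra_simps sum_distrib_left)

lemma cbil_add_right: "cbil w (z + z') = cbil w z + cbil w z'"
  and cbil_diff_right: "cbil w (z - z') = cbil w z - cbil w z'"
  and cbil_smult_right: "cbil w (c *s z) = c * cbil w z"
  by (simp_all add: cbil_commute[of w] cbil_add_left cbil_diff_left cbil_smult_left)

lemmas cbil_simps = cbil_add_left cbil_diff_left cbil_smult_left
  cbil_add_right cbil_diff_right cbil_smult_right

lemma cbil_zero [simp]: "cbil 0 w = 0" "cbil w 0 = 0"
  by (simp_all add: cbil_def)

lemma scaleR_eq_smult: "r *\<^sub>R (z :: complex^'n) = complex_of_real r *s z"
  by (simp add: vec_eq_iff scaleR_conv_of_real[symmetric] vector_scalar_mult_def)

lemma norm_cbil_le: "norm (cbil z w) \<le> norm z * norm w"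
proof -
  have "norm (cbil z w) \<le> (\<Sum>i\<in>UNIV. \<bar>norm (z $ i)\<bar> * \<bar>norm (w $ i)\<bar>)"
    unfolding cbil_def by (rule sum_norm_le) (simp add: norm_mult)
  also have "\<dots> \<le> norm z * norm w"
    unfolding norm_vec_def by (rule L2_set_mult_ineq)
  finally show ?thesis .
qed

lemma bounded_linear_cbil_left: "bounded_linear (\<lambda>z. cbil z w)"
  by (rule bounded_linear_intro[where K = "norm w"])
     (simp_all add: cbil_add_left scaleR_eq_smult cbil_smult_left scaleR_conv_of_real norm_cbil_le)

lemmas has_derivative_cbil_left = bounded_linear.has_derivative[OF bounded_linear_cbil_left]

lemma continuous_on_cbil [continuous_intros]:
  "continuous_on S f \<Longrightarrow> continuous_on S g \<Longrightarrow> continuous_on S (\<lambda>x. cbil (f x) (g x))"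
  unfolding cbil_def by (intro continuous_intros)

lemma cbil_cvec [simp]: "cbil (cvec x) (cvec y) = complex_of_real (x \<bullet> y)"
  by (simp add: cbil_def cvec_def inner_vec_def)

lemma cvec_simps:
  "cvec (x + y) = cvec x + cvec y" "cvec (x - y) = cvec x - cvec y"
  "cvec (r *\<^sub>R x) = complex_of_real r *s cvec x" "cvec (- x) = - cvec x" "cvec 0 = 0"
  by (simp_all add: cvec_def vec_eq_iff)

lemma norm_cvec [simp]: "norm (cvec x) = norm x"
  by (simp add: cvec_def norm_vec_def)

lemma bounded_linear_cvec: "bounded_linear (cvec :: real^'n \<Rightarrow> complex^'n)"
  by (rule bounded_linear_intro[where K = 1]) (simp_all add: cvec_simps scaleR_eq_smult)

lemma continuous_on_cvec [continuous_intros]: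
  "continuous_on S f \<Longrightarrow> continuous_on S (\<lambda>x. cvec (f x))"
  using bounded_linear.continuous_on[OF bounded_linear_cvec] .

lemma cvec_Re_Im: "z = cvec (\<chi> i. Re (z $ i)) + \<i> *s cvec (\<chi> i. Im (z $ i))"
  by (simp add: cvec_def vec_eq_iff complex_eq[symmetric])

lemma creflection_add: "creflection \<alpha> (z + w) = creflection \<alpha> z + creflection \<alpha> w"
  by (simp add: creflection_def cbil_simps vec_eq_iff field_simps add_divide_distrib)

lemma creflection_smult: "creflection \<alpha> (c *s z) = c *s creflection \<alpha> z"
  by (simp add: creflection_def cbil_simps vec_eq_iff algebra_simps)

lemma creflection_cvec: "creflection \<alpha> (cvec x) = cvec (reflection \<alpha> x)"
  by (simp add: creflection_def reflection_def cvec_simps)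

lemma cbil_creflection:
  assumes "\<alpha> \<noteq> 0"
  shows "cbil (creflection \<alpha> z) (creflection \<alpha> w) = cbil z w"
  using assms
  by (simp add: creflection_def cbil_simps cbil_commute[of z] field_simps power2_eq_square)

lemma creflection_creflection [simp]:
  assumes "\<alpha> \<noteq> 0"
  shows "creflection \<alpha> (creflection \<alpha> z) = z"
proof -
  have "creflection \<alpha> (z + (- c) *s cvec \<alpha>) = creflection \<alpha> z + c *s cvec \<alpha>" for c
  proof -
    have "reflection \<alpha> \<alpha> = - \<alpha>"
      using assms by (simp add: reflection_def vec_eq_iff)
    hence "creflection \<alpha> (cvec \<alpha>) = - cvec \<alpha>"
      by (simp only: creflection_cvec cvec_simps)
    thus ?thesis by (simp only: creflection_add creflection_smult) (simp add: vec_eq_iff)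
  qed
  from this[of "2 * cbil (cvec \<alpha>) z / complex_of_real (\<alpha> \<bullet> \<alpha>)"]
  show ?thesis by (simp add: creflection_def vec_eq_iff)
qed

lemma creflection_eqI: "cbil (cvec \<alpha>) z = 0 \<Longrightarrow> creflection \<alpha> z = z"
  by (simp add: creflection_def)

lemma creflection_uminus: "creflection (- \<alpha>) z = creflection \<alpha> z"
  by (simp add: creflection_def cvec_simps cbil_def sum_negf vec_eq_iff)

text \<open>The bilinear form is not the Hermitian product, so its invariance does not give this
  directly. As \<alpha> is real, the reflection commutes with complex conjugation, and the squared
  norm of \<open>z\<close> is the bilinear form of \<open>z\<close> with its conjugate.\<close>

lemma norm_creflection [simp]:
  fixes z :: "complex^'n"
  assumes "\<alpha> \<noteq> 0"
  shows "norm (creflection \<alpha> z) = norm z"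
proof -
  define cj :: "complex^'n \<Rightarrow> complex^'n" where "cj z = (\<chi> i. cnj (z $ i))" for z
  have norm_cj: "cbil z (cj z) = complex_of_real ((norm z)\<^sup>2)" for z
    by (simp add: cbil_def cj_def norm_vec_def L2_set_def complex_norm_square[symmetric] sum_nonneg)
  have "cj (creflection \<alpha> z) = creflection \<alpha> (cj z)"
    by (simp add: cj_def creflection_def cbil_def cvec_def vec_eq_iff)
  hence "complex_of_real ((norm (creflection \<alpha> z))\<^sup>2) = complex_of_real ((norm z)\<^sup>2)"
    unfolding norm_cj[symmetric] using cbil_creflection[OF assms] by simp
  hence "(norm (creflection \<alpha> z))\<^sup>2 = (norm z)\<^sup>2" using of_real_eq_iff by blast
  thus ?thesis by simp
qed

lemma bounded_linear_creflection: "\<alpha> \<noteq> 0 \<Longrightarrow> bounded_linear (creflection \<alpha>)"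
  by (rule bounded_linear_intro[where K = 1])
     (simp_all add: creflection_add scaleR_eq_smult creflection_smult)

lemma reflection_reflection [simp]: "\<alpha> \<noteq> 0 \<Longrightarrow> reflection \<alpha> (reflection \<alpha> x) = x"
  by (simp add: reflection_def inner_simps)

lemma inner_reflection: "\<alpha> \<noteq> 0 \<Longrightarrow> reflection \<alpha> x \<bullet> reflection \<alpha> y = x \<bullet> y"
  by (simp add: reflection_def inner_simps inner_commute field_simps)

text \<open>Conjugating a reflection by \<beta> gives the reflection in the reflected root; this is
  the source of all equivariance statements below.\<close>

lemma creflection_conj:
  assumes "\<beta> \<noteq> 0"
  shows "creflection \<beta> (creflection \<alpha> z) = creflection (reflection \<beta> \<alpha>) (creflection \<beta> z)"
proof -
  have 1: "cbil (cvec (reflection \<beta> \<alpha>)) (creflection \<beta> z) = cbil (cvec \<alpha>) z"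
    using cbil_creflection[OF assms, of "cvec \<alpha>" z] by (simp add: creflection_cvec)
  have 2: "creflection \<beta> (z + (- c) *s cvec \<alpha>) = creflection \<beta> z + (- c) *s cvec (reflection \<beta> \<alpha>)" for c
    by (simp only: creflection_add creflection_smult creflection_cvec)
  have 3: "creflection \<alpha> z = z + (- (2 * cbil (cvec \<alpha>) z / complex_of_real (\<alpha> \<bullet> \<alpha>))) *s cvec \<alpha>"
    by (simp add: creflection_def vec_eq_iff)
  show ?thesis
    unfolding 3 2
    by (simp add: creflection_def[of "reflection \<beta> \<alpha>"] 1 inner_reflection[OF assms] vec_eq_iff)
qed

section \<open>Difference quotients: products, reflections, sign changes, linear
  combinations\<close>

abbreviation cderiv :: "(complex^'n \<Rightarrow> complex) \<Rightarrow> complex^'n \<Rightarrow> complex^'n \<Rightarrow> complex" where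
  "cderiv f z \<equiv> frechet_derivative f (at z)"

lemma cderiv_eq: "(f has_derivative f') (at z) \<Longrightarrow> cderiv f z = f'"
  by (rule frechet_derivative_at[symmetric])

lemma holomorphic_Cn_has_derivative:
  "holomorphic_Cn f \<Longrightarrow> (f has_derivative cderiv f z) (at z)"
  unfolding holomorphic_Cn_def by (metis frechet_derivative_works differentiable_def)

lemma holomorphic_Cn_smult:
  assumes "holomorphic_Cn f"
  shows "cderiv f z (c *s v) = c * cderiv f z v"
  using assms unfolding holomorphic_Cn_def by (metis frechet_derivative_at)

text \<open>On the hyperplane both sides vanish, since the reflection fixes \<open>z\<close> there.
  Hence no singularity survives when T is taken in the direction of the base point.\<close>

lemma dunkl_quotient_mult:
  "cbil (cvec \<alpha>) z * dunkl_quotient \<alpha> f z = f z - f (creflection \<alpha> z)"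
  by (simp add: dunkl_quotient_def creflection_eqI)

text \<open>Off the hyperplane, <\<sigma>z, w> differs from <z, w> by a multiple of <\<alpha>, z>,
  and the division leaves the extra term. On it, the product rule for the derivative along \<alpha>
  gives the same formula.\<close>

lemma dunkl_quotient_cbil_mult:
  assumes f: "(f has_derivative f') (at z)" and "\<alpha> \<noteq> 0"
  shows "dunkl_quotient \<alpha> (\<lambda>z. cbil z w * f z) z
    = cbil z w * dunkl_quotient \<alpha> f z
      + 2 * cbil (cvec \<alpha>) w / complex_of_real (\<alpha> \<bullet> \<alpha>) * f (creflection \<alpha> z)"
proof (cases "cbil (cvec \<alpha>) z = 0")
  case True
  have d: "((\<lambda>z. cbil z w * f z) has_derivative (\<lambda>h. cbil z w * f' h + cbil h w * f z)) (at z)"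
    by (rule has_derivative_mult[OF has_derivative_cbil_left[OF has_derivative_ident] f])
  show ?thesis
    using True assms(2) unfolding dunkl_quotient_def
    by (simp only: cderiv_eq[OF d] cderiv_eq[OF f] creflection_eqI[OF True] if_True) (simp add: field_simps)
next
  case False
  have A: "cbil (creflection \<alpha> z) w = cbil z w - 2 * cbil (cvec \<alpha>) z / complex_of_real (\<alpha> \<bullet> \<alpha>) * cbil (cvec \<alpha>) w"
    by (simp add: creflection_def cbil_simps)
  show ?thesis using False assms(2) unfolding dunkl_quotient_def A
    by (simp add: field_simps)
qed

lemma cderiv_compose_creflection:
  assumes f: "\<And>z. (f has_derivative f' z) (at z)" and b: "\<beta> \<noteq> 0"
  shows "cderiv (\<lambda>z. f (creflection \<beta> z)) z \<xi> = cderiv f (creflection \<beta> z) (creflection \<beta> \<xi>)"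
proof -
  have "((\<lambda>z. f (creflection \<beta> z)) has_derivative (\<lambda>h. f' (creflection \<beta> z) (creflection \<beta> h))) (at z)"
    by (rule has_derivative_compose[OF bounded_linear_imp_has_derivative[OF bounded_linear_creflection[OF b]] f])
  from cderiv_eq[OF this] cderiv_eq[OF f] show ?thesis by simp
qed

lemma dunkl_quotient_compose_creflection:
  assumes f: "\<And>z. (f has_derivative f' z) (at z)" and b: "\<beta> \<noteq> 0"
  shows "dunkl_quotient \<alpha> (\<lambda>z. f (creflection \<beta> z)) z
    = dunkl_quotient (reflection \<beta> \<alpha>) f (creflection \<beta> z)"
proof -
  have 1: "cbil (cvec (reflection \<beta> \<alpha>)) (creflection \<beta> z) = cbil (cvec \<alpha>) z"
    using cbil_creflection[OF b, of "cvec \<alpha>" z] by (simp add: creflection_cvec)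
  show ?thesis
    unfolding dunkl_quotient_def 1 cderiv_compose_creflection[OF f b] creflection_cvec
    by (simp add: inner_reflection[OF b] creflection_conj[OF b])
qed

text \<open>Together with the sign of <\<alpha>, \<xi>> this makes the summands of a Dunkl operator
  even in \<alpha>, so that sums over \<open>Rp\<close> can be treated as half sums over
  \<open>R\<close>.\<close>

lemma dunkl_quotient_uminus:
  assumes f: "(f has_derivative f') (at z)"
  shows "dunkl_quotient (- \<alpha>) f z = - dunkl_quotient \<alpha> f z"
proof -
  have "f' (- cvec \<alpha>) = - f' (cvec \<alpha>)"
    by (rule linear_neg[OF has_derivative_linear[OF f]])
  moreover have "cbil (cvec (- \<alpha>)) z = - cbil (cvec \<alpha>) z"
    by (simp add: cvec_simps cbil_def sum_negf)
  ultimately show ?thesis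
    by (simp add: dunkl_quotient_def cderiv_eq[OF f] creflection_uminus cvec_simps)
qed

lemma dunkl_quotient_lincomb:
  assumes f: "\<And>i. i \<in> I \<Longrightarrow> (f i has_derivative f' i) (at z)"
  shows "dunkl_quotient \<alpha> (\<lambda>z. \<Sum>i\<in>I. c i * f i z) z = (\<Sum>i\<in>I. c i * dunkl_quotient \<alpha> (f i) z)"
proof -
  have d: "((\<lambda>z. \<Sum>i\<in>I. c i * f i z) has_derivative (\<lambda>h. \<Sum>i\<in>I. c i * f' i h)) (at z)"
    by (intro has_derivative_sum has_derivative_mult_right f)
  show ?thesis
    unfolding dunkl_quotient_def cderiv_eq[OF d]
    using cderiv_eq[OF f]
    by (auto simp: sum_distrib_left sum_divide_distrib sum_subtractf algebra_simps diff_divide_distrib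
        intro!: sum.cong)
qed

section \<open>The reflection group and its resolvent\<close>

text \<open>The complexified action of \<open>reflection_group R\<close>. Sums below run over these
  maps rather than over the points of an orbit, so stabilisers need no attention.\<close>

inductive_set complex_reflection_group :: "(real^'n) set \<Rightarrow> (complex^'n \<Rightarrow> complex^'n) set"
  for R :: "(real^'n) set" where
  CW_id: "id \<in> complex_reflection_group R"
| CW_left: "\<alpha> \<in> R \<Longrightarrow> v \<in> complex_reflection_group R \<Longrightarrow> creflection \<alpha> \<circ> v \<in> complex_reflection_group R"

locale dunkl_system =
  fixes R Rp :: "(real^'n) set" and k :: "real^'n \<Rightarrow> real"
  assumes root_system: "root_system R"
    and positive_subsystem: "positive_subsystem R Rp"
    and multiplicity_function: "multiplicity_function R k"
begin

lemma finite_R [simp]: "finite R"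
  using root_system by (simp add: root_system_def)

lemma Rp_subset: "\<alpha> \<in> Rp \<Longrightarrow> \<alpha> \<in> R"
  using positive_subsystem by (auto simp: positive_subsystem_def)

lemma finite_Rp [simp]: "finite Rp"
  using finite_subset[OF _ finite_R] Rp_subset by blast

lemma R_nonzero: "\<alpha> \<in> R \<Longrightarrow> \<alpha> \<noteq> 0"
  using root_system by (auto simp: root_system_def)

lemma Rp_nonzero: "\<alpha> \<in> Rp \<Longrightarrow> \<alpha> \<noteq> 0"
  using R_nonzero Rp_subset by blast

lemma k_nonneg: "\<alpha> \<in> Rp \<Longrightarrow> 0 \<le> k \<alpha>"
  using multiplicity_function Rp_subset by (auto simp: multiplicity_function_def)

lemma reflection_R: "\<beta> \<in> R \<Longrightarrow> \<alpha> \<in> R \<Longrightarrow> reflection \<beta> \<alpha> \<in> R"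
  using root_system by (auto simp: root_system_def)

lemma k_reflection: "\<beta> \<in> R \<Longrightarrow> \<alpha> \<in> R \<Longrightarrow> k (reflection \<beta> \<alpha>) = k \<alpha>"
  using multiplicity_function reflection_group.refl[OF _ reflection_group.id, of \<beta> R]
  unfolding multiplicity_function_def by fastforce

lemma reflection_self: "\<alpha> \<noteq> 0 \<Longrightarrow> reflection \<alpha> \<alpha> = - \<alpha>"
  by (simp add: reflection_def vec_eq_iff)

lemma uminus_R: "\<alpha> \<in> R \<Longrightarrow> - \<alpha> \<in> R"
  using reflection_R[of \<alpha> \<alpha>] R_nonzero[of \<alpha>] by (simp add: reflection_self)

lemma k_uminus: "\<alpha> \<in> R \<Longrightarrow> k (- \<alpha>) = k \<alpha>"
  using k_reflection[of \<alpha> \<alpha>] R_nonzero[of \<alpha>] by (simp add: reflection_self)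

lemma sum_Rp_even:
  fixes F :: "real^'n \<Rightarrow> complex"
  assumes even: "\<And>\<alpha>. \<alpha> \<in> R \<Longrightarrow> F (- \<alpha>) = F \<alpha>"
  shows "2 * (\<Sum>\<alpha>\<in>Rp. F \<alpha>) = (\<Sum>\<alpha>\<in>R. F \<alpha>)"
proof -
  obtain \<beta> where b: "\<And>\<alpha>. \<alpha> \<in> R \<Longrightarrow> \<alpha> \<bullet> \<beta> \<noteq> 0" and Rp: "Rp = {\<alpha>\<in>R. \<alpha> \<bullet> \<beta> > 0}"
    using positive_subsystem by (auto simp: positive_subsystem_def)
  have R: "R = Rp \<union> uminus ` Rp"
  proof (intro set_eqI iffI)
    fix \<alpha> assume a: "\<alpha> \<in> R"
    show "\<alpha> \<in> Rp \<union> uminus ` Rp"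
    proof (cases "\<alpha> \<bullet> \<beta> > 0")
      case False
      hence "- \<alpha> \<in> Rp" using a b[OF a] uminus_R[OF a] by (auto simp: Rp)
      hence "- (- \<alpha>) \<in> uminus ` Rp" by (rule imageI)
      thus ?thesis by simp
    qed (use a in \<open>simp add: Rp\<close>)
  next
    fix \<alpha> assume "\<alpha> \<in> Rp \<union> uminus ` Rp"
    thus "\<alpha> \<in> R" using Rp_subset uminus_R by auto
  qed
  have "(\<Sum>\<alpha>\<in>R. F \<alpha>) = (\<Sum>\<alpha>\<in>Rp. F \<alpha>) + (\<Sum>\<alpha>\<in>uminus ` Rp. F \<alpha>)"
    by (subst R, rule sum.union_disjoint) (auto simp: Rp)
  also have "(\<Sum>\<alpha>\<in>uminus ` Rp. F \<alpha>) = (\<Sum>\<alpha>\<in>Rp. F \<alpha>)"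
    by (subst sum.reindex) (auto simp: inj_on_def even Rp_subset)
  finally show ?thesis by simp
qed

text \<open>A reflection permutes \<open>R\<close> but not \<open>Rp\<close>. Evenness allows the
  detour through the sum over all of \<open>R\<close>, which counts everything twice.\<close>

lemma sum_Rp_reflection:
  fixes F :: "real^'n \<Rightarrow> complex"
  assumes even: "\<And>\<alpha>. \<alpha> \<in> R \<Longrightarrow> F (- \<alpha>) = F \<alpha>" and b: "\<beta> \<in> R"
  shows "(\<Sum>\<alpha>\<in>Rp. F (reflection \<beta> \<alpha>)) = (\<Sum>\<alpha>\<in>Rp. F \<alpha>)"
proof -
  have neg: "reflection \<beta> (- \<alpha>) = - reflection \<beta> \<alpha>" for \<alpha>
    by (simp add: reflection_def vec_eq_iff)
  have "2 * (\<Sum>\<alpha>\<in>Rp. F (reflection \<beta> \<alpha>)) = (\<Sum>\<alpha>\<in>R. F (reflection \<beta> \<alpha>))"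
    by (rule sum_Rp_even) (simp add: neg even b reflection_R)
  also have "\<dots> = (\<Sum>\<alpha>\<in>R. F \<alpha>)"
    by (rule sum.reindex_bij_witness[where i = "reflection \<beta>" and j = "reflection \<beta>"])
       (use b in \<open>auto simp: reflection_R R_nonzero\<close>)
  also have "\<dots> = 2 * (\<Sum>\<alpha>\<in>Rp. F \<alpha>)"
    by (rule sum_Rp_even[symmetric]) (rule even)
  finally show ?thesis by simp
qed

section \<open>The complexified reflection group and its finiteness\<close>

abbreviation CW :: "(complex^'n \<Rightarrow> complex^'n) set" where
  "CW \<equiv> complex_reflection_group R"

lemma CW_right:
  assumes "v \<in> CW" "\<alpha> \<in> R"
  shows "v \<circ> creflection \<alpha> \<in> CW"
  using assms
proof induction
  case CW_id
  show ?case using complex_reflection_group.CW_left[OF CW_id complex_reflection_group.CW_id] by simp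
next
  case (CW_left \<beta> v)
  show ?case using complex_reflection_group.CW_left[OF CW_left.hyps(1) CW_left.IH[OF CW_left.prems]] by (simp only: comp_assoc)
qed

lemma CW_bounded_linear: "v \<in> CW \<Longrightarrow> bounded_linear v"
proof (induction rule: complex_reflection_group.induct)
  case CW_id
  show ?case unfolding id_def by (rule bounded_linear_ident)
next
  case (CW_left \<alpha> v)
  thus ?case unfolding comp_def
    using bounded_linear_compose bounded_linear_creflection R_nonzero by blast
qed

lemma CW_smult: "v \<in> CW \<Longrightarrow> v (c *s z) = c *s v z"
  by (induction rule: complex_reflection_group.induct) (auto simp: creflection_smult)

lemma CW_norm [simp]: "v \<in> CW \<Longrightarrow> norm (v z) = norm z"
  by (induction rule: complex_reflection_group.induct) (auto simp: R_nonzero)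

text \<open>Orbits of real points stay real, so that the eigenvalue factor along them is a real
  number; the order argument in \<open>E_ge\<close> depends on this.\<close>

lemma CW_cvec: "v \<in> CW \<Longrightarrow> \<exists>x'. v (cvec x) = cvec x'"
  by (induction rule: complex_reflection_group.induct) (auto simp: creflection_cvec)

lemma CW_roots: "v \<in> CW \<Longrightarrow> \<alpha> \<in> R \<Longrightarrow> v (cvec \<alpha>) \<in> cvec ` R"
  by (induction rule: complex_reflection_group.induct) (auto simp: creflection_cvec reflection_R)

lemma CW_orthogonal: "v \<in> CW \<Longrightarrow> (\<And>\<alpha>. \<alpha> \<in> R \<Longrightarrow> \<alpha> \<bullet> x = 0) \<Longrightarrow> v (cvec x) = cvec x"
  by (induction rule: complex_reflection_group.induct) (auto simp: creflection_eqI)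

text \<open>Both maps agree on the span of the roots and fix its orthogonal complement pointwise;
  real vectors then determine a complex linear map by \<open>cvec_Re_Im\<close>.\<close>

lemma CW_eqI:
  assumes v: "v \<in> CW" and v': "v' \<in> CW"
    and eq: "\<And>\<alpha>. \<alpha> \<in> R \<Longrightarrow> v (cvec \<alpha>) = v' (cvec \<alpha>)"
  shows "v = v'"
proof
  fix z
  note lin = linear_simps[OF CW_bounded_linear[OF v]] linear_simps[OF CW_bounded_linear[OF v']]
  have real: "v (cvec x) = v' (cvec x)" for x
  proof -
    have "subspace {x. v (cvec x) = v' (cvec x)}"
      by (auto simp: subspace_def cvec_simps lin CW_smult[OF v] CW_smult[OF v'])
    hence span: "v (cvec x) = v' (cvec x)" if "x \<in> span R" for x
      using span_minimal[of R "{x. v (cvec x) = v' (cvec x)}"] eq that by blast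
    obtain p q where p: "p \<in> span R" and q: "\<And>w. w \<in> span R \<Longrightarrow> orthogonal q w" and x: "x = p + q"
      using orthogonal_subspace_decomp_exists[of R x] by metis
    have orth: "\<alpha> \<bullet> q = 0" if "\<alpha> \<in> R" for \<alpha>
      using q[OF span_base[OF that]] by (simp add: orthogonal_def inner_commute)
    have "v (cvec q) = v' (cvec q)"
      using CW_orthogonal[OF v orth] CW_orthogonal[OF v' orth] by simp
    thus ?thesis using span[OF p] by (simp add: x cvec_simps lin)
  qed
  show "v z = v' z"
    by (subst (1 2) cvec_Re_Im[of z]) (simp only: lin CW_smult[OF v] CW_smult[OF v'] real)
qed

text \<open>The group acts faithfully on the roots by \<open>CW_eqI\<close>, hence embeds into the
  self-maps of a finite set.\<close>

lemma finite_CW [simp]: "finite CW"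
proof (rule finite_imageD)
  let ?res = "\<lambda>v. restrict v (cvec ` R)"
  have "?res ` CW \<subseteq> (cvec ` R) \<rightarrow>\<^sub>E (cvec ` R)" using CW_roots by auto
  thus "finite (?res ` CW)"
    by (rule finite_subset) (rule finite_PiE, auto)
  show "inj_on ?res CW"
  proof (rule inj_onI)
    fix v v' assume v: "v \<in> CW" "v' \<in> CW" and eq: "?res v = ?res v'"
    show "v = v'"
    proof (rule CW_eqI[OF v])
      fix \<alpha> assume "\<alpha> \<in> R"
      thus "v (cvec \<alpha>) = v' (cvec \<alpha>)"
        using fun_cong[OF eq, of "cvec \<alpha>"] by simp
    qed
  qed
qed

lemma creflection_comp_self: "\<alpha> \<in> R \<Longrightarrow> creflection \<alpha> \<circ> creflection \<alpha> = id"
  by (auto simp: fun_eq_iff R_nonzero)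

lemma sum_CW_right:
  assumes "\<alpha> \<in> R"
  shows "(\<Sum>v\<in>CW. f (v \<circ> creflection \<alpha>)) = (\<Sum>v\<in>CW. f v)"
  by (rule sum.reindex_bij_witness[where i = "\<lambda>v. v \<circ> creflection \<alpha>" and j = "\<lambda>v. v \<circ> creflection \<alpha>"])
     (use assms in \<open>auto simp: CW_right comp_assoc creflection_comp_self\<close>)

lemma sum_CW_left:
  assumes "\<alpha> \<in> R"
  shows "(\<Sum>v\<in>CW. f (creflection \<alpha> \<circ> v)) = (\<Sum>v\<in>CW. f v)"
proof -
  have [simp]: "creflection \<alpha> \<circ> (creflection \<alpha> \<circ> v) = v" for v
    by (simp add: creflection_comp_self assms flip: comp_assoc)
  show ?thesis
    by (rule sum.reindex_bij_witness[where i = "\<lambda>v. creflection \<alpha> \<circ> v" and j = "\<lambda>v. creflection \<alpha> \<circ> v"])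
       (use assms in \<open>auto simp: complex_reflection_group.CW_left\<close>)
qed

section \<open>The Neumann series on the reflection group\<close>

definition \<gamma> :: real where "\<gamma> = (\<Sum>\<alpha>\<in>Rp. k \<alpha>)"

lemma \<gamma>_nonneg: "0 \<le> \<gamma>"
  unfolding \<gamma>_def by (rule sum_nonneg) (rule k_nonneg)

text \<open>\<open>walk_weight j v\<close> is the coefficient of \<open>v\<close> in \<open>(\<Sum> k(\<alpha>) \<sigma>\<^sub>\<alpha>)\<^sup>j\<close> in the group algebra, so that the
  Neumann series below inverts \<open>n + \<gamma> - \<Sum> k(\<alpha>) \<sigma>\<^sub>\<alpha>\<close>.\<close>

primrec walk_weight :: "nat \<Rightarrow> (complex^'n \<Rightarrow> complex^'n) \<Rightarrow> real" where
  "walk_weight 0 v = (if v = id then 1 else 0)"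
| "walk_weight (Suc j) v = (\<Sum>\<alpha>\<in>Rp. k \<alpha> * walk_weight j (v \<circ> creflection \<alpha>))"

lemma walk_weight_nonneg: "0 \<le> walk_weight j v"
  by (induction j arbitrary: v) (auto intro!: sum_nonneg mult_nonneg_nonneg k_nonneg)

text \<open>Right multiplication by a reflection permutes \<open>CW\<close>, so each step of the
  walk multiplies the total weight by \<gamma>.\<close>

lemma sum_walk_weight: "(\<Sum>v\<in>CW. walk_weight j v) = \<gamma> ^ j"
proof (induction j)
  case 0
  show ?case using complex_reflection_group.CW_id by (simp add: sum.delta)
next
  case (Suc j)
  have "(\<Sum>v\<in>CW. walk_weight (Suc j) v) = (\<Sum>\<alpha>\<in>Rp. k \<alpha> * (\<Sum>v\<in>CW. walk_weight j (v \<circ> creflection \<alpha>)))"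
    by (simp add: sum_distrib_left sum.swap[of _ CW])
  also have "\<dots> = \<gamma> * \<gamma> ^ j"
    by (simp add: sum_CW_right Rp_subset Suc.IH sum_distrib_right \<gamma>_def)
  finally show ?case by simp
qed

lemma walk_weight_le: "v \<in> CW \<Longrightarrow> walk_weight j v \<le> \<gamma> ^ j"
  unfolding sum_walk_weight[symmetric] by (rule member_le_sum) (auto simp: walk_weight_nonneg)

definition resolvent_coeff :: "nat \<Rightarrow> (complex^'n \<Rightarrow> complex^'n) \<Rightarrow> real" where
  "resolvent_coeff n v = (\<Sum>j. walk_weight j v / (real n + \<gamma>) ^ Suc j)"

text \<open>For n > 0 the ratio \<gamma> / (n + \<gamma>) of the dominating geometric series is
  strictly below 1. At n = 0 the operator annihilates constants and has no inverse.\<close>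

lemma summable_walk_weight:
  assumes "v \<in> CW" "n > 0"
  shows "summable (\<lambda>j. walk_weight j v / (real n + \<gamma>) ^ Suc j)"
proof (rule summable_comparison_test[OF exI, OF allI, OF impI])
  fix j
  have "walk_weight j v / (real n + \<gamma>) ^ Suc j \<le> \<gamma> ^ j / (real n + \<gamma>) ^ Suc j"
    using walk_weight_le[OF assms(1)] \<gamma>_nonneg by (intro divide_right_mono) auto
  thus "norm (walk_weight j v / (real n + \<gamma>) ^ Suc j) \<le> 1 / (real n + \<gamma>) * (\<gamma> / (real n + \<gamma>)) ^ j"
    using \<gamma>_nonneg by (simp add: walk_weight_nonneg power_divide)
next
  show "summable (\<lambda>j. 1 / (real n + \<gamma>) * (\<gamma> / (real n + \<gamma>)) ^ j)"
    using \<gamma>_nonneg assms(2) by (intro summable_mult summable_geometric) (auto simp: divide_simps)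
qed

lemma resolvent_coeff_nonneg: "v \<in> CW \<Longrightarrow> n > 0 \<Longrightarrow> 0 \<le> resolvent_coeff n v"
  unfolding resolvent_coeff_def using \<gamma>_nonneg
  by (intro suminf_nonneg summable_walk_weight) (auto simp: walk_weight_nonneg)

text \<open>Splitting off the first term of the Neumann series and applying the recursion of
  \<open>walk_weight\<close> to the rest gives the resolvent identity coefficient by
  coefficient.\<close>

lemma resolvent_coeff_eq:
  assumes v: "v \<in> CW" and n: "n > 0"
  shows "(real n + \<gamma>) * resolvent_coeff n v
    = (if v = id then 1 else 0) + (\<Sum>\<alpha>\<in>Rp. k \<alpha> * resolvent_coeff n (v \<circ> creflection \<alpha>))"
proof -
  let ?d = "real n + \<gamma>"
  have d: "?d > 0" using n \<gamma>_nonneg by simp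
  have 1: "(\<lambda>j. ?d * (walk_weight j v / ?d ^ Suc j)) = (\<lambda>j. walk_weight j v / ?d ^ j)"
    using d by (simp add: fun_eq_iff)
  have s: "summable (\<lambda>j. walk_weight j v / ?d ^ j)"
    using summable_mult[OF summable_walk_weight[OF v n], of ?d] unfolding 1 .
  have "?d * resolvent_coeff n v = (\<Sum>j. walk_weight j v / ?d ^ j)"
    unfolding resolvent_coeff_def by (subst suminf_mult[OF summable_walk_weight[OF v n], symmetric]) (simp only: 1)
  also have "\<dots> = walk_weight 0 v + (\<Sum>j. walk_weight (Suc j) v / ?d ^ Suc j)"
    using suminf_split_head[OF s] by simp
  also have "(\<Sum>j. walk_weight (Suc j) v / ?d ^ Suc j)
      = (\<Sum>j. \<Sum>\<alpha>\<in>Rp. k \<alpha> * (walk_weight j (v \<circ> creflection \<alpha>) / ?d ^ Suc j))"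
    by (simp add: sum_divide_distrib)
  also have "\<dots> = (\<Sum>\<alpha>\<in>Rp. \<Sum>j. k \<alpha> * (walk_weight j (v \<circ> creflection \<alpha>) / ?d ^ Suc j))"
    by (rule suminf_sum) (rule summable_mult, rule summable_walk_weight, auto simp: CW_right v Rp_subset n)
  also have "\<dots> = (\<Sum>\<alpha>\<in>Rp. k \<alpha> * resolvent_coeff n (v \<circ> creflection \<alpha>))"
    unfolding resolvent_coeff_def
    by (intro sum.cong HOL.refl suminf_mult summable_walk_weight) (auto simp: CW_right v Rp_subset n)
  finally show ?thesis by simp
qed

text \<open>Summing \<open>resolvent_coeff_eq\<close> over the group gives (n + \<gamma>) S = 1 +
  \<gamma> S. The resulting factor 1 / n is what accumulates to 1 / n! in the bounds for the
  series.\<close>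

lemma sum_resolvent_coeff:
  assumes n: "n > 0"
  shows "(\<Sum>v\<in>CW. resolvent_coeff n v) = 1 / real n"
proof -
  let ?S = "\<Sum>v\<in>CW. resolvent_coeff n v"
  have "(real n + \<gamma>) * ?S = (\<Sum>v\<in>CW. (if v = id then 1 else 0)
      + (\<Sum>\<alpha>\<in>Rp. k \<alpha> * resolvent_coeff n (v \<circ> creflection \<alpha>)))"
    by (simp add: sum_distrib_left resolvent_coeff_eq n)
  also have "\<dots> = 1 + (\<Sum>\<alpha>\<in>Rp. k \<alpha> * (\<Sum>v\<in>CW. resolvent_coeff n (v \<circ> creflection \<alpha>)))"
    by (simp add: sum.distrib sum_distrib_left sum.swap[of _ CW] complex_reflection_group.CW_id sum.delta)
  also have "\<dots> = 1 + \<gamma> * ?S"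
    by (simp add: sum_CW_right Rp_subset \<gamma>_def sum_distrib_right)
  finally show ?thesis using n by (simp add: field_simps)
qed

definition resolvent :: "nat \<Rightarrow> (complex^'n \<Rightarrow> complex) \<Rightarrow> complex^'n \<Rightarrow> complex" where
  "resolvent n F z = (\<Sum>v\<in>CW. complex_of_real (resolvent_coeff n v) * F (v z))"

text \<open>Reindexing the sum by right multiplication with a reflection turns the shifted
  coefficients of \<open>resolvent_coeff_eq\<close> into a reflected argument.\<close>

lemma resolvent_eq:
  assumes n: "n > 0"
  shows "complex_of_real (real n + \<gamma>) * resolvent n F z
    = F z + (\<Sum>\<alpha>\<in>Rp. complex_of_real (k \<alpha>) * resolvent n F (creflection \<alpha> z))"
proof -
  have sh: "resolvent n F (creflection \<alpha> z)
      = (\<Sum>v\<in>CW. complex_of_real (resolvent_coeff n (v \<circ> creflection \<alpha>)) * F (v z))" if "\<alpha> \<in> Rp" for \<alpha>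
  proof -
    have a: "\<alpha> \<in> R" using that by (rule Rp_subset)
    have "resolvent n F (creflection \<alpha> z) = (\<Sum>v\<in>CW. complex_of_real (resolvent_coeff n (v \<circ> creflection \<alpha> \<circ> creflection \<alpha>)) * F ((v \<circ> creflection \<alpha>) z))"
      unfolding resolvent_def by (simp add: comp_assoc creflection_comp_self[OF a])
    also have "\<dots> = (\<Sum>v\<in>CW. complex_of_real (resolvent_coeff n (v \<circ> creflection \<alpha>)) * F (v z))"
      by (rule sum_CW_right[OF a])
    finally show ?thesis .
  qed
  have "complex_of_real (real n + \<gamma>) * resolvent n F z
      = (\<Sum>v\<in>CW. complex_of_real ((real n + \<gamma>) * resolvent_coeff n v) * F (v z))"
    unfolding resolvent_def sum_distrib_left of_real_mult by (simp add: mult.assoc)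
  also have "\<dots> = (\<Sum>v\<in>CW. (if v = id then F z else 0)
      + (\<Sum>\<alpha>\<in>Rp. complex_of_real (k \<alpha>) * (complex_of_real (resolvent_coeff n (v \<circ> creflection \<alpha>)) * F (v z))))"
  proof (rule sum.cong[OF HOL.refl])
    fix v assume v: "v \<in> CW"
    show "complex_of_real ((real n + \<gamma>) * resolvent_coeff n v) * F (v z) = (if v = id then F z else 0)
      + (\<Sum>\<alpha>\<in>Rp. complex_of_real (k \<alpha>) * (complex_of_real (resolvent_coeff n (v \<circ> creflection \<alpha>)) * F (v z)))"
      unfolding resolvent_coeff_eq[OF v n] by (simp add: distrib_right sum_distrib_right mult.assoc)
  qed
  also have "\<dots> = F z + (\<Sum>\<alpha>\<in>Rp. complex_of_real (k \<alpha>) * resolvent n F (creflection \<alpha> z))"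
    by (simp add: sum.distrib sum.swap[of _ CW] complex_reflection_group.CW_id sum.delta sh sum_distrib_left)
  finally show ?thesis .
qed

lemma norm_resolvent_le:
  assumes n: "n > 0" and F: "\<And>v. v \<in> CW \<Longrightarrow> norm (F (v z)) \<le> B"
  shows "norm (resolvent n F z) \<le> B / real n"
proof -
  have "norm (resolvent n F z) \<le> (\<Sum>v\<in>CW. resolvent_coeff n v * B)"
    unfolding resolvent_def
    by (rule sum_norm_le) (auto simp: norm_mult resolvent_coeff_nonneg n intro!: mult_left_mono F)
  also have "\<dots> = B / real n"
    by (simp add: sum_resolvent_coeff[OF n] flip: sum_distrib_right)
  finally show ?thesis .
qed

end

section \<open>Existence of the Dunkl kernel\<close>

context dunkl_system
begin

text \<open>The roots are substituted by their reflections in \<beta>: \<open>k\<close> and the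
  bilinear form are invariant. The substitution does not preserve \<open>Rp\<close>, but the summand
  is even because <\<alpha>, \<xi>> and the quotient both change sign.\<close>

lemma dunkl_operator_compose_creflection:
  assumes f: "\<And>z. (f has_derivative f' z) (at z)" and b: "\<beta> \<in> R"
  shows "dunkl_operator Rp k \<xi> (\<lambda>z. f (creflection \<beta> z)) z
    = dunkl_operator Rp k (creflection \<beta> \<xi>) f (creflection \<beta> z)"
proof -
  define F where "F \<alpha> = complex_of_real (k \<alpha>) * cbil (cvec \<alpha>) (creflection \<beta> \<xi>)
    * dunkl_quotient \<alpha> f (creflection \<beta> z)" for \<alpha>
  have b0: "\<beta> \<noteq> 0" using b by (rule R_nonzero)
  have "F (reflection \<beta> \<alpha>) = complex_of_real (k \<alpha>) * cbil (cvec \<alpha>) \<xi>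
      * dunkl_quotient \<alpha> (\<lambda>z. f (creflection \<beta> z)) z" if "\<alpha> \<in> Rp" for \<alpha>
    using cbil_creflection[OF b0, of "cvec \<alpha>" \<xi>]
    by (simp add: F_def k_reflection b Rp_subset that creflection_cvec
        dunkl_quotient_compose_creflection[OF f b0])
  moreover have "F (- \<alpha>) = F \<alpha>" if "\<alpha> \<in> R" for \<alpha>
    by (simp add: F_def k_uminus that dunkl_quotient_uminus[OF f]) (simp add: cvec_simps cbil_def sum_negf)
  hence "(\<Sum>\<alpha>\<in>Rp. F (reflection \<beta> \<alpha>)) = (\<Sum>\<alpha>\<in>Rp. F \<alpha>)"
    by (rule sum_Rp_reflection) (use b in auto)
  ultimately show ?thesis
    unfolding dunkl_operator_def cderiv_compose_creflection[OF f b0] F_def[symmetric] by simp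
qed

lemma dunkl_operator_lincomb:
  assumes f: "\<And>i. i \<in> I \<Longrightarrow> (f i has_derivative f' i) (at z)"
  shows "dunkl_operator Rp k \<xi> (\<lambda>z. \<Sum>i\<in>I. c i * f i z) z = (\<Sum>i\<in>I. c i * dunkl_operator Rp k \<xi> (f i) z)"
proof -
  have d: "((\<lambda>z. \<Sum>i\<in>I. c i * f i z) has_derivative (\<lambda>h. \<Sum>i\<in>I. c i * f' i h)) (at z)"
    by (intro has_derivative_sum has_derivative_mult_right f)
  show ?thesis
    unfolding dunkl_operator_def cderiv_eq[OF d]
    using cderiv_eq[OF f]
    by (simp add: dunkl_quotient_lincomb[OF f] distrib_left sum.distrib sum_distrib_left
        sum.swap[of _ Rp] mult.left_commute cong: sum.cong)
qed

text \<open>The last sum is the failure of the Leibniz rule. Its coefficient comes from \<xi> -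
  \<sigma>\<xi> being the multiple 2 <\<alpha>, \<xi>> / <\<alpha>, \<alpha>> of \<alpha>.\<close>

lemma dunkl_operator_cbil_mult:
  assumes f: "(f has_derivative f') (at z)"
  shows "dunkl_operator Rp k \<xi> (\<lambda>z. cbil z w * f z) z
    = cbil z w * dunkl_operator Rp k \<xi> f z + cbil \<xi> w * f z
      + (\<Sum>\<alpha>\<in>Rp. complex_of_real (k \<alpha>) * (cbil \<xi> w - cbil (creflection \<alpha> \<xi>) w) * f (creflection \<alpha> z))"
proof -
  have d: "((\<lambda>z. cbil z w * f z) has_derivative (\<lambda>h. cbil z w * f' h + cbil h w * f z)) (at z)"
    by (rule has_derivative_mult[OF has_derivative_cbil_left[OF has_derivative_ident] f])
  have *: "complex_of_real (k \<alpha>) * cbil (cvec \<alpha>) \<xi> * dunkl_quotient \<alpha> (\<lambda>z. cbil z w * f z) z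
      = cbil z w * (complex_of_real (k \<alpha>) * cbil (cvec \<alpha>) \<xi> * dunkl_quotient \<alpha> f z)
        + complex_of_real (k \<alpha>) * (cbil \<xi> w - cbil (creflection \<alpha> \<xi>) w) * f (creflection \<alpha> z)"
    if "\<alpha> \<in> Rp" for \<alpha>
    unfolding dunkl_quotient_cbil_mult[OF f Rp_nonzero[OF that]]
    by (simp add: creflection_def[of \<alpha> \<xi>] cbil_simps algebra_simps)
  have S: "(\<Sum>\<alpha>\<in>Rp. complex_of_real (k \<alpha>) * cbil (cvec \<alpha>) \<xi> * dunkl_quotient \<alpha> (\<lambda>z. cbil z w * f z) z)
      = (\<Sum>\<alpha>\<in>Rp. cbil z w * (complex_of_real (k \<alpha>) * cbil (cvec \<alpha>) \<xi> * dunkl_quotient \<alpha> f z)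
        + complex_of_real (k \<alpha>) * (cbil \<xi> w - cbil (creflection \<alpha> \<xi>) w) * f (creflection \<alpha> z))"
    by (rule sum.cong[OF HOL.refl *])
  show ?thesis
    unfolding dunkl_operator_def cderiv_eq[OF d] cderiv_eq[OF f] S
    by (simp add: sum.distrib sum_subtractf sum_distrib_left algebra_simps)
qed

section \<open>The homogeneous parts of the kernel and their eigenvalue equations\<close>

primrec dunkl_term :: "nat \<Rightarrow> complex^'n \<Rightarrow> complex^'n \<Rightarrow> complex" where
  "dunkl_term 0 w = (\<lambda>z. 1)"
| "dunkl_term (Suc n) w = resolvent (Suc n) (\<lambda>z. cbil z w * dunkl_term n w z)"

text \<open>An explicit derivative by the product rule; having the same recursive shape as
  \<open>dunkl_term\<close>, it can be bounded by induction for termwise differentiation.\<close>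

primrec dunkl_term_deriv :: "nat \<Rightarrow> complex^'n \<Rightarrow> complex^'n \<Rightarrow> complex^'n \<Rightarrow> complex" where
  "dunkl_term_deriv 0 w = (\<lambda>z h. 0)"
| "dunkl_term_deriv (Suc n) w = (\<lambda>z h. (\<Sum>v\<in>CW. complex_of_real (resolvent_coeff (Suc n) v)
        * (cbil (v z) w * dunkl_term_deriv n w (v z) (v h) + cbil (v h) w * dunkl_term n w (v z))))"

lemma has_derivative_dunkl_term:
  "(dunkl_term n w has_derivative dunkl_term_deriv n w z) (at z)"
proof (induction n arbitrary: z)
  case 0
  show ?case by simp
next
  case (Suc n)
  have "((\<lambda>z. cbil (v z) w * dunkl_term n w (v z)) has_derivative
      (\<lambda>h. cbil (v z) w * dunkl_term_deriv n w (v z) (v h) + cbil (v h) w * dunkl_term n w (v z))) (at z)"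
    if v: "v \<in> CW" for v
  proof -
    have dv: "(v has_derivative v) (at z)"
      by (rule bounded_linear_imp_has_derivative[OF CW_bounded_linear[OF v]])
    show ?thesis
      by (rule has_derivative_mult[OF has_derivative_cbil_left[OF dv] has_derivative_compose[OF dv Suc.IH]])
  qed
  hence "((\<lambda>z. \<Sum>v\<in>CW. complex_of_real (resolvent_coeff (Suc n) v) * (cbil (v z) w * dunkl_term n w (v z)))
    has_derivative (\<lambda>h. \<Sum>v\<in>CW. complex_of_real (resolvent_coeff (Suc n) v)
        * (cbil (v z) w * dunkl_term_deriv n w (v z) (v h) + cbil (v h) w * dunkl_term n w (v z)))) (at z)"
    by (intro has_derivative_sum has_derivative_mult_right) auto
  thus ?case by (simp add: resolvent_def[abs_def])
qed

lemma dunkl_term_deriv_smult: "dunkl_term_deriv n w z (c *s h) = c * dunkl_term_deriv n w z h"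
  by (induction n arbitrary: z h)
     (auto simp: CW_smult cbil_smult_left algebra_simps sum_distrib_left intro!: sum.cong)

lemma norm_dunkl_term_le: "norm (dunkl_term n w z) \<le> (norm z * norm w) ^ n / fact n"
proof (induction n arbitrary: z)
  case (Suc n)
  have "norm (cbil (v z) w * dunkl_term n w (v z)) \<le> (norm z * norm w) ^ Suc n / fact n" if "v \<in> CW" for v
  proof -
    have "norm (cbil (v z) w * dunkl_term n w (v z)) \<le> (norm z * norm w) * ((norm z * norm w) ^ n / fact n)"
      unfolding norm_mult
      by (intro mult_mono order.trans[OF norm_cbil_le] order.trans[OF Suc.IH]) (use that in auto)
    thus ?thesis by simp
  qed
  hence "norm (dunkl_term (Suc n) w z) \<le> (norm z * norm w) ^ Suc n / fact n / real (Suc n)"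
    unfolding dunkl_term.simps by (intro norm_resolvent_le) auto
  thus ?case by (simp add: field_simps)
qed simp

text \<open>In the step to degree n + 2, differentiating the old term contributes n + 1 copies of
  the bound and differentiating the linear factor one more; the sum n + 2 cancels against the total
  mass 1 / (n + 2) of the resolvent coefficients.\<close>

lemma norm_dunkl_term_deriv_le:
  "norm (dunkl_term_deriv (Suc n) w z h) \<le> norm h * norm w * (norm z * norm w) ^ n / fact n"
proof (induction n arbitrary: z h)
  have eq: "dunkl_term_deriv (Suc n) w z h =
      (\<Sum>v\<in>CW. complex_of_real (resolvent_coeff (Suc n) v)
        * (cbil (v z) w * dunkl_term_deriv n w (v z) (v h) + cbil (v h) w * dunkl_term n w (v z)))" for n z h
    by simp
  have *: "norm (dunkl_term_deriv (Suc n) w z h) \<le> B / (real (Suc n))"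
    if "\<And>v. v \<in> CW \<Longrightarrow> norm (cbil (v z) w * dunkl_term_deriv n w (v z) (v h) + cbil (v h) w * dunkl_term n w (v z)) \<le> B"
    for n z h B
  proof -
    have "norm (dunkl_term_deriv (Suc n) w z h) \<le> (\<Sum>v\<in>CW. resolvent_coeff (Suc n) v * B)"
      unfolding eq
      by (rule sum_norm_le) (auto simp: norm_mult resolvent_coeff_nonneg intro!: mult_left_mono that)
    also have "\<dots> = B / real (Suc n)"
      by (simp add: sum_resolvent_coeff flip: sum_distrib_right)
    finally show ?thesis .
  qed
  {
    case 0
    have "norm (cbil (v z) w * dunkl_term_deriv 0 w (v z) (v h) + cbil (v h) w * dunkl_term 0 w (v z))
        \<le> norm h * norm w" if "v \<in> CW" for v
      using norm_cbil_le[of "v h" w] that by simp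
    from *[OF this] show ?case by simp
  next
    case (Suc n)
    have "norm (cbil (v z) w * dunkl_term_deriv (Suc n) w (v z) (v h) + cbil (v h) w * dunkl_term (Suc n) w (v z))
        \<le> real (Suc (Suc n)) * (norm h * norm w * (norm z * norm w) ^ Suc n / fact (Suc n))" if v: "v \<in> CW" for v
    proof -
      have "norm (cbil (v z) w * dunkl_term_deriv (Suc n) w (v z) (v h))
          \<le> (norm z * norm w) * (norm h * norm w * (norm z * norm w) ^ n / fact n)"
        unfolding norm_mult
        by (intro mult_mono order.trans[OF norm_cbil_le] order.trans[OF Suc.IH]) (use v in auto)
      also have "\<dots> = real (Suc n) * (norm h * norm w * (norm z * norm w) ^ Suc n / fact (Suc n))"
        by (simp add: field_simps del: of_nat_Suc)
      finally have 1: "norm (cbil (v z) w * dunkl_term_deriv (Suc n) w (v z) (v h))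
          \<le> real (Suc n) * (norm h * norm w * (norm z * norm w) ^ Suc n / fact (Suc n))" .
      have "norm (cbil (v h) w * dunkl_term (Suc n) w (v z))
          \<le> (norm h * norm w) * ((norm z * norm w) ^ Suc n / fact (Suc n))"
        unfolding norm_mult
        by (intro mult_mono order.trans[OF norm_cbil_le] order.trans[OF norm_dunkl_term_le]) (use v in auto)
      hence 2: "norm (cbil (v h) w * dunkl_term (Suc n) w (v z))
          \<le> norm h * norm w * (norm z * norm w) ^ Suc n / fact (Suc n)" by (simp only: times_divide_eq_right)
      have *: "real (Suc (Suc n)) * b = real (Suc n) * b + b" for b by (simp add: distrib_right)
      from order.trans[OF norm_triangle_ineq add_mono[OF 1 2]] show ?thesis unfolding * .
    qed
    from *[OF this] show ?case by (simp del: of_nat_Suc fact_Suc power_Suc dunkl_term_deriv.simps)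
  }
qed

lemma dunkl_term_eq:
  "complex_of_real (real (Suc n) + \<gamma>) * dunkl_term (Suc n) w z
    = cbil z w * dunkl_term n w z
      + (\<Sum>\<alpha>\<in>Rp. complex_of_real (k \<alpha>) * dunkl_term (Suc n) w (creflection \<alpha> z))"
  unfolding dunkl_term.simps by (rule resolvent_eq) simp

text \<open>At a maximiser of the norm the right side is at most \<gamma> times the maximum, as the
  weights are nonnegative with sum \<gamma>; the surplus c > 0 then forces the maximum to be
  0.\<close>

lemma max_principle:
  fixes U :: "(complex^'n \<Rightarrow> complex^'n) \<Rightarrow> complex"
  assumes U: "\<And>v. v \<in> CW \<Longrightarrow> complex_of_real (c + \<gamma>) * U v
      = (\<Sum>\<alpha>\<in>Rp. complex_of_real (k \<alpha>) * U (creflection \<alpha> \<circ> v))"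
    and c: "c > 0" and v: "v \<in> CW"
  shows "U v = 0"
proof -
  define M where "M = Max ((\<lambda>v. norm (U v)) ` CW)"
  have le: "norm (U v) \<le> M" if "v \<in> CW" for v
    unfolding M_def using that by (intro Max_ge) auto
  have "M \<in> (\<lambda>v. norm (U v)) ` CW"
    unfolding M_def using v by (intro Max_in) auto
  then obtain v0 where v0: "v0 \<in> CW" "M = norm (U v0)" by auto
  have "(c + \<gamma>) * M = norm (complex_of_real (c + \<gamma>) * U v0)"
    unfolding norm_mult norm_of_real v0(2) using c \<gamma>_nonneg by simp
  also have "\<dots> \<le> (\<Sum>\<alpha>\<in>Rp. k \<alpha> * M)"
    unfolding U[OF v0(1)]
    by (rule sum_norm_le)
       (auto simp: norm_mult k_nonneg intro!: mult_left_mono le complex_reflection_group.CW_left v0 Rp_subset)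
  also have "\<dots> = \<gamma> * M" by (simp add: \<gamma>_def sum_distrib_right)
  finally have "c * M \<le> 0" by (simp add: distrib_right)
  hence "M \<le> 0" using c by (simp add: mult_le_0_iff)
  with le[OF v] have "norm (U v) \<le> 0" by (rule order.trans)
  thus ?thesis by simp
qed

lemma dunkl_operator_dunkl_term_0: "dunkl_operator Rp k \<xi> (dunkl_term 0 w) z = 0"
proof -
  have *: "cderiv (\<lambda>z. 1) z = (\<lambda>h. 0)"
    by (rule cderiv_eq) (rule has_derivative_const)
  show ?thesis unfolding dunkl_operator_def dunkl_quotient_def dunkl_term.simps *
    by (auto intro!: sum.neutral)
qed

text \<open>The premise is the eigenvalue equation of degree n multiplied by <z, w>, with the
  recursion inserted on the right. In this form it also makes sense at n = 0, where no term of
  degree n - 1 exists.\<close>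

lemma dunkl_operator_dunkl_term_step:
  assumes IH: "\<And>\<xi> z. cbil z w * dunkl_operator Rp k \<xi> (dunkl_term n w) z
    = cbil \<xi> w * (complex_of_real (real n + \<gamma>) * dunkl_term n w z
        - (\<Sum>\<alpha>\<in>Rp. complex_of_real (k \<alpha>) * dunkl_term n w (creflection \<alpha> z)))"
  shows "dunkl_operator Rp k \<xi> (dunkl_term (Suc n) w) z = cbil \<xi> w * dunkl_term n w z"
proof -
  define f where "f = dunkl_term (Suc n) w"
  define g where "g = dunkl_term n w"
  \<comment> \<open>The group element moves the direction together with the point; by equivariance,
    a reflected argument then just replaces \<open>v\<close> by its product with that
    reflection.\<close>
  define U where "U v = dunkl_operator Rp k (v \<xi>) f (v z) - cbil (v \<xi>) w * g (v z)" for v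
  have f: "(f has_derivative dunkl_term_deriv (Suc n) w z) (at z)" for z
    unfolding f_def by (rule has_derivative_dunkl_term)
  have g: "(g has_derivative dunkl_term_deriv n w z) (at z)" for z
    unfolding g_def by (rule has_derivative_dunkl_term)
  \<comment> \<open>As \<open>creflection 0\<close> is the identity, adding \<open>0\<close> to the index set turns both sides
    of the recursion into one linear combination.\<close>
  define c where "c \<alpha> = (if \<alpha> = 0 then complex_of_real (real (Suc n) + \<gamma>) else - complex_of_real (k \<alpha>))" for \<alpha>
  have cr0: "creflection 0 z = z" for z :: "complex^'n" by (simp add: creflection_def cvec_simps)
  have Rp0: "0 \<notin> Rp" using Rp_nonzero by blast
  have sum_c: "(\<Sum>\<alpha>\<in>insert 0 Rp. c \<alpha> * F \<alpha>) = complex_of_real (real (Suc n) + \<gamma>) * F 0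
    - (\<Sum>\<alpha>\<in>Rp. complex_of_real (k \<alpha>) * F \<alpha>)" for F
  proof -
    have "(\<Sum>\<alpha>\<in>Rp. c \<alpha> * F \<alpha>) = - (\<Sum>\<alpha>\<in>Rp. complex_of_real (k \<alpha>) * F \<alpha>)"
      unfolding sum_negf[symmetric] by (intro sum.cong HOL.refl) (auto simp: c_def Rp_nonzero)
    thus ?thesis using Rp0 by (simp add: c_def)
  qed
  have rec: "(\<lambda>z. \<Sum>\<alpha>\<in>insert 0 Rp. c \<alpha> * f (creflection \<alpha> z)) = (\<lambda>z. cbil z w * g z)"
    unfolding sum_c cr0 f_def g_def dunkl_term_eq by simp
  have key: "complex_of_real (real (Suc n) + \<gamma>) * U v
      = (\<Sum>\<alpha>\<in>Rp. complex_of_real (k \<alpha>) * U (creflection \<alpha> \<circ> v))" for v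
  proof -
    define z' where "z' = v z"
    define \<xi>' where "\<xi>' = v \<xi>"
    have "((\<lambda>z. f (creflection \<alpha> z)) has_derivative (\<lambda>h. dunkl_term_deriv (Suc n) w (creflection \<alpha> z') (creflection \<alpha> h))) (at z')"
      if "\<alpha> \<in> insert 0 Rp" for \<alpha>
    proof (cases "\<alpha> = 0")
      case True
      thus ?thesis using f by (simp add: cr0)
    next
      case False
      show ?thesis
        by (rule has_derivative_compose[OF bounded_linear_imp_has_derivative[OF bounded_linear_creflection[OF False]] f])
    qed
    note d = this
    have "dunkl_operator Rp k \<xi>' (\<lambda>z. cbil z w * g z) z'
        = dunkl_operator Rp k \<xi>' (\<lambda>z. \<Sum>\<alpha>\<in>insert 0 Rp. c \<alpha> * f (creflection \<alpha> z)) z'"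
      by (simp only: rec)
    also have "\<dots> = (\<Sum>\<alpha>\<in>insert 0 Rp. c \<alpha> * dunkl_operator Rp k \<xi>' (\<lambda>z. f (creflection \<alpha> z)) z')"
      by (rule dunkl_operator_lincomb) (rule d)
    also have "\<dots> = complex_of_real (real (Suc n) + \<gamma>) * dunkl_operator Rp k \<xi>' f z'
        - (\<Sum>\<alpha>\<in>Rp. complex_of_real (k \<alpha>) * dunkl_operator Rp k (creflection \<alpha> \<xi>') f (creflection \<alpha> z'))"
      unfolding sum_c
      by (simp add: cr0 dunkl_operator_compose_creflection[OF f] Rp_subset cong: sum.cong)
    finally have "dunkl_operator Rp k \<xi>' (\<lambda>z. cbil z w * g z) z' = \<dots>" .
    \<comment> \<open>The term <\<xi>, w> g of the product rule raises n + \<gamma> to n + 1 +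
      \<gamma>, and the parts k <\<xi>, w> g(\<sigma>z) of the premise and of the Leibniz defect
      cancel. Only reflected directions remain in the sum.\<close>
    moreover have "dunkl_operator Rp k \<xi>' (\<lambda>z. cbil z w * g z) z'
        = complex_of_real (real (Suc n) + \<gamma>) * (cbil \<xi>' w * g z')
          - (\<Sum>\<alpha>\<in>Rp. complex_of_real (k \<alpha>) * (cbil (creflection \<alpha> \<xi>') w * g (creflection \<alpha> z')))"
      unfolding dunkl_operator_cbil_mult[OF g] IH[folded g_def]
      by (simp add: algebra_simps sum_subtractf sum_distrib_left)
    moreover have "N * A - N * B = S - S'" if "X = N * A - S" "X = N * B - S'" for X N A B S S' :: complex
      using that by (simp add: algebra_simps)
    ultimately show ?thesis
      unfolding U_def comp_def right_diff_distrib sum_subtractf z'_def \<xi>'_def by blast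
  qed
  have "U id = 0"
    by (rule max_principle[OF key _ complex_reflection_group.CW_id]) simp
  thus ?thesis
    by (simp add: U_def f_def g_def)
qed

lemma dunkl_operator_dunkl_term_Suc:
  "dunkl_operator Rp k \<xi> (dunkl_term (Suc n) w) z = cbil \<xi> w * dunkl_term n w z"
proof (induction n arbitrary: \<xi> z)
  case 0
  show ?case
    \<comment> \<open>In degree 0 the bracket of the premise is \<gamma> minus the sum of the
      \<open>k \<alpha>\<close>, which is 0.\<close>
    by (rule dunkl_operator_dunkl_term_step) (simp add: dunkl_operator_dunkl_term_0[simplified] \<gamma>_def)
next
  case (Suc n)
  show ?case
    by (rule dunkl_operator_dunkl_term_step) (simp only: Suc.IH dunkl_term_eq, simp)
qed

section \<open>Summing the homogeneous parts\<close>

definition dunkl_series :: "complex^'n \<Rightarrow> complex^'n \<Rightarrow> complex" where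
  "dunkl_series w z = (\<Sum>n. dunkl_term n w z)"

lemma dunkl_term_sums: "(\<lambda>n. dunkl_term n w z) sums dunkl_series w z"
  unfolding dunkl_series_def
proof (rule summable_sums, rule summable_comparison_test[OF exI, OF allI, OF impI])
  show "norm (dunkl_term n w z) \<le> (norm z * norm w) ^ n / fact n" for n
    by (rule norm_dunkl_term_le)
  show "summable (\<lambda>n. (norm z * norm w) ^ n / fact n)"
    using summable_exp[of "norm z * norm w"] by (simp add: field_simps)
qed

definition dunkl_deriv_bound :: "real \<Rightarrow> nat \<Rightarrow> real" where
  "dunkl_deriv_bound r n = (case n of 0 \<Rightarrow> 0 | Suc m \<Rightarrow> r ^ m / fact m)"

lemma summable_dunkl_deriv_bound: "summable (dunkl_deriv_bound r)"
proof -
  have "summable (\<lambda>n. dunkl_deriv_bound r (Suc n))"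
    using summable_exp[of r] by (simp add: dunkl_deriv_bound_def field_simps)
  thus ?thesis by (simp only: summable_Suc_iff)
qed

lemma norm_dunkl_term_deriv_le':
  assumes "norm z \<le> r"
  shows "norm (dunkl_term_deriv n w z h) \<le> norm h * norm w * dunkl_deriv_bound (r * norm w) n"
proof (cases n)
  case (Suc m)
  have "norm (dunkl_term_deriv (Suc m) w z h) \<le> norm h * norm w * ((norm z * norm w) ^ m / fact m)"
    using norm_dunkl_term_deriv_le[of m w z h] by simp
  also have "\<dots> \<le> norm h * norm w * ((r * norm w) ^ m / fact m)"
    using assms by (intro mult_left_mono divide_right_mono power_mono mult_right_mono) auto
  finally show ?thesis by (simp add: Suc dunkl_deriv_bound_def)
qed (simp add: dunkl_deriv_bound_def)

definition dunkl_series_deriv :: "complex^'n \<Rightarrow> complex^'n \<Rightarrow> complex^'n \<Rightarrow> complex" where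
  "dunkl_series_deriv w z h = (\<Sum>n. dunkl_term_deriv n w z h)"

lemma dunkl_term_deriv_sums: "(\<lambda>n. dunkl_term_deriv n w z h) sums dunkl_series_deriv w z h"
  unfolding dunkl_series_deriv_def
  by (rule summable_sums, rule summable_comparison_test[OF exI, OF allI, OF impI,
        OF norm_dunkl_term_deriv_le'[OF order.refl]])
     (intro summable_mult summable_dunkl_deriv_bound)

text \<open>Termwise differentiation requires tails of the derivative series that are small relative
  to \<open>norm h\<close>, uniformly near \<open>z\<close>; on the ball of radius
  \<open>norm z + 1\<close> an exponential tail provides this.\<close>

lemma has_derivative_dunkl_series: "(dunkl_series w has_derivative dunkl_series_deriv w z) (at z)"
proof -
  define r where "r = norm z + 1"
  define b where "b = dunkl_deriv_bound (r * norm w)"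
  have tail: "norm ((\<Sum>i<n. dunkl_term_deriv i w u h) - dunkl_series_deriv w u h)
      \<le> norm h * (norm w * (\<Sum>i. b (i + n)))" if "u \<in> ball 0 r" for u h n
  proof -
    have sb: "summable (\<lambda>i. b (i + n))"
      using summable_dunkl_deriv_bound by (simp add: b_def summable_iff_shift)
    have "dunkl_series_deriv w u h - (\<Sum>i<n. dunkl_term_deriv i w u h) = (\<Sum>i. dunkl_term_deriv (i + n) w u h)"
      unfolding dunkl_series_deriv_def
      using suminf_minus_initial_segment[OF sums_summable[OF dunkl_term_deriv_sums]] by simp
    moreover have "norm (\<Sum>i. dunkl_term_deriv (i + n) w u h) \<le> (\<Sum>i. norm h * norm w * b (i + n))"
      using that unfolding b_def
      by (intro norm_suminf_le norm_dunkl_term_deriv_le' summable_mult sb[unfolded b_def]) auto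
    moreover have "(\<Sum>i. norm h * norm w * b (i + n)) = norm h * (norm w * (\<Sum>i. b (i + n)))"
      using suminf_mult[OF sb, of "norm h * norm w"] by (simp only: mult.assoc)
    ultimately show ?thesis by (simp add: norm_minus_commute)
  qed
  have "\<exists>g. \<forall>u\<in>ball 0 r. (\<lambda>n. dunkl_term n w u) sums (g u)
      \<and> (g has_derivative dunkl_series_deriv w u) (at u within ball 0 r)"
  proof (rule has_derivative_series[where x = z])
    fix e :: real assume e: "e > 0"
    have "(\<lambda>n. norm w * (\<Sum>i. b (i + n))) \<longlonglongrightarrow> norm w * 0"
      unfolding b_def
      by (intro tendsto_mult_left suminf_exist_split2 summable_dunkl_deriv_bound)
    hence "\<forall>\<^sub>F n in sequentially. norm w * (\<Sum>i. b (i + n)) < e"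
      using e by (simp add: order_tendstoD)
    thus "\<forall>\<^sub>F n in sequentially. \<forall>u\<in>ball 0 r. \<forall>h.
        norm ((\<Sum>i<n. dunkl_term_deriv i w u h) - dunkl_series_deriv w u h) \<le> e * norm h"
    proof eventually_elim
      case (elim n)
      show ?case
      proof (intro ballI allI)
        fix u h :: "complex^'n" assume u: "u \<in> ball 0 r"
        have "norm h * (norm w * (\<Sum>i. b (i + n))) \<le> norm h * e"
          using elim by (intro mult_left_mono) auto
        from order.trans[OF tail[OF u] this]
        show "norm ((\<Sum>i<n. dunkl_term_deriv i w u h) - dunkl_series_deriv w u h) \<le> e * norm h"
          unfolding mult.commute[of e] .
      qed
    qed
  qed (auto intro: has_derivative_dunkl_term has_derivative_at_withinI dunkl_term_sums simp: r_def)
  then obtain g where g: "\<And>u. u \<in> ball 0 r \<Longrightarrow> (\<lambda>n. dunkl_term n w u) sums (g u)"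
    and dg: "\<And>u. u \<in> ball 0 r \<Longrightarrow> (g has_derivative dunkl_series_deriv w u) (at u within ball 0 r)"
    by blast
  have z: "z \<in> ball 0 r" by (simp add: r_def)
  have "(g has_derivative dunkl_series_deriv w z) (at z)"
    using dg[OF z] z by (simp add: at_within_open[OF _ open_ball])
  thus ?thesis
    by (rule has_derivative_transform_within_open[OF _ open_ball z])
       (use g dunkl_term_sums sums_unique2 in blast)
qed

lemma holomorphic_dunkl_series: "holomorphic_Cn (dunkl_series w)"
proof -
  have "dunkl_series_deriv w z (c *s h) = c * dunkl_series_deriv w z h" for z c h
    using sums_unique2[OF dunkl_term_deriv_sums[of w z "c *s h"]] sums_mult[OF dunkl_term_deriv_sums[of w z h], of c]
    by (simp add: dunkl_term_deriv_smult)
  thus ?thesis unfolding holomorphic_Cn_def using has_derivative_dunkl_series by blast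
qed

lemma dunkl_quotient_sums:
  "(\<lambda>n. dunkl_quotient \<alpha> (dunkl_term n w) z) sums dunkl_quotient \<alpha> (dunkl_series w) z"
  unfolding dunkl_quotient_def cderiv_eq[OF has_derivative_dunkl_term] cderiv_eq[OF has_derivative_dunkl_series]
  by (cases "cbil (cvec \<alpha>) z = 0")
     (auto intro!: sums_mult sums_divide sums_diff dunkl_term_deriv_sums dunkl_term_sums)

lemma dunkl_operator_dunkl_series:
  "dunkl_operator Rp k \<xi> (dunkl_series w) z = cbil \<xi> w * dunkl_series w z"
proof -
  have "(\<lambda>n. dunkl_operator Rp k \<xi> (dunkl_term n w) z) sums dunkl_operator Rp k \<xi> (dunkl_series w) z"
    unfolding dunkl_operator_def cderiv_eq[OF has_derivative_dunkl_term] cderiv_eq[OF has_derivative_dunkl_series]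
    by (intro sums_add sums_sum sums_mult dunkl_term_deriv_sums dunkl_quotient_sums)
  \<comment> \<open>The constant term is annihilated, so the index can be shifted; the shift matches
    degree n + 1 on the left with degree n on the right.\<close>
  hence "(\<lambda>n. dunkl_operator Rp k \<xi> (dunkl_term (Suc n) w) z) sums dunkl_operator Rp k \<xi> (dunkl_series w) z"
    using dunkl_operator_dunkl_term_0 by (subst sums_Suc_iff) (simp del: dunkl_term.simps)
  moreover have "(\<lambda>n. dunkl_operator Rp k \<xi> (dunkl_term (Suc n) w) z) sums (cbil \<xi> w * dunkl_series w z)"
    unfolding dunkl_operator_dunkl_term_Suc by (intro sums_mult dunkl_term_sums)
  ultimately show ?thesis by (rule sums_unique2)
qed

lemma dunkl_term_zero: "dunkl_term (Suc n) w 0 = 0"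
  using norm_dunkl_term_le[of "Suc n" w 0] by simp

lemma dunkl_series_at_0: "dunkl_series w 0 = 1"
proof -
  have "(\<lambda>n. dunkl_term n w 0) sums (\<Sum>n\<in>{0}. dunkl_term n w 0)"
    by (rule sums_finite) (auto simp: dunkl_term_zero gr0_conv_Suc simp del: dunkl_term.simps)
  with dunkl_term_sums[of w 0] show ?thesis by (simp add: sums_unique2)
qed

end

section \<open>Uniqueness, positivity and growth of the Dunkl kernel\<close>

text \<open>N t exp(-C t) is nonincreasing. The derivative bound is required in the open interval
  only, since the ray equation carries a factor t and says nothing about the derivative at
  0.\<close>

lemma gronwall_zero:
  fixes N :: "real \<Rightarrow> real"
  assumes cont: "continuous_on {0..1} N"
    and deriv: "\<And>t. 0 < t \<Longrightarrow> t < 1 \<Longrightarrow> (N has_real_derivative N' t) (at t)"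
    and le: "\<And>t. 0 < t \<Longrightarrow> t < 1 \<Longrightarrow> N' t \<le> C * N t"
    and init: "N 0 = 0"
  shows "N 1 \<le> 0"
proof -
  have "N 1 * exp (- C * 1) \<le> N 0 * exp (- C * 0)"
  proof (rule DERIV_nonpos_imp_decreasing_open[where f = "\<lambda>t. N t * exp (- C * t)"])
    fix t :: real assume t: "0 < t" "t < 1"
    have "((\<lambda>t. N t * exp (- C * t)) has_real_derivative (N' t - C * N t) * exp (- C * t)) (at t)"
      by (rule derivative_eq_intros deriv[OF t] HOL.refl)+ (simp add: algebra_simps)
    moreover have "(N' t - C * N t) * exp (- C * t) \<le> 0"
      using le[OF t] by (simp add: mult_le_0_iff)
    ultimately show "\<exists>y. ((\<lambda>t. N t * exp (- C * t)) has_real_derivative y) (at t) \<and> y \<le> 0" by blast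
  qed (auto intro!: continuous_intros cont)
  thus ?thesis using init by (simp add: mult_le_0_iff)
qed

text \<open>The square makes the negative part differentiable at 0 as well. The derivative is
  written with an inner product to match \<open>ray_energy\<close>.\<close>

lemma has_derivative_min_0_square:
  "((\<lambda>x::real. (min 0 x)\<^sup>2) has_derivative (\<lambda>h. 2 * (min 0 a \<bullet> h))) (at a)"
proof -
  have "((\<lambda>x::real. (min 0 x)\<^sup>2) has_real_derivative 2 * min 0 a) (at a)"
  proof (cases "a = 0")
    case False
    have "((\<lambda>x::real. if 0 < a then 0 else x\<^sup>2) has_real_derivative 2 * min 0 a) (at a)"
      using False by (cases "0 < a") (auto intro!: derivative_eq_intros)
    thus ?thesis
    proof (rule has_field_derivative_transform_within)
      show "0 < \<bar>a\<bar>" using False by simp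
    qed (auto simp: dist_real_def)
  next
    case True
    have "((\<lambda>y. (min 0 y)\<^sup>2 / y) \<longlongrightarrow> (0::real)) (at 0)"
    proof (rule Lim_null_comparison)
      show "\<forall>\<^sub>F y in at (0::real). norm ((min 0 y)\<^sup>2 / y) \<le> \<bar>y\<bar>"
        by (rule always_eventually) (auto simp: min_def power2_eq_square)
      show "((\<lambda>y::real. \<bar>y\<bar>) \<longlongrightarrow> 0) (at 0)"
        by (rule tendsto_rabs_zero) (rule tendsto_ident_at)
    qed
    thus ?thesis by (simp add: True has_field_derivative_iff)
  qed
  thus ?thesis
    unfolding has_field_derivative_def by (rule has_derivative_eq_rhs) (simp add: fun_eq_iff)
qed

context dunkl_system
begin

text \<open>Substituting \<sigma>v for \<open>v\<close> and adding the two forms of the sum yields a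
  sum of products (p x - p y) \<bullet> (x - y), each nonnegative by monotonicity.\<close>

lemma dissipation:
  fixes a :: "(complex^'n \<Rightarrow> complex^'n) \<Rightarrow> 'b::real_inner"
  assumes mono: "\<And>x y. 0 \<le> (p x - p y) \<bullet> (x - y)" and \<alpha>: "\<alpha> \<in> R"
  shows "0 \<le> (\<Sum>v\<in>CW. p (a v) \<bullet> (a v - a (creflection \<alpha> \<circ> v)))" (is "0 \<le> ?S")
proof -
  have invol: "creflection \<alpha> \<circ> (creflection \<alpha> \<circ> v) = v" for v
    by (simp add: creflection_comp_self \<alpha> flip: comp_assoc)
  have "?S = (\<Sum>v\<in>CW. p (a (creflection \<alpha> \<circ> v)) \<bullet> (a (creflection \<alpha> \<circ> v) - a v))" (is "_ = ?S'")
    using sum_CW_left[OF \<alpha>, of "\<lambda>v. p (a v) \<bullet> (a v - a (creflection \<alpha> \<circ> v))"]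
    by (simp only: invol)
  hence "?S + ?S = ?S + ?S'" by (rule arg_cong)
  also have "\<dots> = (\<Sum>v\<in>CW. (p (a v) - p (a (creflection \<alpha> \<circ> v))) \<bullet> (a v - a (creflection \<alpha> \<circ> v)))"
    unfolding sum.distrib[symmetric] by (simp add: inner_diff_left inner_diff_right algebra_simps)
  also have "\<dots> \<ge> 0" by (rule sum_nonneg) (rule mono)
  finally show ?thesis by simp
qed

text \<open>Along a ray, the values of an eigenfunction on a \<open>W\<close>-orbit solve a system whose reflection
  part is dissipative for every energy \<open>\<Phi>\<close> with monotone gradient \<open>2 p\<close>. With \<open>p = id\<close> this yields
  uniqueness of the Dunkl kernel, with \<open>p = min 0\<close> its positivity.\<close>

lemma ray_energy:
  fixes g :: "(complex^'n \<Rightarrow> complex^'n) \<Rightarrow> real \<Rightarrow> 'b::real_inner"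
  assumes mono: "\<And>x y. 0 \<le> (p x - p y) \<bullet> (x - y)"
    and deriv_\<Phi>: "\<And>a. (\<Phi> has_derivative (\<lambda>h. 2 * (p a \<bullet> h))) (at a)"
    and nonneg: "\<And>a. 0 \<le> \<Phi> a"
    and deriv: "\<And>v t. v \<in> CW \<Longrightarrow> (g v has_vector_derivative g' v t) (at t)"
    and le: "\<And>v t. v \<in> CW \<Longrightarrow> 0 < t \<Longrightarrow> t < 1 \<Longrightarrow>
      p (g v t) \<bullet> (t *\<^sub>R g' v t + (\<Sum>\<alpha>\<in>Rp. k \<alpha> *\<^sub>R (g v t - g (creflection \<alpha> \<circ> v) t))) \<le> t * r * \<Phi> (g v t)"
    and init: "\<And>v. v \<in> CW \<Longrightarrow> \<Phi> (g v 0) = 0"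
    and v: "v \<in> CW"
  shows "\<Phi> (g v 1) = 0"
proof -
  define N where "N t = (\<Sum>v\<in>CW. \<Phi> (g v t))" for t
  define N' where "N' t = (\<Sum>v\<in>CW. 2 * (p (g v t) \<bullet> g' v t))" for t
  have dN: "(N has_real_derivative N' t) (at t)" for t
  proof -
    have "((\<lambda>t. \<Phi> (g v t)) has_derivative (\<lambda>h. 2 * (p (g v t) \<bullet> (h *\<^sub>R g' v t)))) (at t)" if "v \<in> CW" for v
      by (rule has_derivative_compose[OF deriv[OF that, unfolded has_vector_derivative_def] deriv_\<Phi>])
    hence "((\<lambda>t. \<Phi> (g v t)) has_real_derivative 2 * (p (g v t) \<bullet> g' v t)) (at t)" if "v \<in> CW" for v
      using that by (simp add: has_field_derivative_def mult.left_commute mult_commute_abs)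
    thus ?thesis unfolding N_def N'_def by (intro DERIV_sum)
  qed
  have "N 1 \<le> 0"
  proof (rule gronwall_zero[of N N'])
    show "continuous_on {0..1} N"
      using DERIV_continuous_on[of "{0..1}" N N'] dN by (auto intro: has_field_derivative_at_within)
    show "N' t \<le> 2 * r * N t" if t: "0 < t" "t < 1" for t
    proof -
      \<comment> \<open>Only \<open>t *\<^sub>R g'\<close> is controlled by the hypothesis, so the
        estimate is made for t N' and divided by t > 0 at the end.\<close>
      have "t * N' t = 2 * (\<Sum>v\<in>CW. p (g v t) \<bullet> (t *\<^sub>R g' v t))"
        by (simp add: N'_def sum_distrib_left algebra_simps)
      also have "(\<Sum>v\<in>CW. p (g v t) \<bullet> (t *\<^sub>R g' v t))
          \<le> (\<Sum>v\<in>CW. t * r * \<Phi> (g v t) - (\<Sum>\<alpha>\<in>Rp. k \<alpha> * (p (g v t) \<bullet> (g v t - g (creflection \<alpha> \<circ> v) t))))"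
        using le[OF _ t] by (intro sum_mono) (simp add: inner_add_right inner_sum_right le_diff_eq)
      also have "\<dots> = t * r * N t
          - (\<Sum>\<alpha>\<in>Rp. k \<alpha> * (\<Sum>v\<in>CW. p (g v t) \<bullet> (g v t - g (creflection \<alpha> \<circ> v) t)))"
        by (simp add: N_def sum_subtractf sum_distrib_left sum.swap[of _ CW])
      also have "\<dots> \<le> t * r * N t"
        using dissipation[OF mono Rp_subset, of _ "\<lambda>v. g v t"] k_nonneg
        by (simp add: sum_nonneg)
      finally have "t * N' t \<le> t * (2 * r * N t)" by simp
      thus ?thesis using t by simp
    qed
    show "N 0 = 0" by (simp add: N_def init)
  qed (use dN in auto)
  hence "N 1 = 0" using nonneg by (simp add: N_def sum_nonneg order.antisym)
  thus ?thesis
    using v nonneg by (simp add: N_def sum_nonneg_eq_0_iff)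
qed

section \<open>Eigenfunctions along rays, and uniqueness\<close>

definition dunkl_eigenfunction :: "complex^'n \<Rightarrow> (complex^'n \<Rightarrow> complex) \<Rightarrow> bool" where
  "dunkl_eigenfunction w f \<longleftrightarrow> holomorphic_Cn f \<and>
     (\<forall>\<xi> u. dunkl_operator Rp k \<xi> f u = cbil \<xi> w * f u) \<and> f 0 = 1"

lemma eigenfunction_ray_derivative:
  assumes "dunkl_eigenfunction w f"
  shows "((\<lambda>t. f (t *\<^sub>R u)) has_vector_derivative cderiv f (t *\<^sub>R u) u) (at t)"
proof -
  have "((\<lambda>t. t *\<^sub>R u) has_derivative (\<lambda>h. h *\<^sub>R u)) (at t)"
    by (intro derivative_eq_intros) auto
  from has_derivative_compose[OF this holomorphic_Cn_has_derivative]
  have "((\<lambda>t. f (t *\<^sub>R u)) has_derivative (\<lambda>h. cderiv f (t *\<^sub>R u) (h *\<^sub>R u))) (at t)"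
    using assms by (simp add: dunkl_eigenfunction_def)
  thus ?thesis
    unfolding has_vector_derivative_def scaleR_eq_smult
    using assms by (simp add: dunkl_eigenfunction_def holomorphic_Cn_smult scaleR_conv_of_real)
qed

text \<open>The direction is the base point \<open>t u\<close> itself, so
  \<open>dunkl_quotient_mult\<close> turns the difference quotients into plain differences of values
  on the orbit.\<close>

lemma eigenfunction_ray_eq:
  assumes "dunkl_eigenfunction w f"
  shows "t *\<^sub>R cderiv f (t *\<^sub>R u) u + (\<Sum>\<alpha>\<in>Rp. k \<alpha> *\<^sub>R (f (t *\<^sub>R u) - f (t *\<^sub>R creflection \<alpha> u)))
    = complex_of_real t * cbil u w * f (t *\<^sub>R u)"
proof -
  have hol: "holomorphic_Cn f" using assms by (simp add: dunkl_eigenfunction_def)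
  have "cbil (t *\<^sub>R u) w * f (t *\<^sub>R u) = dunkl_operator Rp k (t *\<^sub>R u) f (t *\<^sub>R u)"
    using assms by (simp add: dunkl_eigenfunction_def)
  also have "\<dots> = t *\<^sub>R cderiv f (t *\<^sub>R u) u + (\<Sum>\<alpha>\<in>Rp. k \<alpha> *\<^sub>R (f (t *\<^sub>R u) - f (t *\<^sub>R creflection \<alpha> u)))"
    unfolding dunkl_operator_def mult.assoc dunkl_quotient_mult
    by (simp add: scaleR_eq_smult holomorphic_Cn_smult[OF hol] creflection_smult scaleR_conv_of_real)
  finally show ?thesis by (simp add: scaleR_eq_smult cbil_smult_left)
qed

text \<open>The difference of two solutions starts at 0 on every ray, and by Cauchy-Schwarz the
  eigenvalue term is at most \<open>norm z * norm w\<close> times the energy.\<close>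

lemma eigenfunction_unique:
  assumes f: "dunkl_eigenfunction w f" and f': "dunkl_eigenfunction w f'"
  shows "f = f'"
proof
  fix z
  define g :: "(complex^'n \<Rightarrow> complex^'n) \<Rightarrow> real \<Rightarrow> complex" where "g v t = f (t *\<^sub>R v z) - f' (t *\<^sub>R v z)" for v t
  define g' :: "(complex^'n \<Rightarrow> complex^'n) \<Rightarrow> real \<Rightarrow> complex" where "g' v t = cderiv f (t *\<^sub>R v z) (v z) - cderiv f' (t *\<^sub>R v z) (v z)" for v t
  have "(norm (g id 1))\<^sup>2 = 0"
  proof (rule ray_energy[where p = "\<lambda>a. a" and \<Phi> = "\<lambda>a. (norm a)\<^sup>2" and g = g and g' = g' and r = "norm z * norm w"])
    show "((\<lambda>a. (norm a)\<^sup>2) has_derivative (\<lambda>h. 2 * (a \<bullet> h))) (at a)" for a :: complex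
      unfolding power2_norm_eq_inner
      by (rule derivative_eq_intros HOL.refl)+ (simp add: inner_commute)
    show "(g v has_vector_derivative g' v t) (at t)" if "v \<in> CW" for v t
      unfolding g_def[abs_def] g'_def
      by (intro has_vector_derivative_diff eigenfunction_ray_derivative[OF f] eigenfunction_ray_derivative[OF f'])
    show "g v t \<bullet> (t *\<^sub>R g' v t + (\<Sum>\<alpha>\<in>Rp. k \<alpha> *\<^sub>R (g v t - g (creflection \<alpha> \<circ> v) t)))
        \<le> t * (norm z * norm w) * (norm (g v t))\<^sup>2" if v: "v \<in> CW" and t: "0 < t" for v t
    proof -
      have "t *\<^sub>R g' v t + (\<Sum>\<alpha>\<in>Rp. k \<alpha> *\<^sub>R (g v t - g (creflection \<alpha> \<circ> v) t))
        = (t *\<^sub>R cderiv f (t *\<^sub>R v z) (v z) + (\<Sum>\<alpha>\<in>Rp. k \<alpha> *\<^sub>R (f (t *\<^sub>R v z) - f (t *\<^sub>R creflection \<alpha> (v z)))))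
        - (t *\<^sub>R cderiv f' (t *\<^sub>R v z) (v z) + (\<Sum>\<alpha>\<in>Rp. k \<alpha> *\<^sub>R (f' (t *\<^sub>R v z) - f' (t *\<^sub>R creflection \<alpha> (v z)))))"
        unfolding g_def g'_def comp_def by (simp add: algebra_simps sum.distrib sum_subtractf)
      also have "\<dots> = t *\<^sub>R (cbil (v z) w * g v t)"
        unfolding eigenfunction_ray_eq[OF f] eigenfunction_ray_eq[OF f']
        by (simp add: g_def scaleR_conv_of_real algebra_simps)
      finally have eq: "t *\<^sub>R g' v t + (\<Sum>\<alpha>\<in>Rp. k \<alpha> *\<^sub>R (g v t - g (creflection \<alpha> \<circ> v) t)) = \<dots>" .
      have "g v t \<bullet> (cbil (v z) w * g v t) \<le> norm (g v t) * (norm (cbil (v z) w) * norm (g v t))"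
        using Cauchy_Schwarz_ineq2[of "g v t" "cbil (v z) w * g v t"] by (simp add: norm_mult)
      also have "\<dots> \<le> norm (g v t) * ((norm z * norm w) * norm (g v t))"
        using norm_cbil_le[of "v z" w] v by (intro mult_left_mono mult_right_mono) auto
      finally show ?thesis
        unfolding eq using t by (simp add: power2_eq_square mult.commute mult.left_commute)
    qed
    show "(norm (g v 0))\<^sup>2 = 0" for v
      using f f' by (simp add: g_def dunkl_eigenfunction_def)
  qed (auto intro: complex_reflection_group.CW_id)
  thus "f z = f' z" by (simp add: g_def)
qed

lemma dunkl_eigenfunction_dunkl_series: "dunkl_eigenfunction w (dunkl_series w)"
  by (simp add: dunkl_eigenfunction_def holomorphic_dunkl_series dunkl_operator_dunkl_series dunkl_series_at_0)

lemma dunkl_kernel_eq: "dunkl_kernel Rp k z w = dunkl_series w z"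
proof -
  have "(THE f. dunkl_eigenfunction w f) = dunkl_series w"
    using dunkl_eigenfunction_dunkl_series eigenfunction_unique by blast
  thus ?thesis by (simp add: dunkl_kernel_def dunkl_eigenfunction_def)
qed

section \<open>Two-sided bounds and continuity on real arguments\<close>

abbreviation E :: "real^'n \<Rightarrow> real^'n \<Rightarrow> real" where
  "E \<equiv> real_dunkl_kernel Rp k"

lemma E_eq: "E x y = Re (dunkl_series (cvec y) (cvec x))"
  by (simp add: real_dunkl_kernel_def dunkl_kernel_eq)

lemma E_zero_left: "E 0 y = 1"
  by (simp add: E_eq cvec_simps dunkl_series_at_0)

lemma E_zero_right: "E x 0 = 1"
proof -
  have "dunkl_term (Suc n) 0 z = 0" for n z
    using norm_dunkl_term_le[of "Suc n" 0 z] by simp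
  hence "(\<lambda>n. dunkl_term n 0 z) sums (\<Sum>n\<in>{0}. dunkl_term n 0 z)" for z
    by (intro sums_finite) (auto simp: gr0_conv_Suc simp del: dunkl_term.simps)
  from sums_unique2[OF dunkl_term_sums this] show ?thesis by (simp add: E_eq cvec_simps)
qed

lemma E_le: "E x y \<le> exp (norm x * norm y)"
proof -
  have s: "(\<lambda>n. (norm x * norm y) ^ n / fact n) sums exp (norm x * norm y)"
    using exp_converges[of "norm x * norm y"] by (simp add: field_simps)
  have "norm (dunkl_series (cvec y) (cvec x)) \<le> (\<Sum>n. (norm x * norm y) ^ n / fact n)"
    unfolding dunkl_series_def
    using norm_dunkl_term_le[of _ "cvec y" "cvec x"] by (intro norm_suminf_le sums_summable[OF s]) simp
  thus ?thesis
    unfolding E_eq using sums_unique[OF s] complex_Re_le_cmod[of "dunkl_series (cvec y) (cvec x)"] by simp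
qed

text \<open>The comparison function exp(-r t) is the same for all orbit points, so it drops out of
  the reflection differences, and it decays at least as fast as any eigenvalue factor allows. The
  difference \<open>g\<close> thus has a nonnegative source, and the energy of its negative part
  stays 0.\<close>

lemma E_ge: "exp (- (norm x * norm y)) \<le> E x y"
proof -
  define r where "r = norm x * norm y"
  define f where "f = dunkl_series (cvec y)"
  have f: "dunkl_eigenfunction (cvec y) f"
    unfolding f_def by (rule dunkl_eigenfunction_dunkl_series)
  define g :: "(complex^'n \<Rightarrow> complex^'n) \<Rightarrow> real \<Rightarrow> real" where "g v t = Re (f (t *\<^sub>R v (cvec x))) - exp (- r * t)" for v t
  define g' :: "(complex^'n \<Rightarrow> complex^'n) \<Rightarrow> real \<Rightarrow> real" where "g' v t = Re (cderiv f (t *\<^sub>R v (cvec x)) (v (cvec x))) + r * exp (- r * t)" for v t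
  have "(min 0 (g id 1))\<^sup>2 = 0"
  proof (rule ray_energy[where p = "min 0" and \<Phi> = "\<lambda>a. (min 0 a)\<^sup>2" and g = g and g' = g' and r = r])
    show "0 \<le> (min 0 a - min 0 b) \<bullet> (a - b)" for a b :: real
      by (auto simp: min_def zero_le_mult_iff)
    show "((\<lambda>a. (min 0 a)\<^sup>2) has_derivative (\<lambda>h. 2 * (min 0 a \<bullet> h))) (at a)" for a :: real
      by (rule has_derivative_min_0_square)
    show "(g v has_vector_derivative g' v t) (at t)" if "v \<in> CW" for v t
    proof -
      have "((\<lambda>t. exp (- r * t)) has_vector_derivative - r * exp (- r * t)) (at t)"
        unfolding has_real_derivative_iff_has_vector_derivative[symmetric]
        by (rule derivative_eq_intros HOL.refl)+ simp
      from has_vector_derivative_diff[OF bounded_linear.has_vector_derivative[OF bounded_linear_Re eigenfunction_ray_derivative[OF f]] this]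
      show ?thesis unfolding g_def[abs_def] g'_def by simp
    qed
    show "min 0 (g v t) \<bullet> (t *\<^sub>R g' v t + (\<Sum>\<alpha>\<in>Rp. k \<alpha> *\<^sub>R (g v t - g (creflection \<alpha> \<circ> v) t)))
        \<le> t * r * (min 0 (g v t))\<^sup>2" if v: "v \<in> CW" and t: "0 < t" for v t
    proof -
      obtain x' where x': "v (cvec x) = cvec x'" using CW_cvec[OF v] by blast
      have "norm x' = norm x" using CW_norm[OF v, of "cvec x"] by (simp add: x')
      hence a: "\<bar>x' \<bullet> y\<bar> \<le> r" using Cauchy_Schwarz_ineq2[of x' y] by (simp add: r_def)
      have "t *\<^sub>R g' v t + (\<Sum>\<alpha>\<in>Rp. k \<alpha> *\<^sub>R (g v t - g (creflection \<alpha> \<circ> v) t))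
        = Re (t *\<^sub>R cderiv f (t *\<^sub>R v (cvec x)) (v (cvec x))
            + (\<Sum>\<alpha>\<in>Rp. k \<alpha> *\<^sub>R (f (t *\<^sub>R v (cvec x)) - f (t *\<^sub>R creflection \<alpha> (v (cvec x))))))
          + t * r * exp (- r * t)"
        unfolding g_def g'_def comp_def by (simp add: algebra_simps)
      \<comment> \<open>The second summand is the source; it is nonnegative because \<open>r\<close>
        bounds the absolute value of the inner product on the whole orbit.\<close>
      also have "\<dots> = t * ((x' \<bullet> y) * g v t + ((x' \<bullet> y) + r) * exp (- r * t))"
        unfolding eigenfunction_ray_eq[OF f] by (simp add: x' g_def algebra_simps)
      finally have eq: "t *\<^sub>R g' v t + (\<Sum>\<alpha>\<in>Rp. k \<alpha> *\<^sub>R (g v t - g (creflection \<alpha> \<circ> v) t)) = \<dots>" .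
      have "min 0 (g v t) * ((x' \<bullet> y) * g v t + ((x' \<bullet> y) + r) * exp (- r * t)) \<le> r * (min 0 (g v t))\<^sup>2"
      proof (cases "g v t < 0")
        case True
        have "(x' \<bullet> y) * (g v t)\<^sup>2 \<le> r * (g v t)\<^sup>2"
          using a by (intro mult_right_mono) auto
        moreover have "g v t * (((x' \<bullet> y) + r) * exp (- r * t)) \<le> 0"
          using a True by (intro mult_nonpos_nonneg mult_nonneg_nonneg) auto
        moreover have "g v t * ((x' \<bullet> y) * g v t + ((x' \<bullet> y) + r) * exp (- r * t))
            = (x' \<bullet> y) * (g v t)\<^sup>2 + g v t * (((x' \<bullet> y) + r) * exp (- r * t))"
          by (simp add: power2_eq_square algebra_simps)
        moreover have "min 0 (g v t) = g v t" using True by simp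
        ultimately show ?thesis by (simp only:)
      qed simp
      hence "t * (min 0 (g v t) * ((x' \<bullet> y) * g v t + ((x' \<bullet> y) + r) * exp (- r * t))) \<le> t * (r * (min 0 (g v t))\<^sup>2)"
        using t by (intro mult_left_mono) auto
      thus ?thesis unfolding eq inner_real_def by (simp only: ac_simps)
    qed
    show "(min 0 (g v 0))\<^sup>2 = 0" for v
      using f by (simp add: g_def dunkl_eigenfunction_def)
  qed (auto intro: complex_reflection_group.CW_id)
  hence "g id 1 \<ge> 0" by (simp add: min_def split: if_splits)
  thus ?thesis by (simp add: g_def E_eq f_def r_def)
qed

lemma E_pos: "0 < E x y"
  using E_ge[of x y] exp_gt_zero[of "- (norm x * norm y)"] by linarith

lemma continuous_on_dunkl_term: "continuous_on UNIV (\<lambda>p. dunkl_term n (snd p) (fst p))"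
proof (induction n)
  case (Suc n)
  have "continuous_on UNIV (\<lambda>p. cbil (v (fst p)) (snd p) * dunkl_term n (snd p) (v (fst p)))" if v: "v \<in> CW" for v
  proof -
    have c: "continuous_on UNIV (\<lambda>p. v (fst p))"
      by (intro bounded_linear.continuous_on[OF CW_bounded_linear[OF v]] continuous_intros)
    have p: "continuous_on UNIV (\<lambda>p. (v (fst p), snd p))"
      using c by (intro continuous_intros)
    have "continuous_on UNIV (\<lambda>p. dunkl_term n (snd p) (v (fst p)))"
      using continuous_on_compose2[OF Suc.IH p] by simp
    thus ?thesis using c by (intro continuous_intros)
  qed
  thus ?case
    unfolding dunkl_term.simps resolvent_def by (intro continuous_on_sum continuous_on_mult_left)
qed simp

text \<open>Joint continuity in point and parameter, from uniform convergence on balls of the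
  product space; it is what makes the transition densities measurable in both variables.\<close>

lemma continuous_on_dunkl_series: "continuous_on UNIV (\<lambda>p. dunkl_series (snd p) (fst p))"
proof -
  have "isCont (\<lambda>p. dunkl_series (snd p) (fst p)) q" for q
  proof -
    define r where "r = norm q + 1"
    have u: "uniform_limit (ball 0 r) (\<lambda>n p. \<Sum>i<n. dunkl_term i (snd p) (fst p)) (\<lambda>p. \<Sum>n. dunkl_term n (snd p) (fst p)) sequentially"
    proof (rule Weierstrass_m_test)
      show "norm (dunkl_term n (snd p) (fst p)) \<le> (r * r) ^ n / fact n" if p: "p \<in> ball 0 r" for n p
      proof -
        have "norm (fst p) \<le> r" "norm (snd p) \<le> r"
          using p norm_fst_le[of "fst p" "snd p"] norm_snd_le[of "snd p" "fst p"] by auto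
        hence "norm (fst p) * norm (snd p) \<le> r * r" by (intro mult_mono) (auto simp: r_def)
        hence "(norm (fst p) * norm (snd p)) ^ n / fact n \<le> (r * r) ^ n / fact n"
          by (intro divide_right_mono power_mono) auto
        thus ?thesis using norm_dunkl_term_le[of n "snd p" "fst p"] by linarith
      qed
      show "summable (\<lambda>n. (r * r) ^ n / fact n)"
        using summable_exp[of "r * r"] by (simp add: field_simps)
    qed
    have "continuous_on (ball 0 r) (\<lambda>p. \<Sum>n. dunkl_term n (snd p) (fst p))"
      by (rule uniform_limit_theorem[OF always_eventually u])
         (auto intro!: continuous_on_sum continuous_on_subset[OF continuous_on_dunkl_term])
    thus ?thesis
      unfolding dunkl_series_def by (rule continuous_on_interior) (simp add: r_def)
  qed
  thus ?thesis by (simp add: continuous_on_eq_continuous_at)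
qed

lemma continuous_on_E [continuous_intros]:
  assumes "continuous_on S f" "continuous_on S g"
  shows "continuous_on S (\<lambda>x. E (f x) (g x))"
proof -
  have p: "continuous_on S (\<lambda>x. (cvec (f x), cvec (g x)))"
    using assms by (intro continuous_intros)
  show ?thesis
    unfolding E_eq using continuous_on_compose2[OF continuous_on_dunkl_series p] by (auto intro: continuous_on_Re)
qed

lemma measurable_E [measurable]:
  assumes [measurable]: "f \<in> borel_measurable M" "g \<in> borel_measurable M"
  shows "(\<lambda>x. E (f x) (g x)) \<in> borel_measurable M"
proof -
  have "(\<lambda>p. E (fst p) (snd p)) \<in> borel_measurable borel"
    by (rule borel_measurable_continuous_onI) (intro continuous_intros)
  from measurable_compose[OF borel_measurable_Pair[OF assms] this] show ?thesis by simp
qed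

end

section \<open>Transition densities\<close>

lemma nn_integral_lborel_scale:
  fixes f :: "'a::euclidean_space \<Rightarrow> ennreal"
  assumes [measurable]: "f \<in> borel_measurable borel" and c: "c > 0"
  shows "(\<integral>\<^sup>+y. f y \<partial>lborel) = ennreal (c ^ DIM('a)) * (\<integral>\<^sup>+y. f (c *\<^sub>R y) \<partial>lborel)"
proof -
  have "(\<integral>\<^sup>+y. f y \<partial>lborel)
      = (\<integral>\<^sup>+y. f y \<partial>density (distr lborel borel (\<lambda>x. 0 + c *\<^sub>R x)) (\<lambda>_. ennreal (\<bar>c\<bar> ^ DIM('a))))"
    using lborel_affine[of c "0::'a"] c by simp
  also have "\<dots> = (\<integral>\<^sup>+y. ennreal (c ^ DIM('a)) * f (c *\<^sub>R y) \<partial>lborel)"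
    using c by (simp add: nn_integral_density nn_integral_distr)
  also have "\<dots> = ennreal (c ^ DIM('a)) * (\<integral>\<^sup>+y. f (c *\<^sub>R y) \<partial>lborel)"
    by (rule nn_integral_cmult) simp
  finally show ?thesis .
qed

lemma vanishing_continuous_small:
  assumes "f \<in> vanishing_continuous" "e > 0"
  obtains M where "M > 0" "\<And>x. norm x \<ge> M \<Longrightarrow> \<bar>f x\<bar> < e"
proof -
  have "\<forall>\<^sub>F x in at_infinity. \<bar>f x\<bar> < e"
    using assms tendstoD[of f 0 at_infinity e] by (simp add: vanishing_continuous_def)
  then obtain b where "\<And>x. norm x \<ge> b \<Longrightarrow> \<bar>f x\<bar> < e" by (auto simp: eventually_at_infinity)
  thus thesis using that[of "max b 1"] by auto
qed

lemma vanishing_continuous_bounded: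
  assumes f: "f \<in> vanishing_continuous"
  obtains B where "B > 0" "\<And>x. \<bar>f x\<bar> \<le> B"
proof -
  obtain M where M: "\<And>x. norm x \<ge> M \<Longrightarrow> \<bar>f x\<bar> < 1" using vanishing_continuous_small[OF f, of 1] by auto
  have "continuous_on (cball 0 M) f"
    using f by (auto simp: vanishing_continuous_def intro: continuous_on_subset)
  hence "bounded (f ` cball 0 M)"
    by (intro compact_imp_bounded compact_continuous_image) auto
  then obtain B where B: "\<forall>y\<in>f ` cball 0 M. norm y \<le> B" unfolding bounded_iff by blast
  have "\<bar>f x\<bar> \<le> B" if "norm x \<le> M" for x
    using B that by auto
  hence "\<bar>f x\<bar> \<le> max B 1" for x
    using M[of x] by (cases "norm x \<le> M") (auto simp: le_max_iff_disj)
  thus thesis using that[of "max B 1"] by auto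
qed

lemma vanishing_continuous_measurable: "f \<in> vanishing_continuous \<Longrightarrow> f \<in> borel_measurable borel"
  by (auto simp: vanishing_continuous_def intro: borel_measurable_continuous_onI)

context dunkl_system
begin

abbreviation wt :: "real^'n \<Rightarrow> real" where "wt \<equiv> dunkl_weight Rp k"
abbreviation ck :: real where "ck \<equiv> dunkl_const Rp k"

text \<open>Half the homogeneous dimension of the measure with density \<open>wt\<close>: dilation
  by \<open>sqrt t\<close> scales that measure by \<open>t powr dim_index\<close>.\<close>

definition dim_index :: real where "dim_index = \<gamma> + real CARD('n) / 2"

lemma wt_nonneg: "0 \<le> wt y"
  unfolding dunkl_weight_def by (rule prod_nonneg) auto

lemma wt_measurable [measurable]: "wt \<in> borel_measurable borel"
  unfolding dunkl_weight_def[abs_def] by measurable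

lemma wt_scale:
  assumes r: "r > 0"
  shows "wt (r *\<^sub>R y) = r powr (2 * \<gamma>) * wt y"
proof -
  have "wt (r *\<^sub>R y) = (\<Prod>\<alpha>\<in>Rp. r powr (2 * k \<alpha>) * (if k \<alpha> = 0 then 1 else \<bar>\<alpha> \<bullet> y\<bar> powr (2 * k \<alpha>)))"
    unfolding dunkl_weight_def using r
    by (intro prod.cong HOL.refl) (simp add: abs_mult powr_mult)
  also have "\<dots> = (\<Prod>\<alpha>\<in>Rp. r powr (2 * k \<alpha>)) * wt y"
    by (simp add: prod.distrib dunkl_weight_def)
  also have "(\<Prod>\<alpha>\<in>Rp. r powr (2 * k \<alpha>)) = r powr (2 * \<gamma>)"
    using r by (simp add: \<gamma>_def sum_distrib_left powr_sum)
  finally show ?thesis .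
qed

definition q :: "real \<Rightarrow> real^'n \<Rightarrow> real^'n \<Rightarrow> real" where
  "q t x y = ck / t powr dim_index * exp (- ((norm x)\<^sup>2 + (norm y)\<^sup>2) / (2 * t))
    * E (x /\<^sub>R sqrt t) (y /\<^sub>R sqrt t) * wt y"

lemma q_measurable [measurable]:
  assumes [measurable]: "f \<in> borel_measurable M" "g \<in> borel_measurable M"
  shows "(\<lambda>x. q t (f x) (g x)) \<in> borel_measurable M"
  unfolding q_def by measurable

lemma dunkl_transition_eq:
  "dunkl_transition Rp k lam t x
    = density lborel (\<lambda>y. ennreal (exp (- (norm lam)\<^sup>2 * t / 2) * E y lam / E x lam * q t x y))"
  unfolding dunkl_transition_def q_def dim_index_def \<gamma>_def by (simp add: field_simps)

abbreviation K0 :: "real \<Rightarrow> real^'n \<Rightarrow> (real^'n) measure" where "K0 \<equiv> dunkl_transition Rp k 0"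

lemma K0_eq: "K0 t x = density lborel (\<lambda>y. ennreal (q t x y))"
  by (simp add: dunkl_transition_eq E_zero_right)

lemma sets_dunkl_transition [measurable_cong, simp]: "sets (dunkl_transition Rp k lam t x) = sets borel"
  and space_dunkl_transition [simp]: "space (dunkl_transition Rp k lam t x) = UNIV"
  by (simp_all add: dunkl_transition_def)

end

locale dunkl_drift = dunkl_system R Rp k for R Rp :: "(real^'n) set" and k +
  fixes lam :: "real^'n"
  assumes feller: "feller_semigroup (dunkl_transition Rp k lam)"
begin

abbreviation K :: "real \<Rightarrow> real^'n \<Rightarrow> (real^'n) measure" where "K \<equiv> dunkl_transition Rp k lam"

lemma K_measurable: "t > 0 \<Longrightarrow> K t \<in> borel \<rightarrow>\<^sub>M prob_algebra borel"
  using feller by (simp add: feller_semigroup_def)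

lemma K_measurable_subprob: "t > 0 \<Longrightarrow> K t \<in> borel \<rightarrow>\<^sub>M subprob_algebra borel"
  using K_measurable by (rule measurable_prob_algebraD)

lemma prob_space_K: "t > 0 \<Longrightarrow> prob_space (K t x)"
  using measurable_space[OF K_measurable, of t x] by (simp add: space_prob_algebra)

text \<open>With \<open>ck = 0\<close> the kernels with drift would be zero measures, contradicting
  their mass one.\<close>

lemma ck_nonzero: "ck \<noteq> 0"
proof
  assume "ck = 0"
  hence "emeasure (K 1 0) UNIV = 0" by (simp add: dunkl_transition_eq q_def emeasure_density)
  thus False using prob_space.emeasure_space_1[OF prob_space_K, of 1 0] by simp
qed

text \<open>If integrability failed, the integral would take the default value 0 and
  \<open>ck = 1 / 0\<close> would be 0.\<close>

lemma integrable_gauss: "integrable lborel (\<lambda>y. exp (- (norm y)\<^sup>2 / 2) * wt y)"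
  using ck_nonzero not_integrable_integral_eq by (fastforce simp: dunkl_const_def)

lemma ck_pos: "ck > 0"
proof -
  have "(LINT y|lborel. exp (- (norm y)\<^sup>2 / 2) * wt y) \<ge> 0"
    by (rule integral_nonneg_AE) (simp add: wt_nonneg)
  hence "ck \<ge> 0" by (simp add: dunkl_const_def)
  thus ?thesis using ck_nonzero by simp
qed

lemma gauss_finite:
  assumes a: "a > 0"
  shows "(\<integral>\<^sup>+y. ennreal (exp (- a * (norm y)\<^sup>2) * wt y) \<partial>lborel) < \<infinity>"
proof -
  \<comment> \<open>Chosen so that dilation by \<open>r\<close> turns the exponent - norm^2 / 2 into
    - a norm^2; homogeneity of \<open>wt\<close> supplies the rest.\<close>
  define r where "r = sqrt (2 * a)"
  have r: "r > 0" using a by (simp add: r_def)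
  have eq: "exp (- (norm (r *\<^sub>R y))\<^sup>2 / 2) * wt (r *\<^sub>R y) = r powr (2 * \<gamma>) * (exp (- a * (norm y)\<^sup>2) * wt y)" for y
    unfolding wt_scale[OF r] using a by (simp add: power_mult_distrib r_def)
  have "(\<integral>\<^sup>+y. ennreal (exp (- (norm y)\<^sup>2 / 2) * wt y) \<partial>lborel)
      = ennreal (r ^ DIM(real^'n)) * (\<integral>\<^sup>+y. ennreal (exp (- (norm (r *\<^sub>R y))\<^sup>2 / 2) * wt (r *\<^sub>R y)) \<partial>lborel)"
    by (rule nn_integral_lborel_scale[OF _ r]) simp
  also have "\<dots> = ennreal (r ^ DIM(real^'n)) * (ennreal (r powr (2 * \<gamma>)) * (\<integral>\<^sup>+y. ennreal (exp (- a * (norm y)\<^sup>2) * wt y) \<partial>lborel))"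
    unfolding eq using r by (simp add: ennreal_mult' wt_nonneg nn_integral_cmult)
  finally have "ennreal (r ^ DIM(real^'n)) * (ennreal (r powr (2 * \<gamma>)) * (\<integral>\<^sup>+y. ennreal (exp (- a * (norm y)\<^sup>2) * wt y) \<partial>lborel)) < \<infinity>"
    using integrable_gauss by (simp add: integrable_iff_bounded wt_nonneg)
  thus ?thesis using r zero_less_power[OF r, of "CARD('n)"] by (auto simp: ennreal_mult_less_top ennreal_eq_0_iff not_le)
qed

lemma q_nonneg: "0 \<le> q t x y"
  unfolding q_def using ck_pos E_pos wt_nonneg by (simp add: less_imp_le)

text \<open>The bound exp(norm x norm y / t) for the kernel factor completes the square in the
  Gaussian exponent.\<close>

lemma q_le:
  assumes t: "t > 0"
  shows "q t x y \<le> ck / t powr dim_index * exp (- (norm x - norm y)\<^sup>2 / (2 * t)) * wt y"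
proof -
  have "norm (x /\<^sub>R sqrt t) * norm (y /\<^sub>R sqrt t) = norm x * norm y / t"
    using t by (simp add: field_simps)
  hence "E (x /\<^sub>R sqrt t) (y /\<^sub>R sqrt t) \<le> exp (norm x * norm y / t)"
    using E_le[of "x /\<^sub>R sqrt t" "y /\<^sub>R sqrt t"] by simp
  hence "exp (- ((norm x)\<^sup>2 + (norm y)\<^sup>2) / (2 * t)) * E (x /\<^sub>R sqrt t) (y /\<^sub>R sqrt t)
      \<le> exp (- ((norm x)\<^sup>2 + (norm y)\<^sup>2) / (2 * t)) * exp (norm x * norm y / t)"
    by (intro mult_left_mono) auto
  also have "\<dots> = exp (- (norm x - norm y)\<^sup>2 / (2 * t))"
    unfolding exp_add[symmetric] using t by (simp add: power2_diff field_simps)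
  finally have "ck / t powr dim_index * (exp (- ((norm x)\<^sup>2 + (norm y)\<^sup>2) / (2 * t)) * E (x /\<^sub>R sqrt t) (y /\<^sub>R sqrt t)) * wt y
      \<le> ck / t powr dim_index * exp (- (norm x - norm y)\<^sup>2 / (2 * t)) * wt y"
    using ck_pos by (intro mult_right_mono mult_left_mono wt_nonneg) auto
  thus ?thesis by (simp add: q_def mult.assoc)
qed

text \<open>Separates the variables: half of the decay in \<open>y\<close> is given up so that the
  dependence on \<open>x\<close> becomes a mere factor.\<close>

lemma q_le_gauss:
  assumes t: "t > 0"
  shows "q t x y \<le> ck / t powr dim_index * exp ((norm x)\<^sup>2 / (2 * t)) * (exp (- (1 / (4 * t)) * (norm y)\<^sup>2) * wt y)"
proof -
  \<comment> \<open>Expanded, this says -(a - b)^2 is at most a^2 - b^2 / 2 for the two norms a and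
    b.\<close>
  have "0 \<le> 2 * (norm x - norm y / 2)\<^sup>2" by simp
  hence "- (norm x - norm y)\<^sup>2 \<le> (norm x)\<^sup>2 - (norm y)\<^sup>2 / 2"
    by (simp add: power2_eq_square algebra_simps)
  hence "- (norm x - norm y)\<^sup>2 / (2 * t) \<le> ((norm x)\<^sup>2 - (norm y)\<^sup>2 / 2) / (2 * t)"
    using t by (intro divide_right_mono) auto
  also have "\<dots> = (norm x)\<^sup>2 / (2 * t) + - (1 / (4 * t)) * (norm y)\<^sup>2"
    using t by (simp add: field_simps)
  finally have "exp (- (norm x - norm y)\<^sup>2 / (2 * t)) \<le> exp ((norm x)\<^sup>2 / (2 * t)) * exp (- (1 / (4 * t)) * (norm y)\<^sup>2)"
    unfolding exp_add[symmetric] exp_le_cancel_iff .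
  hence "ck / t powr dim_index * exp (- (norm x - norm y)\<^sup>2 / (2 * t)) * wt y
      \<le> ck / t powr dim_index * (exp ((norm x)\<^sup>2 / (2 * t)) * exp (- (1 / (4 * t)) * (norm y)\<^sup>2)) * wt y"
    using ck_pos by (intro mult_right_mono mult_left_mono wt_nonneg) auto
  with q_le[OF t, of x y] show ?thesis by (simp add: mult.assoc)
qed

section \<open>Passing between the kernels with and without drift\<close>

lemma nn_integral_K0:
  assumes [measurable]: "f \<in> borel_measurable borel"
  shows "(\<integral>\<^sup>+y. f y \<partial>K0 t x) = (\<integral>\<^sup>+y. ennreal (q t x y) * f y \<partial>lborel)"
  unfolding K0_eq by (subst nn_integral_density) auto

lemma nn_integral_K:
  assumes [measurable]: "f \<in> borel_measurable borel"
  shows "(\<integral>\<^sup>+y. f y \<partial>K t x)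
    = (\<integral>\<^sup>+y. ennreal (exp (- (norm lam)\<^sup>2 * t / 2) * E y lam / E x lam) * f y \<partial>K0 t x)"
proof -
  have "ennreal (exp (- (norm lam)\<^sup>2 * t / 2) * E y lam / E x lam * q t x y)
      = ennreal (q t x y) * ennreal (exp (- (norm lam)\<^sup>2 * t / 2) * E y lam / E x lam)" for y
    using E_pos[of y lam] E_pos[of x lam] by (subst ennreal_mult[symmetric]) (auto simp: q_nonneg mult.commute)
  thus ?thesis
    unfolding dunkl_transition_eq[of lam] by (subst nn_integral_density) (auto simp: nn_integral_K0 mult.assoc)
qed

lemma nn_integral_K0_from_K:
  assumes [measurable]: "g \<in> borel_measurable borel"
  shows "(\<integral>\<^sup>+y. g y \<partial>K0 t x)
    = (\<integral>\<^sup>+y. ennreal (exp ((norm lam)\<^sup>2 * t / 2) * E x lam / E y lam) * g y \<partial>K t x)"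
proof -
  have *: "ennreal (exp (- (norm lam)\<^sup>2 * t / 2) * E y lam / E x lam)
      * (ennreal (exp ((norm lam)\<^sup>2 * t / 2) * E x lam / E y lam) * g y) = g y" for y
  proof -
    have "exp (- (norm lam)\<^sup>2 * t / 2) * E y lam / E x lam * (exp ((norm lam)\<^sup>2 * t / 2) * E x lam / E y lam)
        = exp (- (norm lam)\<^sup>2 * t / 2) * exp ((norm lam)\<^sup>2 * t / 2)"
      using E_pos[of y lam] E_pos[of x lam] by simp
    also have "\<dots> = 1" unfolding exp_add[symmetric] by simp
    finally show ?thesis
      using E_pos[of y lam] E_pos[of x lam]
      by (subst mult.assoc[symmetric], subst ennreal_mult[symmetric]) auto
  qed
  have m: "(\<lambda>y. ennreal (exp ((norm lam)\<^sup>2 * t / 2) * E x lam / E y lam) * g y) \<in> borel_measurable borel"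
    by measurable
  show ?thesis unfolding nn_integral_K[OF m] * ..
qed

lemma nn_integral_K0_measurable [measurable]:
  assumes [measurable]: "g \<in> borel_measurable borel"
  shows "(\<lambda>x. \<integral>\<^sup>+y. g y \<partial>K0 t x) \<in> borel_measurable borel"
  unfolding nn_integral_K0[OF assms] by measurable

lemma nn_integral_K_measurable [measurable]:
  assumes [measurable]: "g \<in> borel_measurable borel"
  shows "(\<lambda>x. \<integral>\<^sup>+y. g y \<partial>K t x) \<in> borel_measurable borel"
proof -
  have "(\<lambda>y. ennreal (exp (- (norm lam)\<^sup>2 * t / 2) * E y lam / E x lam) * g y) \<in> borel_measurable borel" for x
    by measurable
  from nn_integral_K0[OF this] show ?thesis
    unfolding nn_integral_K[OF assms] by simp
qed

lemma chapman_kolmogorov: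
  assumes s: "s > 0" and t: "t > 0" and [measurable]: "g \<in> borel_measurable borel"
  shows "(\<integral>\<^sup>+y. g y \<partial>K0 (s + t) x) = (\<integral>\<^sup>+z. \<integral>\<^sup>+y. g y \<partial>K0 t z \<partial>K0 s x)"
proof -
  let ?c = "\<lambda>t. exp ((norm lam)\<^sup>2 * t / 2)"
  have c: "?c (s + t) = ?c s * ?c t"
    unfolding exp_add[symmetric] by (simp add: field_simps)
  have Eq: "K (s + t) x = K s x \<bind> K t"
    using feller s t by (simp add: feller_semigroup_def)
  have N: "K t \<in> K s x \<rightarrow>\<^sub>M subprob_algebra borel"
    by (subst measurable_cong_sets[OF sets_dunkl_transition HOL.refl]) (rule K_measurable_subprob[OF t])
  have "(\<integral>\<^sup>+y. g y \<partial>K0 (s + t) x) = (\<integral>\<^sup>+z. \<integral>\<^sup>+y. ennreal (?c (s + t) * E x lam / E y lam) * g y \<partial>K t z \<partial>K s x)"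
    unfolding nn_integral_K0_from_K[OF assms(3)] Eq
    by (rule nn_integral_bind[OF _ N]) measurable
  also have "\<dots> = (\<integral>\<^sup>+z. ennreal (?c s * E x lam / E z lam) * (\<integral>\<^sup>+y. g y \<partial>K0 t z) \<partial>K s x)"
  proof (intro nn_integral_cong)
    fix z
    \<comment> \<open>The transfer factor is a quotient of endpoint terms, so it telescopes through
      the intermediate point \<open>z\<close>.\<close>
    have *: "ennreal (?c (s + t) * E x lam / E y lam) * g y
        = ennreal (?c s * E x lam / E z lam) * (ennreal (?c t * E z lam / E y lam) * g y)" for y
      using E_pos[of x lam] E_pos[of z lam] E_pos[of y lam] unfolding c mult.assoc[symmetric]
      by (subst ennreal_mult[symmetric]) (auto simp: ac_simps)
    show "(\<integral>\<^sup>+y. ennreal (?c (s + t) * E x lam / E y lam) * g y \<partial>K t z)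
        = ennreal (?c s * E x lam / E z lam) * (\<integral>\<^sup>+y. g y \<partial>K0 t z)"
      unfolding * nn_integral_K0_from_K[OF assms(3)] by (rule nn_integral_cmult) measurable
  qed
  also have "\<dots> = (\<integral>\<^sup>+z. \<integral>\<^sup>+y. g y \<partial>K0 t z \<partial>K0 s x)"
    by (rule nn_integral_K0_from_K[symmetric]) measurable
  finally show ?thesis .
qed

end

section \<open>Total mass of the driftless kernels\<close>

context dunkl_drift
begin

lemma integrable_gauss_wt: "a > 0 \<Longrightarrow> integrable lborel (\<lambda>y. exp (- a * (norm y)\<^sup>2) * wt y)"
  by (rule integrableI_bounded) (use gauss_finite[of a] in \<open>simp_all add: wt_nonneg\<close>)

text \<open>One majorant for all \<open>x\<close> in a ball, as needed for dominated convergence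
  along a convergent sequence of starting points.\<close>

lemma q_mult_le:
  assumes t: "t > 0" and B: "\<bar>b\<bar> \<le> B" and x: "norm x \<le> M"
  shows "norm (q t x y * b)
    \<le> B * (ck / t powr dim_index * exp (M\<^sup>2 / (2 * t))) * (exp (- (1 / (4 * t)) * (norm y)\<^sup>2) * wt y)"
proof -
  have "(norm x)\<^sup>2 \<le> M\<^sup>2" using x by (intro power_mono) auto
  hence "ck / t powr dim_index * exp ((norm x)\<^sup>2 / (2 * t)) * (exp (- (1 / (4 * t)) * (norm y)\<^sup>2) * wt y)
      \<le> ck / t powr dim_index * exp (M\<^sup>2 / (2 * t)) * (exp (- (1 / (4 * t)) * (norm y)\<^sup>2) * wt y)"
    using t ck_pos wt_nonneg by (intro mult_right_mono mult_left_mono) (auto intro!: divide_right_mono)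
  with q_le_gauss[OF t, of x y]
  have "q t x y \<le> ck / t powr dim_index * exp (M\<^sup>2 / (2 * t)) * (exp (- (1 / (4 * t)) * (norm y)\<^sup>2) * wt y)"
    by (rule order.trans)
  hence "q t x y * \<bar>b\<bar> \<le> ck / t powr dim_index * exp (M\<^sup>2 / (2 * t)) * (exp (- (1 / (4 * t)) * (norm y)\<^sup>2) * wt y) * B"
    using B q_nonneg[of t x y] by (intro mult_mono) auto
  thus ?thesis by (simp add: abs_mult q_nonneg mult.commute mult.left_commute)
qed

lemma integrable_q:
  assumes t: "t > 0" and [measurable]: "f \<in> borel_measurable borel" and f: "\<And>y. \<bar>f y\<bar> \<le> B"
  shows "integrable lborel (\<lambda>y. q t x y * f y)"
proof (rule Bochner_Integration.integrable_bound)
  show "integrable lborel (\<lambda>y. B * (ck / t powr dim_index * exp ((norm x)\<^sup>2 / (2 * t)))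
      * (exp (- (1 / (4 * t)) * (norm y)\<^sup>2) * wt y))"
    using t by (intro integrable_mult_right integrable_gauss_wt) auto
  show "AE y in lborel. norm (q t x y * f y)
      \<le> norm (B * (ck / t powr dim_index * exp ((norm x)\<^sup>2 / (2 * t)))
      * (exp (- (1 / (4 * t)) * (norm y)\<^sup>2) * wt y))"
    using order.trans[OF q_mult_le[OF t f order.refl] abs_ge_self] by (simp only: real_norm_def) simp
qed measurable

lemma continuous_on_q_integral:
  assumes t: "t > 0" and [measurable]: "f \<in> borel_measurable borel" and f: "\<And>y. \<bar>f y\<bar> \<le> B"
  shows "continuous_on UNIV (\<lambda>x. LINT y|lborel. q t x y * f y)"
proof -
  have "(\<lambda>n. LINT y|lborel. q t (X n) y * f y) \<longlonglongrightarrow> (LINT y|lborel. q t x y * f y)"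
    if X: "X \<longlonglongrightarrow> x" for X x
  proof -
    obtain M where M: "\<And>n. norm (X n) \<le> M"
      using Bseq_def convergentI[OF X] convergent_imp_Bseq by blast
    show ?thesis
    proof (rule integral_dominated_convergence)
      show "integrable lborel (\<lambda>y. B * (ck / t powr dim_index * exp (M\<^sup>2 / (2 * t)))
          * (exp (- (1 / (4 * t)) * (norm y)\<^sup>2) * wt y))"
        using t by (intro integrable_mult_right integrable_gauss_wt) auto
      show "AE y in lborel. norm (q t (X n) y * f y) \<le> B * (ck / t powr dim_index * exp (M\<^sup>2 / (2 * t)))
          * (exp (- (1 / (4 * t)) * (norm y)\<^sup>2) * wt y)" for n
        using q_mult_le[OF t f M] by (intro always_eventually allI)
      have "continuous_on UNIV (\<lambda>x. q t x y * f y)" for y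
        unfolding q_def using t by (intro continuous_intros) auto
      thus "AE y in lborel. (\<lambda>n. q t (X n) y * f y) \<longlonglongrightarrow> q t x y * f y"
        using X by (intro always_eventually allI) (auto simp: continuous_on_eq_continuous_at isCont_def intro: isCont_tendsto_compose)
    qed measurable
  qed
  thus ?thesis
    by (auto simp: continuous_on_sequentially comp_def)
qed

section \<open>Scaling, growth and propagation of the total mass\<close>

definition mass :: "real^'n \<Rightarrow> real" where "mass x = (LINT y|lborel. q 1 x y)"

lemma nn_integral_q: "t > 0 \<Longrightarrow> (\<integral>\<^sup>+y. ennreal (q t x y) \<partial>lborel) = ennreal (LINT y|lborel. q t x y)"
  using integrable_q[of t "\<lambda>_. 1" 1 x] by (intro nn_integral_eq_integral) (auto simp: q_nonneg)

text \<open>Substituting \<open>sqrt t *\<^sub>R y\<close> produces t^(N/2) from the Jacobian and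
  t^\<gamma> from \<open>wt\<close>, exactly cancelling the normalisation
  \<open>t powr dim_index\<close>.\<close>

lemma nn_integral_q_scale:
  assumes t: "t > 0"
  shows "(\<integral>\<^sup>+y. ennreal (q t x y) \<partial>lborel) = ennreal (mass (x /\<^sub>R sqrt t))"
proof -
  have s: "sqrt t > 0" using t by simp
  have "sqrt t ^ CARD('n) * q t x (sqrt t *\<^sub>R y) = q 1 (x /\<^sub>R sqrt t) y" for y
  proof -
    have "sqrt t ^ CARD('n) = t powr (real CARD('n) / 2)"
      using t by (simp add: powr_half_sqrt[symmetric] powr_powr flip: powr_realpow)
    moreover have "sqrt t powr (2 * \<gamma>) = t powr \<gamma>"
      using t by (simp add: powr_half_sqrt[symmetric] powr_powr)
    moreover have "t powr dim_index = t powr \<gamma> * t powr (real CARD('n) / 2)"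
      by (simp add: dim_index_def powr_add)
    moreover have "(norm (x /\<^sub>R sqrt t))\<^sup>2 + (norm y)\<^sup>2 = ((norm x)\<^sup>2 + (norm (sqrt t *\<^sub>R y))\<^sup>2) / t"
      using t by (simp add: power_mult_distrib power_divide field_simps)
    ultimately show ?thesis
      unfolding q_def wt_scale[OF s] using t by (simp add: field_simps)
  qed
  moreover have "(\<integral>\<^sup>+y. ennreal (q t x y) \<partial>lborel)
      = (\<integral>\<^sup>+y. ennreal (sqrt t ^ CARD('n)) * ennreal (q t x (sqrt t *\<^sub>R y)) \<partial>lborel)"
    by (subst nn_integral_lborel_scale[OF _ s]) (simp_all add: nn_integral_cmult)
  ultimately have "(\<integral>\<^sup>+y. ennreal (q t x y) \<partial>lborel) = (\<integral>\<^sup>+y. ennreal (q 1 (x /\<^sub>R sqrt t) y) \<partial>lborel)"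
    using t by (simp add: ennreal_mult'[symmetric])
  thus ?thesis by (simp add: nn_integral_q mass_def)
qed

lemma continuous_on_mass: "continuous_on UNIV mass"
  using continuous_on_q_integral[of 1 "\<lambda>_. 1" 1] by (simp add: mass_def[abs_def])

lemma mass_0: "mass 0 = 1"
proof -
  have "mass 0 = ck * (LINT y|lborel. exp (- (norm y)\<^sup>2 / 2) * wt y)"
    by (simp add: mass_def q_def E_zero_left mult.assoc)
  thus ?thesis using ck_nonzero by (simp add: dunkl_const_def)
qed

lemma mass_nonneg: "0 \<le> mass x"
  unfolding mass_def by (rule integral_nonneg_AE) (simp add: q_nonneg)

text \<open>A crude growth bound suffices: evaluated at z / sqrt \<tau> with \<tau> large, it grows
  more slowly than the Gaussian density decays.\<close>

lemma mass_le: obtains C where "C > 0" "\<And>x. mass x \<le> C * exp ((norm x)\<^sup>2 / 2)"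
proof -
  define G where "G = (LINT y|lborel. exp (- (1 / 4) * (norm y)\<^sup>2) * wt y)"
  have G: "G \<ge> 0" unfolding G_def by (rule integral_nonneg_AE) (simp add: wt_nonneg)
  have "mass x \<le> ck * exp ((norm x)\<^sup>2 / 2) * G" for x
  proof -
    have "mass x \<le> (LINT y|lborel. ck * exp ((norm x)\<^sup>2 / 2) * (exp (- (1 / 4) * (norm y)\<^sup>2) * wt y))"
      unfolding mass_def
    proof (rule integral_mono)
      show "integrable lborel (q 1 x)" using integrable_q[of 1 "\<lambda>_. 1" 1 x] by simp
      show "integrable lborel (\<lambda>y. ck * exp ((norm x)\<^sup>2 / 2) * (exp (- (1 / 4) * (norm y)\<^sup>2) * wt y))"
        by (intro integrable_mult_right integrable_gauss_wt) auto
      show "q 1 x y \<le> ck * exp ((norm x)\<^sup>2 / 2) * (exp (- (1 / 4) * (norm y)\<^sup>2) * wt y)" for y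
        using q_le_gauss[of 1 x y] by simp
    qed
    thus ?thesis by (simp add: G_def)
  qed
  hence "mass x \<le> (ck * G + 1) * exp ((norm x)\<^sup>2 / 2)" for x
    by (rule order.trans) (simp add: algebra_simps)
  thus thesis using that[of "ck * G + 1"] G ck_pos by (simp add: add_nonneg_pos)
qed

text \<open>The total mass of \<open>K0 t x\<close> depends on \<open>x / sqrt t\<close> only, is \<open>1\<close> at \<open>0\<close>, and is propagated by
  the semigroup; letting the second time parameter tend to infinity makes it \<open>1\<close> everywhere.\<close>

lemma nn_integral_q_eq_1:
  assumes s: "s > 0"
  shows "(\<integral>\<^sup>+y. ennreal (q s x y) \<partial>lborel) = 1"
proof -
  obtain C where C: "C > 0" "\<And>x. mass x \<le> C * exp ((norm x)\<^sup>2 / 2)" using mass_le by blast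
  define D where "D = C * (ck / s powr dim_index * exp ((norm x)\<^sup>2 / (2 * s)))"
  \<comment> \<open>With \<tau> at least 4 s the mass grows at most like exp(norm z^2 / (8 s)), half
    the rate at which \<open>q s x z\<close> decays by \<open>q_le_gauss\<close>; the majorant stays
    integrable.\<close>
  define \<tau> where "\<tau> n = 4 * s + 1 + real n" for n
  have \<tau>: "\<tau> n > 0" "\<tau> n \<ge> 4 * s" for n using s by (auto simp: \<tau>_def)
  have [measurable]: "mass \<in> borel_measurable borel"
    by (rule borel_measurable_continuous_onI[OF continuous_on_mass])
  \<comment> \<open>Used with r = s for the start \<open>x\<close> at total time s + \<tau>, and
    with r = 0 inside the integral.\<close>
  have scale: "filterlim (\<lambda>n. sqrt (r + \<tau> n)) at_top sequentially" for r
  proof (rule filterlim_compose[OF sqrt_at_top])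
    show "filterlim (\<lambda>n. r + \<tau> n) at_top sequentially"
      unfolding \<tau>_def
      by (intro filterlim_tendsto_add_at_top[OF tendsto_const] filterlim_real_sequentially)
  qed
  have lim: "(\<lambda>n. ennreal (mass (z /\<^sub>R sqrt (r + \<tau> n)))) \<longlonglongrightarrow> 1" for z r
  proof -
    have "(\<lambda>n. inverse (sqrt (r + \<tau> n)) *\<^sub>R z) \<longlonglongrightarrow> 0 *\<^sub>R z"
      by (intro tendsto_scaleR tendsto_const filterlim_compose[OF tendsto_inverse_0_at_top scale]
          tendsto_inverse_0_at_top scale)
    hence "(\<lambda>n. mass (inverse (sqrt (r + \<tau> n)) *\<^sub>R z)) \<longlonglongrightarrow> mass 0"
      using continuous_on_mass by (auto simp: continuous_on_eq_continuous_at intro: isCont_tendsto_compose)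
    hence "(\<lambda>n. ennreal (mass (inverse (sqrt (r + \<tau> n)) *\<^sub>R z))) \<longlonglongrightarrow> ennreal 1"
      unfolding mass_0 by (rule tendsto_ennrealI)
    thus ?thesis by simp
  qed
  have "ennreal (mass (x /\<^sub>R sqrt (s + \<tau> n)))
      = (\<integral>\<^sup>+z. ennreal (q s x z) * ennreal (mass (z /\<^sub>R sqrt (0 + \<tau> n))) \<partial>lborel)" for n
  proof -
    have "ennreal (mass (x /\<^sub>R sqrt (s + \<tau> n))) = (\<integral>\<^sup>+y. 1 \<partial>K0 (s + \<tau> n) x)"
      using s \<tau>[of n] by (subst nn_integral_K0) (auto simp: nn_integral_q_scale)
    also have "\<dots> = (\<integral>\<^sup>+z. \<integral>\<^sup>+y. 1 \<partial>K0 (\<tau> n) z \<partial>K0 s x)"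
      by (rule chapman_kolmogorov) (use s \<tau> in auto)
    also have "\<dots> = (\<integral>\<^sup>+z. ennreal (mass (z /\<^sub>R sqrt (0 + \<tau> n))) \<partial>K0 s x)"
    proof (rule nn_integral_cong)
      fix z
      have "(\<integral>\<^sup>+y. 1 \<partial>K0 (\<tau> n) z) = (\<integral>\<^sup>+y. ennreal (q (\<tau> n) z y) \<partial>lborel)"
        by (subst nn_integral_K0) auto
      thus "(\<integral>\<^sup>+y. 1 \<partial>K0 (\<tau> n) z) = ennreal (mass (z /\<^sub>R sqrt (0 + \<tau> n)))"
        by (simp only: nn_integral_q_scale[OF \<tau>(1)] add_0)
    qed
    also have "\<dots> = (\<integral>\<^sup>+z. ennreal (q s x z) * ennreal (mass (z /\<^sub>R sqrt (0 + \<tau> n))) \<partial>lborel)"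
      by (rule nn_integral_K0) measurable
    finally show ?thesis .
  qed
  moreover have "(\<lambda>n. \<integral>\<^sup>+z. ennreal (q s x z) * ennreal (mass (z /\<^sub>R sqrt (0 + \<tau> n))) \<partial>lborel)
      \<longlonglongrightarrow> (\<integral>\<^sup>+z. ennreal (q s x z) * 1 \<partial>lborel)"
  proof (rule nn_integral_dominated_convergence)
    show "(\<integral>\<^sup>+z. ennreal (D * (exp (- (1 / (8 * s)) * (norm z)\<^sup>2) * wt z)) \<partial>lborel) < \<infinity>"
    proof -
      have "D \<ge> 0" using C(1) ck_pos by (simp add: D_def)
      thus ?thesis
        using gauss_finite[of "1 / (8 * s)"] s
        by (simp add: ennreal_mult' wt_nonneg nn_integral_cmult ennreal_mult_less_top)
    qed
    show "AE z in lborel. ennreal (q s x z) * ennreal (mass (z /\<^sub>R sqrt (0 + \<tau> n)))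
        \<le> ennreal (D * (exp (- (1 / (8 * s)) * (norm z)\<^sup>2) * wt z))" for n
    proof (intro always_eventually allI)
      fix z :: "real^'n"
      have "(norm (z /\<^sub>R sqrt (\<tau> n)))\<^sup>2 / 2 = (norm z)\<^sup>2 / (2 * \<tau> n)"
        using \<tau>(1)[of n] by (simp add: power_mult_distrib power_divide field_simps)
      also have "\<dots> \<le> (norm z)\<^sup>2 / (2 * (4 * s))"
        using \<tau>[of n] s by (intro divide_left_mono) auto
      finally have "mass (z /\<^sub>R sqrt (\<tau> n)) \<le> C * exp ((norm z)\<^sup>2 / (8 * s))"
        using C(1) by (intro order.trans[OF C(2)]) (simp add: mult_left_mono)
      hence "q s x z * mass (z /\<^sub>R sqrt (\<tau> n))
          \<le> (ck / s powr dim_index * exp ((norm x)\<^sup>2 / (2 * s)) * (exp (- (1 / (4 * s)) * (norm z)\<^sup>2) * wt z))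
            * (C * exp ((norm z)\<^sup>2 / (8 * s)))"
        using q_le_gauss[OF s] q_nonneg mass_nonneg ck_pos wt_nonneg by (intro mult_mono) auto
      also have "\<dots> = D * (exp (- (1 / (4 * s)) * (norm z)\<^sup>2) * exp ((norm z)\<^sup>2 / (8 * s)) * wt z)"
        by (simp add: D_def mult.commute mult.left_commute)
      also have "exp (- (1 / (4 * s)) * (norm z)\<^sup>2) * exp ((norm z)\<^sup>2 / (8 * s)) = exp (- (1 / (8 * s)) * (norm z)\<^sup>2)"
        unfolding exp_add[symmetric] using s by (simp add: field_simps)
      finally show "ennreal (q s x z) * ennreal (mass (z /\<^sub>R sqrt (0 + \<tau> n)))
          \<le> ennreal (D * (exp (- (1 / (8 * s)) * (norm z)\<^sup>2) * wt z))"
        by (simp add: ennreal_mult[symmetric] q_nonneg mass_nonneg ennreal_leI)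
    qed
    show "AE z in lborel. (\<lambda>n. ennreal (q s x z) * ennreal (mass (z /\<^sub>R sqrt (0 + \<tau> n)))) \<longlonglongrightarrow> ennreal (q s x z) * 1"
      by (intro always_eventually allI ennreal_tendsto_cmult lim) simp
  qed measurable
  ultimately have "(\<lambda>n. ennreal (mass (x /\<^sub>R sqrt (s + \<tau> n)))) \<longlonglongrightarrow> (\<integral>\<^sup>+z. ennreal (q s x z) \<partial>lborel)"
    by simp
  from LIMSEQ_unique[OF this lim] show ?thesis .
qed

section \<open>The driftless kernels as a Markov semigroup\<close>

lemma prob_space_K0: "t > 0 \<Longrightarrow> prob_space (K0 t x)"
  by (rule prob_spaceI) (simp add: K0_eq emeasure_density nn_integral_q_eq_1)

lemma K0_measurable_subprob:
  assumes t: "t > 0"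
  shows "K0 t \<in> borel \<rightarrow>\<^sub>M subprob_algebra borel"
proof (rule measurable_subprob_algebra)
  show "subprob_space (K0 t x)" for x by (rule prob_space_imp_subprob_space[OF prob_space_K0[OF t]])
  show "(\<lambda>x. emeasure (K0 t x) A) \<in> borel_measurable borel" if [measurable]: "A \<in> sets borel" for A
    using nn_integral_K0_measurable[of "indicator A" t] by simp
qed simp

lemma K0_measurable: "t > 0 \<Longrightarrow> K0 t \<in> borel \<rightarrow>\<^sub>M prob_algebra borel"
  by (intro measurable_prob_algebraI prob_space_K0 K0_measurable_subprob)

lemma K0_semigroup:
  assumes s: "s > 0" and t: "t > 0"
  shows "K0 (s + t) x = K0 s x \<bind> K0 t"
proof (rule measure_eqI)
  have N: "K0 t \<in> K0 s x \<rightarrow>\<^sub>M subprob_algebra borel"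
    by (subst measurable_cong_sets[OF sets_dunkl_transition HOL.refl]) (rule K0_measurable_subprob[OF t])
  show "sets (K0 (s + t) x) = sets (K0 s x \<bind> K0 t)"
    using sets_bind[OF sets_kernel[OF N], of borel] by simp
  fix A assume "A \<in> sets (K0 (s + t) x)"
  hence [measurable]: "A \<in> sets borel" by simp
  show "emeasure (K0 (s + t) x) A = emeasure (K0 s x \<bind> K0 t) A"
    using chapman_kolmogorov[OF s t, of "indicator A" x]
    by (subst emeasure_bind[OF _ N]) auto
qed

lemma integral_K0: "f \<in> borel_measurable borel \<Longrightarrow> (LINT y|K0 t x. f y) = (LINT y|lborel. q t x y * f y)"
  unfolding K0_eq by (subst integral_density) (auto simp: q_nonneg)

lemma integral_K0_eq_K:
  assumes [measurable]: "g \<in> borel_measurable borel"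
  shows "(LINT y|K0 t x. g y) = exp ((norm lam)\<^sup>2 * t / 2) * E x lam * (LINT y|K t x. g y / E y lam)"
proof -
  have "(LINT y|K t x. g y / E y lam)
      = (LINT y|lborel. (exp (- (norm lam)\<^sup>2 * t / 2) * E y lam / E x lam * q t x y) * (g y / E y lam))"
    unfolding dunkl_transition_eq[of lam] using E_pos[of _ lam]
    by (subst integral_density) (auto simp: q_nonneg less_imp_le)
  also have "\<dots> = (LINT y|lborel. (exp (- (norm lam)\<^sup>2 * t / 2) / E x lam) * (q t x y * g y))"
    using E_pos[of _ lam] by (intro Bochner_Integration.integral_cong) (auto simp: less_imp_neq[symmetric])
  also have "\<dots> = (exp (- (norm lam)\<^sup>2 * t / 2) / E x lam) * (LINT y|K0 t x. g y)"
    by (simp add: integral_K0)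
  finally have eq: "(LINT y|K t x. g y / E y lam) = (exp (- (norm lam)\<^sup>2 * t / 2) / E x lam) * (LINT y|K0 t x. g y)" .
  have "exp ((norm lam)\<^sup>2 * t / 2) * exp (- (norm lam)\<^sup>2 * t / 2) = 1"
    unfolding exp_add[symmetric] by simp
  hence "exp ((norm lam)\<^sup>2 * t / 2) * E x lam * ((exp (- (norm lam)\<^sup>2 * t / 2) / E x lam) * b) = b" for b
    using E_pos[of x lam] by (simp add: field_simps)
  thus ?thesis unfolding eq by simp
qed

end

section \<open>The driftless Feller semigroup\<close>

lemma clamp_to_symmetric_interval:
  fixes a d :: real
  assumes "d > 0"
  shows "\<bar>max (- d) (min d a)\<bar> \<le> d" "\<bar>a\<bar> \<le> d \<Longrightarrow> max (- d) (min d a) = a"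
  using assms by (auto simp: min_def max_def)

context dunkl_drift
begin

lemma integrable_K0:
  fixes f :: "real^'n \<Rightarrow> real"
  assumes t: "t > 0" and [measurable]: "f \<in> borel_measurable borel" and f: "\<And>y. \<bar>f y\<bar> \<le> B"
  shows "integrable (K0 t x) f"
proof -
  interpret prob_space "K0 t x" by (rule prob_space_K0[OF t])
  show ?thesis by (rule integrable_const_bound[where B = B]) (use f in auto)
qed

lemma abs_integral_K0_le:
  fixes f :: "real^'n \<Rightarrow> real"
  assumes t: "t > 0" and [measurable]: "f \<in> borel_measurable borel" and f: "\<And>y. \<bar>f y\<bar> \<le> B"
  shows "\<bar>LINT y|K0 t x. f y\<bar> \<le> B"
proof -
  interpret prob_space "K0 t x" by (rule prob_space_K0[OF t])
  have "\<bar>LINT y|K0 t x. f y\<bar> \<le> (LINT y|K0 t x. \<bar>f y\<bar>)" by (rule integral_abs_bound)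
  also have "\<dots> \<le> (LINT y|K0 t x. B)"
    using integrable_K0[OF t assms(2) f] by (intro integral_mono f) simp_all
  also have "\<dots> = B" using prob_space by simp
  finally show ?thesis .
qed

text \<open>Starting outside the ball, the distance \<open>norm x - norm y\<close> in
  \<open>q_le\<close> is at least \<open>norm x - M\<close>. As \<open>V\<close> depends on neither
  \<open>t\<close> nor \<open>x\<close>, the bound serves both for x to infinity and, uniformly in
  distant \<open>x\<close>, for t to 0.\<close>

lemma integral_K0_cball_le:
  obtains V where "V > 0" "\<And>t x. t > 0 \<Longrightarrow> norm x \<ge> M \<Longrightarrow>
    (LINT y|K0 t x. indicat_real (cball 0 M) y) \<le> V / t powr dim_index * exp (- (norm x - M)\<^sup>2 / (2 * t))"
proof -
  have [measurable]: "cball (0::real^'n) M \<in> sets borel" by (rule borel_closed) simp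
  define I where "I = (LINT y|lborel. indicat_real (cball 0 M) y * wt y)"
  have int: "integrable lborel (\<lambda>y. indicat_real (cball 0 M) y * wt y)"
  proof (rule Bochner_Integration.integrable_bound)
    show "integrable lborel (\<lambda>y. exp (M\<^sup>2) * (exp (- 1 * (norm y)\<^sup>2) * wt y))"
      by (intro integrable_mult_right integrable_gauss_wt) simp
    have "wt y \<le> exp (M\<^sup>2) * (exp (- 1 * (norm y)\<^sup>2) * wt y)" if "norm y \<le> M" for y
    proof -
      have "1 \<le> exp (M\<^sup>2) * exp (- 1 * (norm y)\<^sup>2)"
        unfolding exp_add[symmetric] one_le_exp_iff using that by (simp add: power_mono)
      from mult_right_mono[OF this wt_nonneg, of y] show ?thesis by (simp add: mult.assoc)
    qed
    thus "AE y in lborel. norm (indicat_real (cball 0 M) y * wt y) \<le> norm (exp (M\<^sup>2) * (exp (- 1 * (norm y)\<^sup>2) * wt y))"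
      by (auto simp: indicator_def wt_nonneg abs_mult)
  qed measurable
  have I: "I \<ge> 0" unfolding I_def by (rule integral_nonneg_AE) (simp add: wt_nonneg)
  show thesis
  \<comment> \<open>\<open>I\<close> may be 0, for instance if \<open>M\<close> is negative; adding
    1 keeps the constant positive.\<close>
  proof (rule that[of "ck * (I + 1)"])
    show "ck * (I + 1) > 0" using ck_pos I by simp
    fix t :: real and x :: "real^'n" assume t: "t > 0" and x: "norm x \<ge> M"
    let ?e = "ck / t powr dim_index * exp (- (norm x - M)\<^sup>2 / (2 * t))"
    have "(LINT y|K0 t x. indicat_real (cball 0 M) y) = (LINT y|lborel. q t x y * indicat_real (cball 0 M) y)"
      by (rule integral_K0) measurable
    also have "\<dots> \<le> (LINT y|lborel. ?e * (indicat_real (cball 0 M) y * wt y))"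
    proof (rule integral_mono)
      show "integrable lborel (\<lambda>y. q t x y * indicat_real (cball 0 M) y)"
        by (rule integrable_q[OF t, of _ 1]) (auto simp: indicator_def)
      show "integrable lborel (\<lambda>y. ?e * (indicat_real (cball 0 M) y * wt y))"
        by (rule integrable_mult_right[OF int])
      fix y :: "real^'n"
      show "q t x y * indicat_real (cball 0 M) y \<le> ?e * (indicat_real (cball 0 M) y * wt y)"
      proof (cases "norm y \<le> M")
        case True
        have "(norm x - M)\<^sup>2 \<le> (norm x - norm y)\<^sup>2" using True x by (intro power_mono) auto
        hence "exp (- (norm x - norm y)\<^sup>2 / (2 * t)) \<le> exp (- (norm x - M)\<^sup>2 / (2 * t))"
          using t by (simp add: divide_right_mono)
        hence "ck / t powr dim_index * exp (- (norm x - norm y)\<^sup>2 / (2 * t)) * wt y \<le> ?e * wt y"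
          using ck_pos wt_nonneg by (intro mult_right_mono mult_left_mono) auto
        with q_le[OF t, of x y] True show ?thesis by simp
      qed simp
    qed
    also have "\<dots> = ?e * I" by (simp add: I_def)
    also have "\<dots> \<le> ?e * (I + 1)" using ck_pos by (intro mult_left_mono) auto
    finally show "(LINT y|K0 t x. indicat_real (cball 0 M) y) \<le> ck * (I + 1) / t powr dim_index * exp (- (norm x - M)\<^sup>2 / (2 * t))"
      by (simp add: mult.commute mult.left_commute)
  qed
qed

lemma abs_integral_K0_le_cball:
  fixes f :: "real^'n \<Rightarrow> real"
  assumes t: "t > 0" and [measurable]: "f \<in> borel_measurable borel" and f: "\<And>y. \<bar>f y\<bar> \<le> B"
    and e: "\<And>y. norm y > M \<Longrightarrow> \<bar>f y\<bar> \<le> e" "e \<ge> 0"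
  shows "\<bar>LINT y|K0 t x. f y\<bar> \<le> e + B * (LINT y|K0 t x. indicat_real (cball 0 M) y)"
proof -
  interpret prob_space "K0 t x" by (rule prob_space_K0[OF t])
  have i: "integrable (K0 t x) (\<lambda>y. indicat_real (cball 0 M) y)"
    by (rule integrable_K0[OF t, of _ 1]) (auto simp: indicator_def)
  have B: "B \<ge> 0" using f[of 0] by linarith
  have "\<bar>LINT y|K0 t x. f y\<bar> \<le> (LINT y|K0 t x. \<bar>f y\<bar>)" by (rule integral_abs_bound)
  also have "\<dots> \<le> (LINT y|K0 t x. e + B * indicat_real (cball 0 M) y)"
  proof (rule integral_mono)
    show "integrable (K0 t x) (\<lambda>y. \<bar>f y\<bar>)" using integrable_K0[OF t assms(2) f] by simp
    show "integrable (K0 t x) (\<lambda>y. e + B * indicat_real (cball 0 M) y)" using i by simp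
    show "\<bar>f y\<bar> \<le> e + B * indicat_real (cball 0 M) y" for y
      using f[of y] e(1)[of y] e(2) B by (cases "norm y \<le> M") auto
  qed
  also have "\<dots> = e + B * (LINT y|K0 t x. indicat_real (cball 0 M) y)"
    using i prob_space by simp
  finally show ?thesis .
qed

text \<open>At infinity the function is split into a part that is small outside a ball and a bounded
  part inside, where distant starting points put little mass. Continuity comes from dominated
  convergence.\<close>

lemma K0_vanishing_continuous:
  assumes t: "t > 0" and f: "f \<in> vanishing_continuous"
  shows "(\<lambda>x. LINT y|K0 t x. f y) \<in> vanishing_continuous"
proof -
  have [measurable]: "f \<in> borel_measurable borel" using f by (rule vanishing_continuous_measurable)
  obtain B where B: "B > 0" "\<And>y. \<bar>f y\<bar> \<le> B" using vanishing_continuous_bounded[OF f] by blast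
  have "((\<lambda>x. LINT y|K0 t x. f y) \<longlongrightarrow> 0) at_infinity"
  proof (rule tendstoI)
    fix e :: real assume e: "e > 0"
    then obtain M where M: "M > 0" "\<And>y. norm y \<ge> M \<Longrightarrow> \<bar>f y\<bar> < e / 2"
      using vanishing_continuous_small[OF f, of "e / 2"] by auto
    obtain V where V: "V > 0" "\<And>t x. t > 0 \<Longrightarrow> norm x \<ge> M \<Longrightarrow>
        (LINT y|K0 t x. indicat_real (cball 0 M) y) \<le> V / t powr dim_index * exp (- (norm x - M)\<^sup>2 / (2 * t))"
      using integral_K0_cball_le by blast
    have "LIM x at_infinity. (norm (x::real^'n) - M)\<^sup>2 / (2 * t) :> at_top"
    proof -
      have "LIM x at_infinity. norm (x::real^'n) - M :> at_top"
        using filterlim_tendsto_add_at_top[OF tendsto_const[of "- M"] filterlim_norm_at_top] by simp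
      hence "LIM x at_infinity. (1 / (2 * t)) * (norm (x::real^'n) - M)\<^sup>2 :> at_top"
        using t by (intro filterlim_tendsto_pos_mult_at_top[OF tendsto_const] filterlim_pow_at_top) auto
      thus ?thesis by simp
    qed
    hence "((\<lambda>x::real^'n. exp (- ((norm x - M)\<^sup>2 / (2 * t)))) \<longlongrightarrow> 0) at_infinity"
      by (intro filterlim_compose[OF exp_at_bot] filterlim_compose[OF filterlim_uminus_at_bot_at_top])
    hence "((\<lambda>x::real^'n. B * (V / t powr dim_index * exp (- (norm x - M)\<^sup>2 / (2 * t)))) \<longlongrightarrow> 0) at_infinity"
      by (intro tendsto_mult_right_zero) simp
    hence "\<forall>\<^sub>F x in at_infinity. B * (V / t powr dim_index * exp (- (norm (x::real^'n) - M)\<^sup>2 / (2 * t))) < e / 2"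
      using e by (intro order_tendstoD(2)[of _ 0]) auto
    moreover have "\<forall>\<^sub>F x in at_infinity. norm (x::real^'n) \<ge> M" by (auto simp: eventually_at_infinity)
    ultimately show "\<forall>\<^sub>F x in at_infinity. dist (LINT y|K0 t x. f y) 0 < e"
    proof eventually_elim
      case (elim x)
      have "\<bar>LINT y|K0 t x. f y\<bar> \<le> e / 2 + B * (LINT y|K0 t x. indicat_real (cball 0 M) y)"
        using M e B by (intro abs_integral_K0_le_cball[OF t]) (auto intro: less_imp_le)
      also have "\<dots> \<le> e / 2 + B * (V / t powr dim_index * exp (- (norm x - M)\<^sup>2 / (2 * t)))"
        using B elim by (intro add_left_mono mult_left_mono V t) auto
      also have "\<dots> < e" using elim(1) by linarith
      finally show ?case by simp
    qed
  qed
  moreover have "continuous_on UNIV (\<lambda>x. LINT y|K0 t x. f y)"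
    using continuous_on_q_integral[OF t _ B(2)] by (simp add: integral_K0)
  ultimately show ?thesis by (simp add: vanishing_continuous_def)
qed

text \<open>With v = 1 / (2 t) and an integer n at least p, the expression is at most 2^n v^n / exp
  v for t < 1.\<close>

lemma powr_exp_inverse_tendsto_0: "((\<lambda>t. 1 / t powr p * exp (- 1 / (2 * t))) \<longlongrightarrow> 0) (at_right (0::real))"
proof -
  define n where "n = nat \<lceil>p\<rceil>"
  have poly_exp: "((\<lambda>v::real. 2 ^ n * (v ^ n / exp v)) \<longlongrightarrow> 0) at_top"
    by (intro tendsto_mult_right_zero tendsto_power_div_exp_0)
  have inv: "LIM t at_right (0::real). inverse t * (1 / 2) :> at_top"
    by (rule filterlim_at_top_mult_tendsto_pos[OF tendsto_const _ filterlim_inverse_at_top_right]) simp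
  have lim: "((\<lambda>t. 2 ^ n * ((inverse t * (1 / 2)) ^ n / exp (inverse t * (1 / 2)))) \<longlongrightarrow> 0) (at_right (0::real))"
    using filterlim_compose[OF poly_exp inv] .
  have "norm (1 / t powr p * exp (- 1 / (2 * t))) \<le> 2 ^ n * ((inverse t * (1 / 2)) ^ n / exp (inverse t * (1 / 2)))"
    if t: "0 < t" "t < 1" for t :: real
  proof -
    have pn: "p \<le> real n" unfolding n_def by (rule real_nat_ceiling_ge)
    have e: "exp (- 1 / (2 * t)) = inverse (exp (inverse t * (1 / 2)))"
      unfolding exp_minus[symmetric] using t by (simp add: field_simps)
    have "1 / t powr p = (1 / t) powr p" using t by (simp add: powr_divide)
    also have "\<dots> \<le> (1 / t) powr real n" using t pn by (intro powr_mono) auto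
    also have "\<dots> = (1 / t) ^ n" using t by (intro powr_realpow) auto
    also have "\<dots> = 2 ^ n * (inverse t * (1 / 2)) ^ n"
      unfolding power_mult_distrib[symmetric] by (simp add: inverse_eq_divide)
    finally have "1 / t powr p * exp (- 1 / (2 * t)) \<le> 2 ^ n * (inverse t * (1 / 2)) ^ n * exp (- 1 / (2 * t))"
      by (intro mult_right_mono) auto
    also have "\<dots> = 2 ^ n * ((inverse t * (1 / 2)) ^ n / exp (inverse t * (1 / 2)))"
      unfolding e by (simp only: divide_inverse[of "_ ^ _"] mult.assoc)
    finally show ?thesis unfolding real_norm_def by (subst abs_of_nonneg) auto
  qed
  hence "\<forall>\<^sub>F t in at_right 0. norm (1 / t powr p * exp (- 1 / (2 * t)))
      \<le> 2 ^ n * ((inverse t * (1 / 2)) ^ n / exp (inverse t * (1 / 2)))"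
    unfolding eventually_at_right_field by (intro exI[of _ 1]) simp
  from Lim_null_comparison[OF this lim] show ?thesis .
qed

text \<open>A compactly supported approximation of \<open>f\<close> reduces the claim to \<open>K\<close> inside a ball, where
  \<open>E x lam\<close> is bounded, and to the Gaussian bound outside of it.\<close>

lemma K0_strongly_continuous:
  assumes f: "f \<in> vanishing_continuous"
  shows "uniform_limit UNIV (\<lambda>t x. LINT y|K0 t x. f y) f (at_right 0)"
proof (rule uniform_limitI)
  fix e :: real assume e: "e > 0"
  \<comment> \<open>Three errors of size at most \<open>d\<close> add up: f against g under the
    kernel, the kernel acting on g, and f against g at \<open>x\<close>. The fourth share makes the
    inequality strict.\<close>
  define d where "d = e / 4"
  have d: "d > 0" using e by (simp add: d_def)
  have [measurable]: "f \<in> borel_measurable borel" using f by (rule vanishing_continuous_measurable)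
  obtain B where B: "B > 0" "\<And>y. \<bar>f y\<bar> \<le> B" using vanishing_continuous_bounded[OF f] by blast
  obtain M where M: "M > 0" "\<And>y. norm y \<ge> M \<Longrightarrow> \<bar>f y\<bar> < d" using vanishing_continuous_small[OF f d] by auto
  \<comment> \<open>Soft thresholding: \<open>g\<close> stays continuous, is within \<open>d\<close>
    of \<open>f\<close>, and vanishes outside the ball of radius \<open>M\<close>.\<close>
  define g where "g y = f y - max (- d) (min d (f y))" for y
  have [measurable]: "g \<in> borel_measurable borel" unfolding g_def[abs_def] by measurable
  have fg: "\<bar>f y - g y\<bar> \<le> d" for y using clamp_to_symmetric_interval(1)[OF d] by (simp add: g_def)
  have g0: "g y = 0" if "norm y \<ge> M" for y
    using clamp_to_symmetric_interval(2)[OF d, of "f y"] M(2)[OF that] by (simp add: g_def)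
  have gB: "\<bar>g y\<bar> \<le> B + d" for y using fg[of y] B(2)[of y] by linarith
  \<comment> \<open>The transfer to \<open>K\<close> replaces \<open>g\<close> by this quotient.
    Because \<open>g\<close> vanishes far out, \<open>h\<close> is in
    \<open>vanishing_continuous\<close> even though 1 / E may grow, so the Feller property of
    \<open>K\<close> applies to it.\<close>
  define h where "h y = g y / E y lam" for y
  have h: "h \<in> vanishing_continuous"
  proof -
    have "continuous_on UNIV h"
      unfolding h_def g_def using f E_pos[of _ lam]
      by (intro continuous_intros) (auto simp: vanishing_continuous_def less_imp_neq[symmetric])
    moreover have "(h \<longlongrightarrow> 0) at_infinity"
    proof (rule tendsto_eventually)
      show "\<forall>\<^sub>F y in at_infinity. h y = 0"
        unfolding eventually_at_infinity h_def by (intro exI[of _ M]) (simp add: g0)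
    qed
    ultimately show ?thesis by (simp add: vanishing_continuous_def)
  qed
  obtain H where H: "H > 0" "\<And>y. \<bar>h y\<bar> \<le> H" using vanishing_continuous_bounded[OF h] by blast
  let ?c = "\<lambda>t. exp ((norm lam)\<^sup>2 * t / 2)"
  \<comment> \<open>Bounds the factor \<open>E x lam\<close> on the ball of radius M + 1. The extra
    1 leaves a gap to the support of \<open>g\<close>, so starts outside that ball contribute at
    most a multiple of exp(-1 / (2 t)) \<open>t powr (- dim_index)\<close>.\<close>
  define A where "A = exp ((M + 1) * norm lam)"
  have A: "A > 0" by (simp add: A_def)
  have K0_g: "(LINT y|K0 t x. g y) = ?c t * E x lam * (LINT y|K t x. h y)" for t x
    unfolding h_def by (rule integral_K0_eq_K) measurable
  have "uniform_limit UNIV (\<lambda>t x. ?c t * (LINT y|K t x. h y)) (\<lambda>x. 1 * h x) (at_right 0)"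
  proof (rule uniform_lim_mult)
    show "uniform_limit UNIV (\<lambda>t x. ?c t) (\<lambda>x::real^'n. 1) (at_right 0)"
    proof (rule uniform_limitI)
      fix e :: real assume e: "e > 0"
      have "(?c \<longlongrightarrow> ?c 0) (at_right 0)" by (intro tendsto_intros) simp
      hence "\<forall>\<^sub>F t in at_right 0. dist (?c t) (?c 0) < e" using e by (rule tendstoD)
      thus "\<forall>\<^sub>F t in at_right 0. \<forall>x\<in>UNIV. dist (?c t) 1 < e" by simp
    qed
    show "uniform_limit UNIV (\<lambda>t x. LINT y|K t x. h y) h (at_right 0)"
      using feller h by (simp add: feller_semigroup_def)
  qed (use H in \<open>auto simp: bounded_iff\<close>)
  hence "\<forall>\<^sub>F t in at_right 0. \<forall>x\<in>UNIV. dist (?c t * (LINT y|K t x. h y)) (1 * h x) < d / A"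
    by (rule uniform_limitD) (use d A in simp)
  moreover obtain V where V: "V > 0" "\<And>t x. t > 0 \<Longrightarrow> norm x \<ge> M \<Longrightarrow>
      (LINT y|K0 t x. indicat_real (cball 0 M) y) \<le> V / t powr dim_index * exp (- (norm x - M)\<^sup>2 / (2 * t))"
    using integral_K0_cball_le by blast
  have "((\<lambda>t. (B + d) * V * (1 / t powr dim_index * exp (- 1 / (2 * t)))) \<longlongrightarrow> 0) (at_right 0)"
    by (intro tendsto_mult_right_zero powr_exp_inverse_tendsto_0)
  hence "\<forall>\<^sub>F t in at_right 0. (B + d) * V * (1 / t powr dim_index * exp (- 1 / (2 * t))) < d"
    by (rule order_tendstoD(2)) (rule d)
  moreover have "\<forall>\<^sub>F t in at_right (0::real). t > 0" by (simp add: eventually_at_filter)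
  ultimately show "\<forall>\<^sub>F t in at_right 0. \<forall>x\<in>UNIV. dist (LINT y|K0 t x. f y) (f x) < e"
  proof eventually_elim
    case (elim t)
    have t: "t > 0" by (rule elim(3))
    show ?case
    proof
      fix x :: "real^'n"
      have "\<bar>LINT y|K0 t x. f y - g y\<bar> \<le> d"
        by (rule abs_integral_K0_le[OF t _ fg]) measurable
      moreover have "(LINT y|K0 t x. f y - g y) = (LINT y|K0 t x. f y) - (LINT y|K0 t x. g y)"
        by (rule Bochner_Integration.integral_diff; rule integrable_K0[OF t]) (auto intro: B gB)
      moreover have "\<bar>(LINT y|K0 t x. g y) - g x\<bar> \<le> d"
      proof (cases "norm x \<le> M + 1")
        case True
        have "E x lam \<le> A"
          unfolding A_def using True
          by (intro order.trans[OF E_le]) (simp add: mult_right_mono)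
        have "\<bar>(LINT y|K0 t x. g y) - g x\<bar> = E x lam * \<bar>?c t * (LINT y|K t x. h y) - h x\<bar>"
        proof -
          have "g x = E x lam * h x" using E_pos[of x lam] by (simp add: h_def)
          hence "(LINT y|K0 t x. g y) - g x = E x lam * (?c t * (LINT y|K t x. h y) - h x)"
            unfolding K0_g by (simp add: algebra_simps)
          thus ?thesis using E_pos[of x lam] by (simp add: abs_mult)
        qed
        also have "\<dots> \<le> A * (d / A)"
          using \<open>E x lam \<le> A\<close> elim(1) A by (intro mult_mono) (auto simp: dist_real_def intro: less_imp_le)
        finally show ?thesis using A by simp
      next
        case False
        have "\<bar>LINT y|K0 t x. g y\<bar> \<le> 0 + (B + d) * (LINT y|K0 t x. indicat_real (cball 0 M) y)"
          using g0 by (intro abs_integral_K0_le_cball[OF t _ gB]) auto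
        also have "\<dots> \<le> 0 + (B + d) * (V / t powr dim_index * exp (- (norm x - M)\<^sup>2 / (2 * t)))"
          using False B(1) d by (intro add_left_mono mult_left_mono V t) auto
        also have "\<dots> \<le> 0 + (B + d) * (V / t powr dim_index * exp (- 1 / (2 * t)))"
        proof -
          have "1\<^sup>2 \<le> (norm x - M)\<^sup>2" using False by (intro power_mono) auto
          hence "exp (- (norm x - M)\<^sup>2 / (2 * t)) \<le> exp (- 1 / (2 * t))"
            using t by (simp add: divide_right_mono)
          thus ?thesis using B(1) d V(1) by (intro add_left_mono mult_left_mono) auto
        qed
        finally show ?thesis using elim(2) False g0[of x] by simp
      qed
      moreover have "\<bar>f x - g x\<bar> \<le> d" by (rule fg)
      ultimately have "\<bar>(LINT y|K0 t x. f y) - f x\<bar> \<le> 3 * d" by linarith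
      thus "dist (LINT y|K0 t x. f y) (f x) < e" using e by (simp add: dist_real_def d_def)
    qed
  qed
qed

theorem feller_semigroup_K0: "feller_semigroup K0"
  unfolding feller_semigroup_def
  using K0_measurable K0_semigroup K0_vanishing_continuous K0_strongly_continuous by blast

end

section \<open>Change of measure\<close>

text \<open>The two densities define the same measure on the smaller sigma-algebra, so they
  integrate every function measurable there alike, bounded or not.\<close>

lemma nn_integral_eq_on_subalgebra:
  fixes G H h :: "'a \<Rightarrow> ennreal"
  assumes sub: "subalgebra M F"
    and G [measurable]: "G \<in> borel_measurable M" and H [measurable]: "H \<in> borel_measurable M"
    and h: "h \<in> borel_measurable F"
    and eq: "\<And>B. B \<in> sets F \<Longrightarrow> (\<integral>\<^sup>+\<omega>. indicator B \<omega> * G \<omega> \<partial>M) = (\<integral>\<^sup>+\<omega>. indicator B \<omega> * H \<omega> \<partial>M)"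
  shows "(\<integral>\<^sup>+\<omega>. h \<omega> * G \<omega> \<partial>M) = (\<integral>\<^sup>+\<omega>. h \<omega> * H \<omega> \<partial>M)"
proof -
  have hM [measurable]: "h \<in> borel_measurable M" by (rule measurable_from_subalg[OF sub h])
  have sub': "subalgebra (density M g) F" for g using sub by (simp add: subalgebra_def)
  have *: "restr_to_subalg (density M G) F = restr_to_subalg (density M H) F"
  proof (rule measure_eqI)
    fix B assume "B \<in> sets (restr_to_subalg (density M G) F)"
    hence B: "B \<in> sets F" by (simp add: sets_restr_to_subalg[OF sub'])
    hence BM: "B \<in> sets M" using sub by (auto simp: subalgebra_def)
    show "emeasure (restr_to_subalg (density M G) F) B = emeasure (restr_to_subalg (density M H) F) B"
      using eq[OF B] BM by (simp add: emeasure_restr_to_subalg[OF sub' B] emeasure_density mult.commute)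
  qed (simp add: sets_restr_to_subalg[OF sub'])
  have "(\<integral>\<^sup>+\<omega>. h \<omega> * G \<omega> \<partial>M) = (\<integral>\<^sup>+\<omega>. h \<omega> \<partial>restr_to_subalg (density M G) F)"
    by (simp add: nn_integral_subalgebra2[OF sub' h] nn_integral_density mult.commute)
  also have "\<dots> = (\<integral>\<^sup>+\<omega>. h \<omega> * H \<omega> \<partial>M)"
    unfolding * by (simp add: nn_integral_subalgebra2[OF sub' h] nn_integral_density mult.commute)
  finally show ?thesis .
qed

text \<open>Only times up to \<open>s\<close> and the underlying space enter, so neither truncation
  at \<open>T\<close> nor the change of measure alters the filtration.\<close>

lemma natural_filtration_cong:
  assumes "space M = space M'" "\<And>u. u \<le> s \<Longrightarrow> u \<in> I \<longleftrightarrow> u \<in> J"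
  shows "natural_filtration M I X s = natural_filtration M' J X s"
proof -
  have "{X u -` B \<inter> space M | u B. u \<in> I \<and> u \<le> s \<and> B \<in> sets borel}
      = {X u -` B \<inter> space M' | u B. u \<in> J \<and> u \<le> s \<and> B \<in> sets borel}"
    using assms by blast
  thus ?thesis using assms(1) by (simp add: natural_filtration_def)
qed

lemma rcll_on_subset:
  assumes "rcll_on I p" "J \<subseteq> I"
  shows "rcll_on J p"
  unfolding rcll_on_def
proof (intro ballI conjI)
  fix t assume "t \<in> J"
  hence t: "t \<in> I" using assms by blast
  have "continuous (at t within I \<inter> {t..}) p" using assms(1) t by (simp add: rcll_on_def)
  thus "continuous (at t within J \<inter> {t..}) p"
    by (rule continuous_within_subset) (use assms(2) in blast)
  obtain l where "(p \<longlongrightarrow> l) (at t within I \<inter> {..<t})" using assms(1) t by (auto simp: rcll_on_def)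
  hence "(p \<longlongrightarrow> l) (at t within J \<inter> {..<t})"
    by (rule tendsto_within_subset) (use assms(2) in blast)
  thus "\<exists>l. (p \<longlongrightarrow> l) (at t within J \<inter> {..<t})" by blast
qed

locale dunkl_drift_process = dunkl_drift R Rp k lam + prob_space P
  for R Rp :: "(real^'n) set" and k lam and P :: "'a measure" +
  fixes X :: "real \<Rightarrow> 'a \<Rightarrow> real^'n"
  assumes process: "dunkl_process P {0..} Rp k lam 0 X"
begin

lemma X_measurable [measurable]: "0 \<le> t \<Longrightarrow> X t \<in> borel_measurable P"
  using process by (simp add: dunkl_process_def feller_process_def)

lemma X_0: "AE \<omega> in P. X 0 \<omega> = 0"
  using process by (simp add: dunkl_process_def feller_process_def)

lemma X_rcll: "\<omega> \<in> space P \<Longrightarrow> rcll_on {0..} (\<lambda>t. X t \<omega>)"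
  using process by (simp add: dunkl_process_def feller_process_def)

section \<open>The Markov property as an identity between nonnegative integrals\<close>

abbreviation F :: "real \<Rightarrow> 'a measure" where "F \<equiv> natural_filtration P {0..} X"

lemma space_F [simp]: "space (F s) = space P"
  by (simp add: natural_filtration_def space_measure_of_conv)

lemma sets_F: "sets (F s) = sigma_sets (space P) {X u -` B \<inter> space P | u B. u \<in> {0..} \<and> u \<le> s \<and> B \<in> sets borel}"
  unfolding natural_filtration_def by (rule sets_measure_of) blast

lemma subalgebra_F: "subalgebra P (F s)"
  unfolding subalgebra_def
proof
  show "sets (F s) \<subseteq> sets P"
    unfolding sets_F
  proof (rule sets.sigma_sets_subset, rule subsetI)
    fix C assume "C \<in> {X u -` B \<inter> space P | u B. u \<in> {0..} \<and> u \<le> s \<and> B \<in> sets borel}"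
    then obtain u B where "0 \<le> u" "B \<in> sets borel" "C = X u -` B \<inter> space P" by auto
    thus "C \<in> sets P" using measurable_sets[OF X_measurable] by simp
  qed
qed simp

lemma F_mono: "s \<le> t \<Longrightarrow> sets (F s) \<subseteq> sets (F t)"
  unfolding sets_F by (rule sigma_sets_mono') force

lemma X_measurable_F: "0 \<le> u \<Longrightarrow> u \<le> s \<Longrightarrow> X u \<in> F s \<rightarrow>\<^sub>M borel"
  by (rule measurableI) (auto simp: sets_F intro!: sigma_sets.Basic)

text \<open>The conditional expectation is tested on one set of the past. All functions involved are
  bounded, so the identity can be rewritten with nonnegative integrals, in which the unbounded
  weights used later are admissible.\<close>

lemma markov_set:
  assumes s: "0 \<le> s" and t: "s < t" and B: "B \<in> sets (F s)" and A [measurable]: "A \<in> sets borel"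
  shows "(\<integral>\<^sup>+\<omega>. indicator B \<omega> * indicator A (X t \<omega>) \<partial>P)
    = (\<integral>\<^sup>+\<omega>. indicator B \<omega> * emeasure (K (t - s) (X s \<omega>)) A \<partial>P)"
proof -
  interpret sub: finite_measure_subalgebra P "F s"
    by unfold_locales (rule subalgebra_F)
  have BP [measurable]: "B \<in> sets P" using B subalgebra_F by (auto simp: subalgebra_def)
  have [measurable]: "X s \<in> borel_measurable P" "X t \<in> borel_measurable P" using s t by auto
  define C where "C = X t -` A \<inter> space P"
  have C [measurable]: "C \<in> sets P" unfolding C_def by measurable
  define m where "m \<omega> = measure (K (t - s) (X s \<omega>)) A" for \<omega>
  have pK: "prob_space (K (t - s) x)" for x using t by (intro prob_space_K) simp
  have "(\<lambda>x. emeasure (K (t - s) x) A) \<in> borel_measurable borel"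
    by (rule measurable_compose[OF K_measurable_subprob measurable_emeasure_subprob_algebra[OF A]]) (use t in simp)
  hence "(\<lambda>x. measure (K (t - s) x) A) \<in> borel_measurable borel"
    unfolding measure_def by measurable
  hence m [measurable]: "m \<in> borel_measurable P" unfolding m_def by measurable
  have m01: "0 \<le> m \<omega>" "m \<omega> \<le> 1" for \<omega> using prob_space.prob_le_1[OF pK] by (auto simp: m_def)
  have em: "emeasure (K (t - s) (X s \<omega>)) A = ennreal (m \<omega>)" for \<omega>
    using finite_measure.emeasure_eq_measure[OF prob_space.finite_measure[OF pK]] by (simp add: m_def)
  have int: "integrable P (\<lambda>\<omega>. indicator B \<omega> * indicat_real C \<omega>)" "integrable P (\<lambda>\<omega>. indicator B \<omega> * m \<omega>)"
    by (rule integrable_const_bound[where B = 1]; use m01 in \<open>auto simp: indicator_def\<close>)+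
  have "AE \<omega> in P. real_cond_exp P (F s) (indicator C) \<omega> = m \<omega>"
    using process s t A unfolding C_def m_def dunkl_process_def feller_process_def by simp
  hence "(\<integral>\<omega>\<in>B. real_cond_exp P (F s) (indicator C) \<omega> \<partial>P) = (\<integral>\<omega>\<in>B. m \<omega> \<partial>P)"
    unfolding set_lebesgue_integral_def by (intro integral_cong_AE) auto
  moreover have "(\<integral>\<omega>\<in>B. indicator C \<omega> \<partial>P) = (\<integral>\<omega>\<in>B. real_cond_exp P (F s) (indicator C) \<omega> \<partial>P)"
    by (rule sub.real_cond_exp_intA[OF _ B]) (simp add: less_top[symmetric])
  ultimately have "(LINT \<omega>|P. indicator B \<omega> * indicat_real C \<omega>) = (LINT \<omega>|P. indicator B \<omega> * m \<omega>)"
    by (simp add: set_lebesgue_integral_def)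
  hence "(\<integral>\<^sup>+\<omega>. ennreal (indicator B \<omega> * indicat_real C \<omega>) \<partial>P) = (\<integral>\<^sup>+\<omega>. ennreal (indicator B \<omega> * m \<omega>) \<partial>P)"
    using int m01 by (simp add: nn_integral_eq_integral)
  moreover have "(\<integral>\<^sup>+\<omega>. ennreal (indicator B \<omega> * indicat_real C \<omega>) \<partial>P) = (\<integral>\<^sup>+\<omega>. indicator B \<omega> * indicator A (X t \<omega>) \<partial>P)"
    by (intro nn_integral_cong) (auto simp: indicator_def C_def)
  moreover have "(\<integral>\<^sup>+\<omega>. ennreal (indicator B \<omega> * m \<omega>) \<partial>P) = (\<integral>\<^sup>+\<omega>. indicator B \<omega> * emeasure (K (t - s) (X s \<omega>)) A \<partial>P)"
    by (intro nn_integral_cong) (auto simp: indicator_def em)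
  ultimately show ?thesis by simp
qed

text \<open>For fixed \<open>B\<close>, the law of \<open>X t\<close> under \<open>P\<close>
  restricted to \<open>B\<close> and the corresponding mixture of kernels are measures that agree on
  Borel sets by \<open>markov_set\<close>; hence they integrate every nonnegative \<open>g\<close>
  equally.\<close>

lemma markov:
  assumes s: "0 \<le> s" and t: "s < t" and B: "B \<in> sets (F s)" and g [measurable]: "g \<in> borel_measurable borel"
  shows "(\<integral>\<^sup>+\<omega>. indicator B \<omega> * g (X t \<omega>) \<partial>P)
    = (\<integral>\<^sup>+\<omega>. indicator B \<omega> * (\<integral>\<^sup>+y. g y \<partial>K (t - s) (X s \<omega>)) \<partial>P)"
proof -
  have BP [measurable]: "B \<in> sets P" using B subalgebra_F by (auto simp: subalgebra_def)
  have Xm [measurable]: "X s \<in> borel_measurable P" "X t \<in> borel_measurable P" using s t by auto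
  define D where "D = density P (indicator B)"
  have XD [measurable]: "X s \<in> borel_measurable D" "X t \<in> borel_measurable D" by (auto simp: D_def)
  have N: "(\<lambda>\<omega>. K (t - s) (X s \<omega>)) \<in> D \<rightarrow>\<^sub>M subprob_algebra borel"
    using measurable_compose[OF XD(1) K_measurable_subprob] t by simp
  have spD: "space D \<noteq> {}" by (simp add: D_def not_empty)
  have "distr D borel (X t) = D \<bind> (\<lambda>\<omega>. K (t - s) (X s \<omega>))"
  proof (rule measure_eqI)
    show "sets (distr D borel (X t)) = sets (D \<bind> (\<lambda>\<omega>. K (t - s) (X s \<omega>)))"
      using sets_bind[OF sets_kernel[OF N] spD] by simp
    fix A assume "A \<in> sets (distr D borel (X t))"
    hence A [measurable]: "A \<in> sets borel" by simp
    have "emeasure (distr D borel (X t)) A = (\<integral>\<^sup>+\<omega>. indicator A (X t \<omega>) \<partial>D)"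
      by (subst nn_integral_indicator[symmetric], simp, subst nn_integral_distr) auto
    also have "\<dots> = (\<integral>\<^sup>+\<omega>. indicator B \<omega> * indicator A (X t \<omega>) \<partial>P)"
      unfolding D_def by (rule nn_integral_density) measurable
    also have "\<dots> = (\<integral>\<^sup>+\<omega>. indicator B \<omega> * emeasure (K (t - s) (X s \<omega>)) A \<partial>P)"
      by (rule markov_set[OF s t B A])
    also have "\<dots> = (\<integral>\<^sup>+\<omega>. emeasure (K (t - s) (X s \<omega>)) A \<partial>D)"
      unfolding D_def
    proof (rule nn_integral_density[symmetric])
      show "(\<lambda>\<omega>. emeasure (K (t - s) (X s \<omega>)) A) \<in> borel_measurable P"
        using measurable_compose[OF N measurable_emeasure_subprob_algebra[OF A]] by (simp add: D_def)
    qed measurable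
    also have "\<dots> = emeasure (D \<bind> (\<lambda>\<omega>. K (t - s) (X s \<omega>))) A"
      by (rule emeasure_bind[symmetric, OF spD N A])
    finally show "emeasure (distr D borel (X t)) A = emeasure (D \<bind> (\<lambda>\<omega>. K (t - s) (X s \<omega>))) A" .
  qed
  hence "(\<integral>\<^sup>+y. g y \<partial>distr D borel (X t)) = (\<integral>\<^sup>+y. g y \<partial>(D \<bind> (\<lambda>\<omega>. K (t - s) (X s \<omega>))))"
    by (rule arg_cong)
  hence "(\<integral>\<^sup>+\<omega>. g (X t \<omega>) \<partial>D) = (\<integral>\<^sup>+\<omega>. \<integral>\<^sup>+y. g y \<partial>K (t - s) (X s \<omega>) \<partial>D)"
    by (simp add: nn_integral_distr nn_integral_bind[OF g N])
  thus ?thesis unfolding D_def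
    using measurable_compose[OF Xm(1) nn_integral_K_measurable[OF g]]
    by (simp add: nn_integral_density)
qed

section \<open>The density process and the tilted measure\<close>

definition \<rho> :: "real \<Rightarrow> 'a \<Rightarrow> ennreal" where
  "\<rho> t \<omega> = ennreal (exp ((norm lam)\<^sup>2 * t / 2) / E (X t \<omega>) lam)"

lemma \<rho>_measurable [measurable]: "0 \<le> t \<Longrightarrow> \<rho> t \<in> borel_measurable P"
  unfolding \<rho>_def[abs_def] by measurable

text \<open>Weighting by the time-t density removes \<open>E y lam\<close> from the kernel with
  drift and leaves the time-s density at \<open>x\<close>. Taking \<open>A = UNIV\<close> yields the
  martingale property, general \<open>A\<close> the driftless Markov property.\<close>

lemma nn_integral_K_quotient:
  assumes [measurable]: "A \<in> sets borel"
  shows "(\<integral>\<^sup>+y. indicator A y * ennreal (exp ((norm lam)\<^sup>2 * t / 2) / E y lam) \<partial>K (t - s) x)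
    = ennreal (exp ((norm lam)\<^sup>2 * s / 2) / E x lam) * emeasure (K0 (t - s) x) A"
proof -
  have *: "exp (- (norm lam)\<^sup>2 * (t - s) / 2) * exp ((norm lam)\<^sup>2 * t / 2) = exp ((norm lam)\<^sup>2 * s / 2)"
    unfolding exp_add[symmetric] by (simp add: field_simps)
  have integrand: "ennreal (exp (- (norm lam)\<^sup>2 * (t - s) / 2) * E y lam / E x lam)
      * (indicator A y * ennreal (exp ((norm lam)\<^sup>2 * t / 2) / E y lam))
      = ennreal (exp ((norm lam)\<^sup>2 * s / 2) / E x lam) * indicator A y" for y
  proof -
    have "exp (- (norm lam)\<^sup>2 * (t - s) / 2) * E y lam / E x lam * (exp ((norm lam)\<^sup>2 * t / 2) / E y lam)
        = exp ((norm lam)\<^sup>2 * s / 2) / E x lam"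
      unfolding *[symmetric] using E_pos[of y lam] by simp
    thus ?thesis
      using E_pos[of y lam] E_pos[of x lam]
      by (auto simp: ennreal_mult[symmetric] indicator_def)
  qed
  have m: "(\<lambda>y. indicator A y * ennreal (exp ((norm lam)\<^sup>2 * t / 2) / E y lam)) \<in> borel_measurable borel"
    by measurable
  show ?thesis
    unfolding nn_integral_K[OF m] integrand by (simp add: nn_integral_cmult)
qed

text \<open>This is where the mass one of the driftless kernels enters: the density at time
  \<open>T\<close>, integrated against \<open>K (T - t) x\<close>, returns the density at time
  \<open>t\<close> times that mass.\<close>

lemma \<rho>_martingale:
  assumes t: "0 \<le> t" "t \<le> T" and B: "B \<in> sets (F t)"
  shows "(\<integral>\<^sup>+\<omega>. indicator B \<omega> * \<rho> T \<omega> \<partial>P) = (\<integral>\<^sup>+\<omega>. indicator B \<omega> * \<rho> t \<omega> \<partial>P)"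
proof (cases "t = T")
  case False
  hence tT: "t < T" using t by simp
  have "(\<integral>\<^sup>+y. ennreal (exp ((norm lam)\<^sup>2 * T / 2) / E y lam) \<partial>K (T - t) x)
      = ennreal (exp ((norm lam)\<^sup>2 * t / 2) / E x lam)" for x
    using nn_integral_K_quotient[of UNIV T t x] prob_space.emeasure_space_1[OF prob_space_K0[of "T - t" x]] tT by simp
  thus ?thesis
    using markov[OF t(1) tT B, of "\<lambda>y. ennreal (exp ((norm lam)\<^sup>2 * T / 2) / E y lam)"]
    by (simp add: \<rho>_def)
qed simp

text \<open>The martingale property moves the total mass to time 0, where the density is 1 almost
  surely because the process starts at 0 and \<open>E 0 lam = 1\<close>.\<close>

lemma prob_space_tilted:
  assumes T: "T \<ge> 0"
  shows "prob_space (density P (\<rho> T))"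
proof (rule prob_spaceI)
  have "space P \<in> sets (F 0)" using sets.top[of "F 0"] by simp
  hence "(\<integral>\<^sup>+\<omega>. indicator (space P) \<omega> * \<rho> T \<omega> \<partial>P) = (\<integral>\<^sup>+\<omega>. indicator (space P) \<omega> * \<rho> 0 \<omega> \<partial>P)"
    by (rule \<rho>_martingale[OF order.refl T])
  also have "\<dots> = (\<integral>\<^sup>+\<omega>. 1 \<partial>P)"
    by (rule nn_integral_cong_AE) (use X_0 AE_space in eventually_elim, simp add: \<rho>_def E_zero_left)
  finally show "emeasure (density P (\<rho> T)) (space (density P (\<rho> T))) = 1"
    using T by (simp add: emeasure_density emeasure_space_1 mult.commute)
qed

text \<open>A Bayes computation: on an event known at time \<open>t\<close> the density is lowered
  from \<open>T\<close> to \<open>t\<close>, the Markov step turns it into the density at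
  \<open>s\<close> times a driftless probability, and the density is raised back to
  \<open>T\<close>.\<close>

lemma tilted_markov:
  assumes s: "0 \<le> s" and t: "s < t" "t \<le> T" and A [measurable]: "A \<in> sets borel"
  shows "AE \<omega> in density P (\<rho> T). real_cond_exp (density P (\<rho> T)) (F s) (indicator (X t -` A \<inter> space P)) \<omega>
    = measure (K0 (t - s) (X s \<omega>)) A"
proof -
  have T: "T \<ge> 0" using s t by simp
  let ?Q = "density P (\<rho> T)"
  interpret Q: prob_space ?Q by (rule prob_space_tilted[OF T])
  interpret Qs: finite_measure_subalgebra ?Q "F s"
    using subalgebra_F by unfold_locales (simp add: subalgebra_def)
  define C where "C = X t -` A \<inter> space P"
  define m where "m \<omega> = measure (K0 (t - s) (X s \<omega>)) A" for \<omega>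
  have pK: "prob_space (K0 (t - s) x)" for x using t by (intro prob_space_K0) simp
  have CF: "C \<in> sets (F t)"
    unfolding C_def using measurable_sets[OF X_measurable_F[of t t] A] s t by simp
  hence C [measurable]: "C \<in> sets P" using subalgebra_F by (auto simp: subalgebra_def)
  have "(\<lambda>x. emeasure (K0 (t - s) x) A) \<in> borel_measurable borel"
    by (rule measurable_compose[OF K0_measurable_subprob measurable_emeasure_subprob_algebra[OF A]]) (use t in simp)
  hence "(\<lambda>x. measure (K0 (t - s) x) A) \<in> borel_measurable borel"
    unfolding measure_def by measurable
  hence mF: "m \<in> borel_measurable (F s)"
    unfolding m_def by (rule measurable_compose[OF X_measurable_F[OF s order.refl]])
  hence m [measurable]: "m \<in> borel_measurable P" by (rule measurable_from_subalg[OF subalgebra_F])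
  have m01: "0 \<le> m \<omega>" "m \<omega> \<le> 1" for \<omega> using prob_space.prob_le_1[OF pK] by (auto simp: m_def)
  have em: "emeasure (K0 (t - s) (X s \<omega>)) A = ennreal (m \<omega>)" for \<omega>
    using finite_measure.emeasure_eq_measure[OF prob_space.finite_measure[OF pK]] by (simp add: m_def)
  have "AE \<omega> in ?Q. real_cond_exp ?Q (F s) (indicator C) \<omega> = m \<omega>"
  proof (rule Qs.real_cond_exp_charact)
    show "integrable ?Q (indicat_real C)" by (rule Q.integrable_const_bound[where B = 1]) (auto simp: indicator_def)
    show "integrable ?Q m" by (rule Q.integrable_const_bound[where B = 1]) (use m01 in auto)
    show "m \<in> borel_measurable (F s)" by (rule mF)
    fix B assume B: "B \<in> sets (F s)"
    hence BP [measurable]: "B \<in> sets P" using subalgebra_F by (auto simp: subalgebra_def)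
    have BF: "B \<inter> C \<in> sets (F t)" using B CF F_mono[of s t] t by auto
    have "(\<integral>\<^sup>+\<omega>. ennreal (indicator B \<omega> * indicator C \<omega>) \<partial>?Q) = (\<integral>\<^sup>+\<omega>. \<rho> T \<omega> * ennreal (indicator B \<omega> * indicator C \<omega>) \<partial>P)"
      using T by (intro nn_integral_density) measurable
    also have "\<dots> = (\<integral>\<^sup>+\<omega>. indicator (B \<inter> C) \<omega> * \<rho> T \<omega> \<partial>P)"
      by (intro nn_integral_cong) (auto simp: indicator_def)
    \<comment> \<open>Both events belong to the past of \<open>t\<close>, so the martingale property
      applies to their intersection.\<close>
    also have "\<dots> = (\<integral>\<^sup>+\<omega>. indicator (B \<inter> C) \<omega> * \<rho> t \<omega> \<partial>P)"
      by (rule \<rho>_martingale) (use s t BF in auto)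
    also have "\<dots> = (\<integral>\<^sup>+\<omega>. indicator B \<omega> * (indicator A (X t \<omega>) * ennreal (exp ((norm lam)\<^sup>2 * t / 2) / E (X t \<omega>) lam)) \<partial>P)"
      by (intro nn_integral_cong) (auto simp: indicator_def \<rho>_def C_def)
    also have "\<dots> = (\<integral>\<^sup>+\<omega>. indicator B \<omega> * (ennreal (exp ((norm lam)\<^sup>2 * s / 2) / E (X s \<omega>) lam) * emeasure (K0 (t - s) (X s \<omega>)) A) \<partial>P)"
      using markov[OF s t(1) B, of "\<lambda>y. indicator A y * ennreal (exp ((norm lam)\<^sup>2 * t / 2) / E y lam)"]
      by (simp add: nn_integral_K_quotient)
    also have "\<dots> = (\<integral>\<^sup>+\<omega>. (indicator B \<omega> * ennreal (m \<omega>)) * \<rho> s \<omega> \<partial>P)"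
      by (simp add: em \<rho>_def ac_simps)
    \<comment> \<open>The integrand now carries the factor \<open>m\<close>, which is measurable at
      time \<open>s\<close> but not an indicator, so the martingale property on sets is extended to
      functions.\<close>
    also have "(\<integral>\<^sup>+\<omega>. (indicator B \<omega> * ennreal (m \<omega>)) * \<rho> s \<omega> \<partial>P)
        = (\<integral>\<^sup>+\<omega>. (indicator B \<omega> * ennreal (m \<omega>)) * \<rho> T \<omega> \<partial>P)"
    proof (rule nn_integral_eq_on_subalgebra[OF subalgebra_F, symmetric])
      show "(\<lambda>\<omega>. indicator B \<omega> * ennreal (m \<omega>)) \<in> borel_measurable (F s)"
        using B mF by measurable
      show "\<rho> T \<in> borel_measurable P" "\<rho> s \<in> borel_measurable P" using s T by auto
      show "(\<integral>\<^sup>+\<omega>. indicator B' \<omega> * \<rho> T \<omega> \<partial>P) = (\<integral>\<^sup>+\<omega>. indicator B' \<omega> * \<rho> s \<omega> \<partial>P)"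
        if "B' \<in> sets (F s)" for B'
        by (rule \<rho>_martingale) (use s t that in auto)
    qed
    also have "\<dots> = (\<integral>\<^sup>+\<omega>. \<rho> T \<omega> * ennreal (indicator B \<omega> * m \<omega>) \<partial>P)"
      by (intro nn_integral_cong) (auto simp: indicator_def mult.commute)
    also have "\<dots> = (\<integral>\<^sup>+\<omega>. ennreal (indicator B \<omega> * m \<omega>) \<partial>?Q)"
      using T by (intro nn_integral_density[symmetric]) measurable
    finally have nn: "(\<integral>\<^sup>+\<omega>. ennreal (indicator B \<omega> * indicator C \<omega>) \<partial>?Q) = (\<integral>\<^sup>+\<omega>. ennreal (indicator B \<omega> * m \<omega>) \<partial>?Q)" .
    have "(LINT \<omega>|?Q. indicator B \<omega> * indicat_real C \<omega>) = (LINT \<omega>|?Q. indicator B \<omega> * m \<omega>)"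
      using nn m01 by (subst (1 2) integral_eq_nn_integral) auto
    thus "(\<integral>\<omega>\<in>B. indicator C \<omega> \<partial>?Q) = (\<integral>\<omega>\<in>B. m \<omega> \<partial>?Q)"
      by (simp add: set_lebesgue_integral_def)
  qed
  thus ?thesis by (simp add: C_def m_def)
qed

theorem tilted_process:
  assumes T: "T > 0"
  shows "dunkl_process (density P (\<rho> T)) {0..T} Rp k 0 0 X"
  unfolding dunkl_process_def feller_process_def
proof (intro conjI ballI impI)
  let ?Q = "density P (\<rho> T)"
  show "prob_space ?Q" by (rule prob_space_tilted) (use T in simp)
  show "feller_semigroup K0" by (rule feller_semigroup_K0)
  show "X t \<in> borel_measurable ?Q" if "t \<in> {0..T}" for t using that by simp
  show "rcll_on {0..T} (\<lambda>t. X t \<omega>)" if "\<omega> \<in> space ?Q" for \<omega>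
    using that by (intro rcll_on_subset[OF X_rcll]) auto
  show "AE \<omega> in ?Q. X 0 \<omega> = 0"
    unfolding AE_density[OF \<rho>_measurable[OF less_imp_le[OF T]]] using X_0 by eventually_elim simp
  show "AE \<omega> in ?Q. real_cond_exp ?Q (natural_filtration ?Q {0..T} X s) (indicator (X t -` A \<inter> space ?Q)) \<omega>
      = measure (K0 (t - s) (X s \<omega>)) A"
    if "s \<in> {0..T}" "t \<in> {0..T}" "s < t" "A \<in> sets borel" for s t A
  proof -
    have filt: "natural_filtration ?Q {0..T} X s = F s"
      by (rule natural_filtration_cong) (use that in auto)
    show ?thesis
      unfolding filt space_density by (rule tilted_markov) (use that in auto)
  qed
qed

end

theorem theorem4p3:
  fixes R Rp :: "(real^'n) set" and k :: "real^'n \<Rightarrow> real" and lam :: "real^'n"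
    and P :: "'a measure" and X :: "real \<Rightarrow> 'a \<Rightarrow> real^'n" and T :: real
  assumes "root_system R" and "positive_subsystem R Rp" and "multiplicity_function R k"
    and "prob_space P" and "dunkl_process P {0..} Rp k lam 0 X"
    and "T > 0"
  shows "dunkl_process
           (density P (\<lambda>\<omega>. ennreal (exp ((norm lam)\<^sup>2 * T / 2) / real_dunkl_kernel Rp k (X T \<omega>) lam)))
           {0..T} Rp k 0 0 X"
proof -
  interpret dunkl_system R Rp k by unfold_locales (fact assms)+
  interpret prob_space P by fact
  \<comment> \<open>The Feller property required of the kernels with drift is one of the conjuncts
    of the hypothesis on \<open>X\<close>.\<close>
  interpret dunkl_drift_process R Rp k lam P X
    using assms(5) by unfold_locales (simp_all add: dunkl_process_def feller_process_def)
  show ?thesis using tilted_process[OF assms(6)] unfolding \<rho>_def[abs_def] .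
qed

end
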